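(* Let $C$ be an elliptic curve over $\mathbb{C}$ and $\pi\colon S_1\to C$ the stable ruled surface over $C$. Let $\mathcal{W}$ be the singular holomorphic $2$-web on $S_1$ defined by the sections of $\pi$ of self-intersection $+1$, and let $\mathrm{Ric}$ be the Riccati foliation on $S_1$. Then the discriminant $\Delta$ of $\mathcal{W}$ is a leaf of the foliation $\mathrm{Ric}$.
   Context: Let $C$ be an elliptic curve over $\mathbb{C}$ with origin $p_\infty$. A ruled surface over $C$ is a $\mathbb{P}^1$-fibration $\pi\colon S\to C$; every such surface is $\mathbb{P}(E)$ for a rank $2$ vector bundle $E$ on $C$. It is called stable if every section $\sigma$ has self-intersection $\sigma\cdot\sigma>0$. $S_1=\mathbb{P}(E_1)$, where $E_1$ is the unique nontrivial extension $0\to\mathcal{O}_C\to E_1\to\mathcal{O}_C(p_\infty)\to 0$; up to isomorphism it is the unique stable ruled surface over $C$. The minimal self-intersection of sections of $S_1$ is $1$; sections with self-intersection $1$ are called minimal sections. Through a generic point of $S_1$ there pass exactly two minimal sections, meeting transversally there, and through every point at least one and at most two; $\mathcal{W}$ is the singular $2$-web whose leaves are the minimal sections. Its discriminant $\Delta$ is the set of points of $S_1$ where the two minimal sections through the point coincide (i.e. through which only one minimal section passes). The foliation $\mathrm{Ric}$: write $C=\mathbb{C}/\Lambda$ with $\Lambda=\mathbb{Z}+\tau\mathbb{Z}$, and let $\varrho\colon\Lambda\to \mathrm{PSL}_2(\mathbb{C})$ be given by $\varrho(1)=(z\mapsto -z)$, $\varrho(\tau)=(z\mapsto 1/z)$.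 Then $S_1$ is isomorphic, over $C$, to the quotient of $\mathbb{C}\times\mathbb{P}^1$ by the action $\lambda\cdot(x,z)=(x+\lambda,\varrho(\lambda)(z))$ of $\Lambda$, and $\mathrm{Ric}$ is the regular foliation transverse to the fibres of $\pi$ induced by the horizontal foliation of $\mathbb{C}\times\mathbb{P}^1$. *)

theory Defs
  imports "HOL-Complex_Analysis.Complex_Analysis"
begin

section \<open>The elliptic curve\<close>

definition lattice :: "complex \<Rightarrow> complex set" where
  "lattice \<tau> = {of_int m + of_int n * \<tau> | m n :: int. True}"

definition ecls :: "complex \<Rightarrow> complex \<Rightarrow> complex set" where
  "ecls \<tau> x = {x + l | l. l \<in> lattice \<tau>}"

text \<open>The elliptic curve is the quotient of the complex plane by the lattice; its points are the
  cosets, and the quotient map \<^term>\<open>ecls \<tau>\<close> carries the topology and the complex structure: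
  a function on an open subset of the curve is holomorphic (meromorphic) iff its composition
  with \<^term>\<open>ecls \<tau>\<close> is.\<close>

definition ell_curve :: "complex \<Rightarrow> complex set set" where
  "ell_curve \<tau> = range (ecls \<tau>)"

definition curve_open :: "complex \<Rightarrow> complex set set \<Rightarrow> bool" where
  "curve_open \<tau> U \<longleftrightarrow> U \<subseteq> ell_curve \<tau> \<and> open (ecls \<tau> -` U)"


section \<open>The projective line\<close>

datatype P1 = Aff (coord: complex) | Infty

text \<open>\<^term>\<open>proj v\<close> is the point with homogeneous coordinates \<^term>\<open>v\<close> (meant for nonzero \<^term>\<open>v\<close>).\<close>

definition proj :: "complex ^ 2 \<Rightarrow> P1" where
  "proj v = (if v $ 2 = 0 then Infty else Aff (v $ 1 / v $ 2))"

fun homog :: "P1 \<Rightarrow> complex ^ 2" where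
  "homog (Aff z) = vector [z, 1]"
| "homog Infty = vector [1, 0]"

definition mobius :: "complex ^ 2 ^ 2 \<Rightarrow> P1 \<Rightarrow> P1" where
  "mobius M z = proj (M *v homog z)"

definition P1_neg :: "P1 \<Rightarrow> P1" where
  "P1_neg = mobius (vector [vector [- 1, 0], vector [0, 1]])"

definition P1_inv :: "P1 \<Rightarrow> P1" where
  "P1_inv = mobius (vector [vector [0, 1], vector [1, 0]])"

definition P1_holomorphic_on :: "(complex \<Rightarrow> P1) \<Rightarrow> complex set \<Rightarrow> bool" where
  "P1_holomorphic_on f A \<longleftrightarrow>
     (\<forall>x\<in>A. \<exists>N g. open N \<and> x \<in> N \<and> g holomorphic_on N \<and>
        ((\<forall>y\<in>N. f y = Aff (g y)) \<or> (\<forall>y\<in>N. f y = P1_inv (Aff (g y)))))"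


section \<open>Ruled surfaces over the elliptic curve\<close>

text \<open>A \<open>P\<^sup>1\<close>-fibration over the curve is given by its total space, its projection and an atlas of
  holomorphic local trivialisations.  The member \<^term>\<open>(U, \<phi>)\<close> of the atlas stands for the
  trivialisation \<open>p \<mapsto> (\<pi> p, \<phi> p)\<close> of the part of the surface over the open set \<^term>\<open>U\<close>; only the
  values of \<^term>\<open>\<phi>\<close> over \<^term>\<open>U\<close> matter.\<close>

record 's fibration =
  total :: "'s set"
  bproj :: "'s \<Rightarrow> complex set"
  trivs :: "(complex set set \<times> ('s \<Rightarrow> P1)) set"

definition local_triv ::
    "complex \<Rightarrow> 's fibration \<Rightarrow> complex set set \<Rightarrow> ('s \<Rightarrow> P1) \<Rightarrow> bool" where
  "local_triv \<tau> S U \<phi> \<longleftrightarrow> curve_open \<tau> U \<and>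
     bij_betw (\<lambda>p. (bproj S p, \<phi> p)) {p \<in> total S. bproj S p \<in> U} (U \<times> UNIV)"

text \<open>Holomorphic changes of trivialisation: locally over the intersection of \<^term>\<open>U\<close> and \<^term>\<open>V\<close>,
  \<open>\<psi> = M(\<pi>) \<cdot> \<phi>\<close> for a holomorphic map \<^term>\<open>M\<close> to the invertible matrices.\<close>

definition compatible ::
    "complex \<Rightarrow> 's fibration \<Rightarrow> complex set set \<Rightarrow> ('s \<Rightarrow> P1) \<Rightarrow> complex set set \<Rightarrow> ('s \<Rightarrow> P1) \<Rightarrow> bool"
  where
  "compatible \<tau> S U \<phi> V \<psi> \<longleftrightarrow>
     (\<forall>x. ecls \<tau> x \<in> U \<inter> V \<longrightarrow>
        (\<exists>N M. open N \<and> x \<in> N \<and>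
           (\<forall>i j. (\<lambda>y. M y $ i $ j) holomorphic_on N) \<and>
           (\<forall>y\<in>N. det (M y) \<noteq> 0) \<and>
           (\<forall>y\<in>N. \<forall>p\<in>total S. bproj S p = ecls \<tau> y \<longrightarrow> \<psi> p = mobius (M y) (\<phi> p))))"

definition ruled_surface :: "complex \<Rightarrow> 's fibration \<Rightarrow> bool" where
  "ruled_surface \<tau> S \<longleftrightarrow>
     bproj S ` total S \<subseteq> ell_curve \<tau> \<and>
     (\<forall>(U, \<phi>)\<in>trivs S. local_triv \<tau> S U \<phi>) \<and>
     ell_curve \<tau> \<subseteq> (\<Union>(U, \<phi>)\<in>trivs S. U) \<and>
     (\<forall>(U, \<phi>)\<in>trivs S. \<forall>(V, \<psi>)\<in>trivs S. compatible \<tau> S U \<phi> V \<psi>)"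

definition ruled_iso :: "complex \<Rightarrow> 's fibration \<Rightarrow> 't fibration \<Rightarrow> ('s \<Rightarrow> 't) \<Rightarrow> bool" where
  "ruled_iso \<tau> S T \<Phi> \<longleftrightarrow>
     bij_betw \<Phi> (total S) (total T) \<and>
     (\<forall>p\<in>total S. bproj T (\<Phi> p) = bproj S p) \<and>
     (\<forall>(U, \<phi>)\<in>trivs S. \<forall>(V, \<psi>)\<in>trivs T. compatible \<tau> S U \<phi> V (\<psi> \<circ> \<Phi>))"

definition is_section :: "complex \<Rightarrow> 's fibration \<Rightarrow> (complex set \<Rightarrow> 's) \<Rightarrow> bool" where
  "is_section \<tau> S \<sigma> \<longleftrightarrow>
     (\<forall>c\<in>ell_curve \<tau>. \<sigma> c \<in> total S \<and> bproj S (\<sigma> c) = c) \<and>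
     (\<forall>(U, \<phi>)\<in>trivs S. P1_holomorphic_on (\<lambda>x. \<phi> (\<sigma> (ecls \<tau> x))) (ecls \<tau> -` U))"


section \<open>Self-intersection of a section\<close>

text \<open>The self-intersection of a section \<^term>\<open>\<sigma>\<close> is the degree of its normal bundle.  The normal
  bundle of a section is the bundle of vertical tangent vectors along it, so a meromorphic
  section of it has one meromorphic component \<^term>\<open>s U \<zeta>\<close> in each local fibre coordinate
  \<^term>\<open>(U, \<zeta>)\<close> that is finite along \<^term>\<open>\<sigma>\<close>, and components in different coordinates are related by
  the derivative of the coordinate change along the fibre, at the point of \<^term>\<open>\<sigma>\<close>.\<close>

definition fibre_coord ::
    "complex \<Rightarrow> 's fibration \<Rightarrow> (complex set \<Rightarrow> 's) \<Rightarrow> complex set set \<Rightarrow> ('s \<Rightarrow> P1) \<Rightarrow> bool" where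
  "fibre_coord \<tau> S \<sigma> U \<zeta> \<longleftrightarrow>
     local_triv \<tau> S U \<zeta> \<and>
     (\<forall>(V, \<phi>)\<in>trivs S. compatible \<tau> S V \<phi> U \<zeta>) \<and>
     (\<forall>c\<in>U. \<zeta> (\<sigma> c) \<noteq> Infty)"

definition coord_change_deriv ::
    "'s fibration \<Rightarrow> (complex set \<Rightarrow> 's) \<Rightarrow> ('s \<Rightarrow> P1) \<Rightarrow> ('s \<Rightarrow> P1) \<Rightarrow> complex set \<Rightarrow> complex" where
  "coord_change_deriv S \<sigma> \<zeta> \<xi> c =
     deriv (\<lambda>w. coord (\<xi> (THE p. p \<in> total S \<and> bproj S p = c \<and> \<zeta> p = Aff w))) (coord (\<zeta> (\<sigma> c)))"

text \<open>As usual for meromorphic functions, the transformation rule is only required off a discrete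
  set.  The curve being connected, a section that is not identically zero is nonzero near
  every point (with that point removed).\<close>

definition normal_mero_section ::
    "complex \<Rightarrow> 's fibration \<Rightarrow> (complex set \<Rightarrow> 's) \<Rightarrow>
     (complex set set \<Rightarrow> ('s \<Rightarrow> P1) \<Rightarrow> complex set \<Rightarrow> complex) \<Rightarrow> bool" where
  "normal_mero_section \<tau> S \<sigma> s \<longleftrightarrow>
     (\<forall>U \<zeta>. fibre_coord \<tau> S \<sigma> U \<zeta> \<longrightarrow>
        (\<lambda>x. s U \<zeta> (ecls \<tau> x)) meromorphic_on (ecls \<tau> -` U) \<and>
        (\<forall>x. ecls \<tau> x \<in> U \<longrightarrow> (\<forall>\<^sub>F y in at x. s U \<zeta> (ecls \<tau> y) \<noteq> 0))) \<and>
     (\<forall>U \<zeta> V \<xi>. fibre_coord \<tau> S \<sigma> U \<zeta> \<and> fibre_coord \<tau> S \<sigma> V \<xi> \<longrightarrow>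
        (\<forall>x. ecls \<tau> x \<in> U \<inter> V \<longrightarrow>
           (\<forall>\<^sub>F y in at x. s V \<xi> (ecls \<tau> y) =
              coord_change_deriv S \<sigma> \<zeta> \<xi> (ecls \<tau> y) * s U \<zeta> (ecls \<tau> y))))"

definition normal_section_divisor ::
    "complex \<Rightarrow> 's fibration \<Rightarrow> (complex set \<Rightarrow> 's) \<Rightarrow>
     (complex set set \<Rightarrow> ('s \<Rightarrow> P1) \<Rightarrow> complex set \<Rightarrow> complex) \<Rightarrow> (complex set \<Rightarrow> int) \<Rightarrow> bool" where
  "normal_section_divisor \<tau> S \<sigma> s D \<longleftrightarrow>
     (\<forall>U \<zeta> x. fibre_coord \<tau> S \<sigma> U \<zeta> \<and> ecls \<tau> x \<in> U \<longrightarrow>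
        D (ecls \<tau> x) = zorder (\<lambda>y. s U \<zeta> (ecls \<tau> y)) x)"

definition self_intersection :: "complex \<Rightarrow> 's fibration \<Rightarrow> (complex set \<Rightarrow> 's) \<Rightarrow> int" where
  "self_intersection \<tau> S \<sigma> =
     (THE d. \<exists>s D. normal_mero_section \<tau> S \<sigma> s \<and> normal_section_divisor \<tau> S \<sigma> s D \<and>
        finite {c \<in> ell_curve \<tau>. D c \<noteq> 0} \<and>
        d = (\<Sum>c \<in> {c \<in> ell_curve \<tau>. D c \<noteq> 0}. D c))"

definition stable_ruled :: "complex \<Rightarrow> 's fibration \<Rightarrow> bool" where
  "stable_ruled \<tau> S \<longleftrightarrow> (\<forall>\<sigma>. is_section \<tau> S \<sigma> \<longrightarrow> self_intersection \<tau> S \<sigma> > 0)"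


section \<open>The web of minimal sections and its discriminant\<close>

text \<open>Webs and foliations are represented by their sets of leaves.\<close>

definition minimal_web :: "complex \<Rightarrow> 's fibration \<Rightarrow> 's set set" where
  "minimal_web \<tau> S =
     {\<sigma> ` ell_curve \<tau> | \<sigma>. is_section \<tau> S \<sigma> \<and> self_intersection \<tau> S \<sigma> = 1}"

definition discriminant :: "'s fibration \<Rightarrow> 's set set \<Rightarrow> 's set" where
  "discriminant S \<W> = {p \<in> total S. \<exists>!L. L \<in> \<W> \<and> p \<in> L}"


section \<open>The flat model and the Riccati foliation\<close>

text \<open>\<^term>\<open>rho m n\<close> is the image of \<open>m + n\<tau>\<close> under the monodromy representation.  The images of both
  generators are involutions, which is why the signs of the exponents can be dropped.\<close>

definition rho :: "int \<Rightarrow> int \<Rightarrow> P1 \<Rightarrow> P1" where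
  "rho m n = (P1_neg ^^ nat \<bar>m\<bar>) \<circ> (P1_inv ^^ nat \<bar>n\<bar>)"

definition flat_orbit :: "complex \<Rightarrow> complex \<times> P1 \<Rightarrow> (complex \<times> P1) set" where
  "flat_orbit \<tau> = (\<lambda>(x, z). {(x + (of_int m + of_int n * \<tau>), rho m n z) | m n. True})"

text \<open>Over the image of an open set \<^term>\<open>N\<close> that injects into the curve, the quotient is trivialised
  by the second component of the unique representative over \<^term>\<open>N\<close>.\<close>

definition flat_surface :: "complex \<Rightarrow> (complex \<times> P1) set fibration" where
  "flat_surface \<tau> =
     \<lparr> total = range (flat_orbit \<tau>),
       bproj = (\<lambda>p. fst ` p),
       trivs = {(ecls \<tau> ` N, \<lambda>p. THE z. \<exists>x\<in>N. (x, z) \<in> p) | N. open N \<and> inj_on (ecls \<tau>) N} \<rparr>"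

definition horizontal_foliation :: "(complex \<times> P1) set set" where
  "horizontal_foliation = {UNIV \<times> {z} | z. True}"

text \<open>The horizontal foliation is invariant under the lattice, and the leaves of the foliation it
  induces on the quotient are the images of its leaves.  The argument \<^term>\<open>\<Phi>\<close> is the isomorphism
  from the surface to the quotient along which this foliation is pulled back.\<close>

definition flat_foliation :: "complex \<Rightarrow> (complex \<times> P1) set set set" where
  "flat_foliation \<tau> = (\<lambda>L. flat_orbit \<tau> ` L) ` horizontal_foliation"

definition Ric :: "complex \<Rightarrow> 's fibration \<Rightarrow> ('s \<Rightarrow> (complex \<times> P1) set) \<Rightarrow> 's set set" where
  "Ric \<tau> S \<Phi> = (\<lambda>L. {p \<in> total S. \<Phi> p \<in> L}) ` flat_foliation \<tau>"

end

(* Through the flat model, sections of the surface become maps f from the complex plane to the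
   projective line with f (x + 1) = - f x and f (x + tau) = 1 / f x.  The translation invariant vector
   field, pushed forward by f, is a section of the normal bundle, so the self-intersection of the
   section is the total ramification of f on the curve.  Since f'/f is meromorphic and periodic up to
   sign, its divisor has degree zero (a theta product and Liouville's theorem), and the total
   ramification equals the sum of |ord f| over the curve.  Hence a section is minimal iff f has, modulo
   the lattice, a single simple zero or pole, that is, iff f = sn (x - a) for the theta quotient sn.

   The minimal sections through the point (x, z) correspond to the solutions y of sn y = z modulo twice
   the lattice.  There sn has degree two and is invariant under y -> 1 - y, so there is a single
   solution exactly when y = 1 - y, i.e. when z lies in the monodromy orbit of sn (1/2).  So the
   discriminant is the image of the horizontal leaf z = sn (1/2). *)

theory Submission
  imports Defs
begin

section \<open>Lattices\<close>

text \<open>Three obstacles shape the argument. First, a self-intersection number is a definite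
  description over all meromorphic normal sections, so computing one degree is not enough:
  uniqueness is proved too, from the fact that the quotient of two such sections is elliptic. This
  and the ramification count both rest on \<open>sum_zorder_eq_0\<close>, which admits constant
  factors under the periods because the logarithmic derivative of a twisted function changes sign
  under \<open>\<tau>\<close>. Second, neither a twisted function nor the order of its zeros lives
  on the curve: the twist by \<open>\<tau>\<close> exchanges zeros and poles, so only |ord f|
  descends. To count the fibres of \<open>sn \<tau>\<close>, which is single-valued modulo twice the
  lattice, it is pulled back along x -> 2x to the curve itself, and the same degree theorem applies
  again. Third, theta products converge only for a positive imaginary part, while the statement
  admits every non-real \<open>\<tau>\<close>. The lower half plane is reduced to the upper one at
  the very end.\<close>

lemma lattice_0 [simp]: "0 \<in> lattice \<tau>"
  and lattice_1 [simp]: "1 \<in> lattice \<tau>"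
  and lattice_tau [simp]: "\<tau> \<in> lattice \<tau>"
proof -
  show "0 \<in> lattice \<tau>" unfolding lattice_def by (rule CollectI, rule exI[of _ 0], rule exI[of _ 0]) simp
  show "1 \<in> lattice \<tau>" unfolding lattice_def by (rule CollectI, rule exI[of _ 1], rule exI[of _ 0]) simp
  show "\<tau> \<in> lattice \<tau>" unfolding lattice_def by (rule CollectI, rule exI[of _ 0], rule exI[of _ 1]) simp
qed

lemma latticeI: "of_int m + of_int n * \<tau> \<in> lattice \<tau>"
  unfolding lattice_def by blast

lemma lattice_add: "a \<in> lattice \<tau> \<Longrightarrow> b \<in> lattice \<tau> \<Longrightarrow> a + b \<in> lattice \<tau>"
proof -
  assume "a \<in> lattice \<tau>" "b \<in> lattice \<tau>"
  then obtain m n m' n' where "a = of_int m + of_int n * \<tau>" "b = of_int m' + of_int n' * \<tau>"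
    unfolding lattice_def by blast
  then have "a + b = of_int (m + m') + of_int (n + n') * \<tau>" by (simp add: algebra_simps)
  then show ?thesis using latticeI by metis
qed

lemma lattice_uminus: "a \<in> lattice \<tau> \<Longrightarrow> - a \<in> lattice \<tau>"
proof -
  assume "a \<in> lattice \<tau>"
  then obtain m n where "a = of_int m + of_int n * \<tau>" unfolding lattice_def by blast
  then have "- a = of_int (- m) + of_int (- n) * \<tau>" by (simp add: algebra_simps)
  then show ?thesis using latticeI by metis
qed

lemma lattice_diff: "a \<in> lattice \<tau> \<Longrightarrow> b \<in> lattice \<tau> \<Longrightarrow> a - b \<in> lattice \<tau>"
  using lattice_add[OF _ lattice_uminus] by (metis diff_conv_add_uminus)

lemma ecls_eq_iff: "ecls \<tau> x = ecls \<tau> y \<longleftrightarrow> x - y \<in> lattice \<tau>"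
proof
  assume "ecls \<tau> x = ecls \<tau> y"
  moreover have "x \<in> ecls \<tau> x" unfolding ecls_def by (rule CollectI, rule exI[of _ 0]) simp
  ultimately show "x - y \<in> lattice \<tau>" unfolding ecls_def by auto
next
  assume *: "x - y \<in> lattice \<tau>"
  have "x + l \<in> ecls \<tau> y" if "l \<in> lattice \<tau>" for l
    unfolding ecls_def using lattice_add[OF * that] by (auto intro!: exI[of _ "x - y + l"])
  moreover have "y + l \<in> ecls \<tau> x" if "l \<in> lattice \<tau>" for l
    unfolding ecls_def using lattice_diff[OF that *] by (auto intro!: exI[of _ "l - (x - y)"])
  ultimately show "ecls \<tau> x = ecls \<tau> y" unfolding ecls_def by auto
qed

lemma ecls_add_lattice: "l \<in> lattice \<tau> \<Longrightarrow> ecls \<tau> (x + l) = ecls \<tau> x"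
  by (simp add: ecls_eq_iff)

text \<open>Backward steps are separate hypotheses because \<open>P\<close> is an arbitrary
  predicate, such as equality of two orders that themselves change sign under \<open>\<tau>\<close>,
  and need not come from a periodic function.\<close>

lemma periodic_induct:
  assumes "l \<in> lattice \<tau>" "\<And>x. P x \<Longrightarrow> P (x + 1)" "\<And>x. P x \<Longrightarrow> P (x - 1)"
    "\<And>x. P x \<Longrightarrow> P (x + \<tau>)" "\<And>x. P x \<Longrightarrow> P (x - \<tau>)" "P x"
  shows "P (x + l)"
proof -
  obtain m n where l: "l = of_int m + of_int n * \<tau>" using assms(1) unfolding lattice_def by blast
  have 1: "P (x + of_int m)" for m
  proof (induction m rule: int_induct[where k = 0])
    case (step1 i) then show ?case using assms(2)[of "x + of_int i"] by (simp add: algebra_simps)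
  next
    case (step2 i) then show ?case using assms(3)[of "x + of_int i"] by (simp add: algebra_simps)
  qed (use assms in simp)
  have "P (x + of_int m + of_int n * \<tau>)" for n
  proof (induction n rule: int_induct[where k = 0])
    case (step1 i)
    then show ?case using assms(4)[of "x + of_int m + of_int i * \<tau>"] by (simp add: algebra_simps)
  next
    case (step2 i)
    then show ?case using assms(5)[of "x + of_int m + of_int i * \<tau>"] by (simp add: algebra_simps)
  qed (use 1 in simp)
  then show ?thesis by (simp add: l add.assoc)
qed

lemma periodic_lattice:
  assumes "l \<in> lattice \<tau>" "\<And>x. g (x + 1) = g x" "\<And>x. g (x + \<tau>) = g x"
  shows "g (x + l) = g x"
proof (rule periodic_induct[OF assms(1), where P = "\<lambda>y. g y = g x"])
  show "g (y - 1) = g x" if "g y = g x" for y using assms(2)[of "y - 1"] that by simp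
  show "g (y - \<tau>) = g x" if "g y = g x" for y using assms(3)[of "y - \<tau>"] that by simp
qed (simp_all add: assms)

text \<open>The parallelogram is closed because compactness is what the applications use:
  boundedness for Liouville's theorem and Bolzano-Weierstrass for finiteness.\<close>

definition period_cell :: "complex \<Rightarrow> complex set" where
  "period_cell \<tau> = (\<lambda>(s, t). of_real s + of_real t * \<tau>) ` (cbox 0 1 \<times> cbox 0 1)"

lemma compact_period_cell: "compact (period_cell \<tau>)"
  unfolding period_cell_def
  by (intro compact_continuous_image compact_Times compact_cbox)
    (auto simp: case_prod_unfold intro!: continuous_intros)

lemma lattice_coords:
  assumes "Im \<tau> \<noteq> 0"
  obtains s t :: real where "x = of_real s + of_real t * \<tau>"
proof
  show "x = of_real (Re x - Im x / Im \<tau> * Re \<tau>) + of_real (Im x / Im \<tau>) * \<tau>"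
    using assms by (simp add: complex_eq_iff)
qed

lemma lattice_reduce:
  assumes "Im \<tau> \<noteq> 0"
  obtains l where "l \<in> lattice \<tau>" "x + l \<in> period_cell \<tau>"
proof -
  obtain s t where x: "x = of_real s + of_real t * \<tau>" using lattice_coords[OF assms] .
  show ?thesis
  proof
    show "of_int (- \<lfloor>s\<rfloor>) + of_int (- \<lfloor>t\<rfloor>) * \<tau> \<in> lattice \<tau>" by (rule latticeI)
    have "x + (of_int (- \<lfloor>s\<rfloor>) + of_int (- \<lfloor>t\<rfloor>) * \<tau>) = of_real (frac s) + of_real (frac t) * \<tau>"
      by (simp add: x frac_def algebra_simps)
    moreover have "frac s \<in> cbox 0 1" "frac t \<in> cbox 0 1"
      using frac_lt_1[of s] frac_lt_1[of t] by (auto simp: less_imp_le)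
    ultimately show "x + (of_int (- \<lfloor>s\<rfloor>) + of_int (- \<lfloor>t\<rfloor>) * \<tau>) \<in> period_cell \<tau>"
      unfolding period_cell_def by (auto intro!: image_eqI[of _ _ "(frac s, frac t)"])
  qed
qed

lemma lattice_coords_unique:
  assumes "Im \<tau> \<noteq> 0" "of_int m + of_int n * \<tau> = of_int m' + of_int n' * \<tau>"
  shows "m = m' \<and> n = n'"
  using assms by (auto simp: complex_eq_iff)

lemma lattice_discrete:
  assumes "Im \<tau> \<noteq> 0"
  obtains e where "e > 0" "\<And>l. l \<in> lattice \<tau> \<Longrightarrow> l \<noteq> 0 \<Longrightarrow> e \<le> norm l"
proof
  \<comment> \<open>For n = 0 the vector is a nonzero integer, of norm at least 1; otherwise its
    imaginary part is at least that of \<open>\<tau>\<close> in absolute value.\<close>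
  show "min 1 \<bar>Im \<tau>\<bar> > 0" using assms by simp
  show "min 1 \<bar>Im \<tau>\<bar> \<le> norm l" if that: "l \<in> lattice \<tau>" "l \<noteq> 0" for l
  proof -
    from that(1) obtain m n where l: "l = of_int m + of_int n * \<tau>" unfolding lattice_def by blast
    show ?thesis
    proof (cases "n = 0")
      case True
      then have "m \<noteq> 0" using that l by auto
      then have "1 \<le> norm l" using True by (simp add: l)
      then show ?thesis by simp
    next
      case False
      then have "1 * \<bar>Im \<tau>\<bar> \<le> \<bar>of_int n\<bar> * \<bar>Im \<tau>\<bar>" by (intro mult_right_mono) auto
      also have "\<dots> = \<bar>Im l\<bar>" by (simp add: l abs_mult)
      also have "\<dots> \<le> norm l" by (rule abs_Im_le_cmod)
      finally show ?thesis by simp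
    qed
  qed
qed

lemma entire_elliptic_constant:
  assumes "Im \<tau> \<noteq> 0" "f holomorphic_on UNIV" "\<And>x. f (x + 1) = f x" "\<And>x. f (x + \<tau>) = f x"
  obtains c where "\<And>x. f x = c"
proof -
  have "compact (f ` period_cell \<tau>)"
    by (intro compact_continuous_image compact_period_cell)
      (use assms(2) holomorphic_on_imp_continuous_on holomorphic_on_subset in blast)
  moreover have "range f \<subseteq> f ` period_cell \<tau>"
  proof (clarify)
    fix x obtain l where "l \<in> lattice \<tau>" "x + l \<in> period_cell \<tau>" using lattice_reduce[OF assms(1)] .
    then show "f x \<in> f ` period_cell \<tau>" using periodic_lattice[of l \<tau> f x] assms by (metis image_eqI)
  qed
  ultimately have "bounded (range f)" using bounded_subset compact_imp_bounded by blast
  from Liouville_theorem[OF assms(2) this] obtain c where "\<And>x. f x = c"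
    unfolding constant_on_def by blast
  then show ?thesis using that by blast
qed

text \<open>The discrete set of exceptional points meets the compact period cell in finitely many points.\<close>

lemma finite_classes:
  assumes "Im \<tau> \<noteq> 0" "\<And>x. \<forall>\<^sub>F y in at x. ecls \<tau> y \<notin> A" "A \<subseteq> ell_curve \<tau>"
  shows "finite A"
proof -
  define B where "B = {x. ecls \<tau> x \<in> A} \<inter> period_cell \<tau>"
  have "\<not> x islimpt B" for x
    using assms(2)[of x] unfolding islimpt_iff_eventually B_def by (auto elim: eventually_mono)
  then have "finite B"
    using Heine_Borel_imp_Bolzano_Weierstrass[OF compact_period_cell[of \<tau>], of B] by (auto simp: B_def)
  moreover have "A \<subseteq> ecls \<tau> ` B"
  proof
    fix c assume c: "c \<in> A"
    then obtain x where x: "c = ecls \<tau> x" using assms(3) unfolding ell_curve_def by blast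
    obtain l where l: "l \<in> lattice \<tau>" "x + l \<in> period_cell \<tau>" using lattice_reduce[OF assms(1)] .
    then show "c \<in> ecls \<tau> ` B" using c x ecls_add_lattice[OF l(1), of x] unfolding B_def
      by (intro image_eqI[of _ _ "x + l"]) auto
  qed
  ultimately show ?thesis using finite_surj by blast
qed

section \<open>Theta functions\<close>

text \<open>The q-Pochhammer symbol (u; q) of infinite length.\<close>

definition qprod :: "complex \<Rightarrow> complex \<Rightarrow> complex" where
  "qprod q u = (\<Prod>n. 1 - q ^ n * u)"

lemma summable_qprod:
  fixes q u :: complex
  assumes "norm q < 1"
  shows "summable (\<lambda>n. norm (q ^ n * u))"
proof -
  have "summable (\<lambda>n. norm q ^ n * norm u)"
    using summable_mult2[OF summable_geometric[of "norm q"], of "norm u"] assms by simp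
  then show ?thesis by (simp only: norm_mult norm_power)
qed

lemma convergent_qprod:
  fixes q u :: complex
  assumes "norm q < 1"
  shows "convergent_prod (\<lambda>n. 1 - q ^ n * u)"
proof -
  have "abs_convergent_prod (\<lambda>n. 1 + (- (q ^ n * u)))"
    by (rule summable_imp_abs_convergent_prod) (use summable_qprod[OF assms, of u] in simp)
  then show ?thesis by (simp add: abs_convergent_prod_imp_convergent_prod)
qed

lemma qprod_eq_0_iff:
  assumes "norm q < 1"
  shows "qprod q u = 0 \<longleftrightarrow> (\<exists>n. q ^ n * u = 1)"
proof -
  have "(\<lambda>n. 1 - q ^ n * u) has_prod qprod q u"
    unfolding qprod_def using convergent_qprod[OF assms] by (rule convergent_prod_has_prod)
  from has_prod_eq_0_iff[OF this] show ?thesis by auto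
qed

lemma qprod_rec:
  assumes "norm q < 1"
  shows "qprod q u = (1 - u) * qprod q (q * u)"
proof (cases "u = 1")
  case True
  then show ?thesis using qprod_eq_0_iff[OF assms, of u] by (auto intro: exI[of _ 0])
next
  case False
  have "qprod q u = (1 - q ^ 0 * u) * (\<Prod>n. 1 - q ^ Suc n * u)"
    unfolding qprod_def using False
    by (subst prodinf_split_head[OF convergent_qprod[OF assms]]) auto
  then show ?thesis by (simp add: qprod_def mult_ac)
qed

lemma uniform_limit_qprod:
  assumes "norm q < 1"
  shows "uniform_limit (cball 0 R) (\<lambda>N u. \<Prod>n<N. 1 - q ^ n * u) (qprod q) sequentially"
proof -
  have "uniformly_convergent_on (cball 0 R) (\<lambda>N u. \<Prod>n<N. 1 - q ^ n * u)"
  proof (rule uniformly_convergent_on_prod')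
    show "uniformly_convergent_on (cball 0 R) (\<lambda>N u. \<Sum>n<N. norm (1 - q ^ n * u - 1))"
    proof (rule Weierstrass_m_test')
      show "norm (norm (1 - q ^ n * u - 1)) \<le> norm q ^ n * \<bar>R\<bar>" if "u \<in> cball 0 R" for n u
        using that by (auto simp: norm_mult norm_power intro!: mult_left_mono)
      show "summable (\<lambda>n. norm q ^ n * \<bar>R\<bar>)"
        using summable_mult2[OF summable_geometric[of "norm q"], of "\<bar>R\<bar>"] assms by simp
    qed
  qed (auto intro!: continuous_intros)
  then obtain g where g: "uniform_limit (cball 0 R) (\<lambda>N u. \<Prod>n<N. 1 - q ^ n * u) g sequentially"
    by (auto simp: uniformly_convergent_on_def)
  have "g u = qprod q u" if u: "u \<in> cball 0 R" for u
  proof (rule LIMSEQ_unique)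
    \<comment> \<open>The shift to \<open>Suc N\<close> is needed because convergence of an infinite
      product is phrased with partial products over \<open>{..N}\<close>.\<close>
    show "(\<lambda>N. \<Prod>n<Suc N. 1 - q ^ n * u) \<longlonglongrightarrow> g u"
      using LIMSEQ_Suc[OF tendsto_uniform_limitI[OF g u]] .
    show "(\<lambda>N. \<Prod>n<Suc N. 1 - q ^ n * u) \<longlonglongrightarrow> qprod q u"
      using convergent_prod_LIMSEQ[OF convergent_qprod[OF assms, of u]]
      unfolding lessThan_Suc_atMost by (simp add: qprod_def)
  qed
  with uniform_limit_cong'[of "cball 0 R" "\<lambda>N u. \<Prod>n<N. 1 - q ^ n * u" _ g "qprod q"] g
  show ?thesis by simp
qed

lemma holomorphic_qprod:
  assumes "norm q < 1"
  shows "qprod q holomorphic_on UNIV"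
proof (rule holomorphic_uniform_sequence[OF open_UNIV])
  fix z :: complex
  have "uniform_limit (cball z 1) (\<lambda>N u. \<Prod>n<N. 1 - q ^ n * u) (qprod q) sequentially"
    by (rule uniform_limit_on_subset[OF uniform_limit_qprod[OF assms, of "norm z + 1"]])
      (simp add: cball_subset_cball_iff)
  then show "\<exists>d>0. cball z d \<subseteq> UNIV \<and>
      uniform_limit (cball z d) (\<lambda>N u. \<Prod>n<N. 1 - q ^ n * u) (qprod q) sequentially"
    by (intro exI[of _ 1]) auto
qed (auto intro!: holomorphic_intros)

lemma holomorphic_qprod_compose:
  assumes "norm q < 1" "g holomorphic_on A"
  shows "(\<lambda>x. qprod q (g x)) holomorphic_on A"
  using holomorphic_on_compose[OF assms(2) holomorphic_on_subset[OF holomorphic_qprod[OF assms(1)]]]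
  by (simp add: o_def)

text \<open>The covering of the punctured plane with kernel the integers. With q =
  \<open>wexp \<tau>\<close> the torus becomes the punctured plane modulo powers of q.\<close>

definition wexp :: "complex \<Rightarrow> complex" where
  "wexp x = exp (2 * of_real pi * \<i> * x)"

lemma wexp_add: "wexp (x + y) = wexp x * wexp y"
  by (simp add: wexp_def exp_add[symmetric] algebra_simps)

lemma wexp_nonzero [simp]: "wexp x \<noteq> 0"
  by (simp add: wexp_def)

lemma wexp_uminus: "wexp (- x) = inverse (wexp x)"
  by (simp add: wexp_def exp_minus)

lemma wexp_of_nat_mult: "wexp (of_nat n * x) = wexp x ^ n"
  by (simp add: wexp_def exp_of_nat_mult[symmetric] algebra_simps)

lemma wexp_eq_1_iff: "wexp x = 1 \<longleftrightarrow> (\<exists>m::int. x = of_int m)"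
proof -
  have "wexp x = 1 \<longleftrightarrow> Im x = 0 \<and> (\<exists>m::int. 2 * pi * Re x = of_int (2 * m) * pi)"
    by (auto simp: wexp_def exp_eq_1)
  also have "\<dots> \<longleftrightarrow> (\<exists>m::int. x = of_int m)"
    by (auto simp: complex_eq_iff)
  finally show ?thesis .
qed

lemma wexp_1 [simp]: "wexp 1 = 1"
  using wexp_eq_1_iff[of 1] by (metis of_int_1)

lemma norm_wexp: "norm (wexp x) = exp (- 2 * pi * Im x)"
  by (simp add: wexp_def)

text \<open>Up to a constant and an exponential factor this is Jacobi's theta function with zeros on
  the lattice: the triple product without the factor that depends on q alone.\<close>

definition theta :: "complex \<Rightarrow> complex \<Rightarrow> complex" where
  "theta \<tau> x = qprod (wexp \<tau>) (wexp x) * qprod (wexp \<tau>) (wexp \<tau> * wexp (- x))"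

lemma norm_wexp_less_1: "Im \<tau> > 0 \<Longrightarrow> norm (wexp \<tau>) < 1"
  by (simp add: norm_wexp)

lemma holomorphic_wexp [holomorphic_intros]:
  "f holomorphic_on A \<Longrightarrow> (\<lambda>x. wexp (f x)) holomorphic_on A"
  unfolding wexp_def by (intro holomorphic_intros)

lemma holomorphic_theta:
  assumes "Im \<tau> > 0"
  shows "theta \<tau> holomorphic_on UNIV"
  unfolding theta_def
  by (intro holomorphic_intros holomorphic_qprod_compose norm_wexp_less_1[OF assms])

lemma theta_plus_1: "theta \<tau> (x + 1) = theta \<tau> x"
  using wexp_add[of "- x" "- 1"] by (simp add: theta_def wexp_add wexp_uminus[of 1])

text \<open>Splitting off the head of one product leaves 1 - w times a product symmetric under w ->
  1/w, and 1 - 1/w = -(1 - w)/w.\<close>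

lemma theta_uminus:
  assumes "Im \<tau> > 0"
  shows "theta \<tau> (- x) = - theta \<tau> x / wexp x"
proof -
  let ?P = "qprod (wexp \<tau>)"
  note r = qprod_rec[OF norm_wexp_less_1[OF assms]]
  have 1: "theta \<tau> (- x) = (1 - wexp (- x)) * ?P (wexp \<tau> * wexp (- x)) * ?P (wexp \<tau> * wexp x)"
    unfolding theta_def by (subst r) simp
  have 2: "theta \<tau> x = (1 - wexp x) * ?P (wexp \<tau> * wexp x) * ?P (wexp \<tau> * wexp (- x))"
    unfolding theta_def by (subst r) simp
  show ?thesis unfolding 1 2 by (simp add: wexp_uminus field_simps)
qed

text \<open>The reflection exchanges the two factors of the product.\<close>

lemma theta_tau_minus: "theta \<tau> (\<tau> - x) = theta \<tau> x"
proof -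
  have "wexp (\<tau> - x) = wexp \<tau> * wexp (- x)" using wexp_add[of \<tau> "- x"] by simp
  moreover have "wexp \<tau> * wexp (x - \<tau>) = wexp x" using wexp_add[of \<tau> "x - \<tau>"] by simp
  ultimately show ?thesis by (simp add: theta_def mult.commute)
qed

text \<open>Translation by \<open>\<tau>\<close> is the composition of the reflections x -> -x and x
  -> \<open>\<tau>\<close> - x.\<close>

lemma theta_plus_tau:
  assumes "Im \<tau> > 0"
  shows "theta \<tau> (x + \<tau>) = - theta \<tau> x / wexp x"
  using theta_tau_minus[of \<tau> "- x"] theta_uminus[OF assms] by (simp add: add.commute)

text \<open>The two factors share the lattice between them: the first vanishes where the coefficient
  of \<open>\<tau>\<close> is at most 0, the second where it is positive.\<close>

lemma theta_eq_0_iff: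
  assumes "Im \<tau> > 0"
  shows "theta \<tau> x = 0 \<longleftrightarrow> x \<in> lattice \<tau>"
proof -
  note z = qprod_eq_0_iff[OF norm_wexp_less_1[OF assms]]
  have *: "wexp \<tau> ^ n * wexp y = 1 \<longleftrightarrow> (\<exists>m::int. y = of_int m - of_nat n * \<tau>)" for n y
  proof -
    have "wexp \<tau> ^ n * wexp y = wexp (of_nat n * \<tau> + y)" by (simp add: wexp_add wexp_of_nat_mult)
    then show ?thesis by (simp add: wexp_eq_1_iff algebra_simps)
  qed
  have "theta \<tau> x = 0 \<longleftrightarrow> (\<exists>n::nat. \<exists>m::int. x = of_int m - of_nat n * \<tau>) \<or>
      (\<exists>n::nat. \<exists>m::int. - x = of_int m - of_nat (Suc n) * \<tau>)"
    unfolding theta_def mult_eq_0_iff z using *[of _ x] *[of "Suc _" "- x"]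
    by (simp add: power_Suc2 mult.assoc del: power_Suc)
  also have "\<dots> \<longleftrightarrow> x \<in> lattice \<tau>"
  proof
    assume "(\<exists>n::nat. \<exists>m::int. x = of_int m - of_nat n * \<tau>) \<or>
      (\<exists>n::nat. \<exists>m::int. - x = of_int m - of_nat (Suc n) * \<tau>)"
    then show "x \<in> lattice \<tau>"
    proof
      assume "\<exists>n::nat. \<exists>m::int. x = of_int m - of_nat n * \<tau>"
      then obtain n :: nat and m :: int where "x = of_int m + of_int (- int n) * \<tau>" by auto
      then show ?thesis using latticeI by metis
    next
      assume "\<exists>n::nat. \<exists>m::int. - x = of_int m - of_nat (Suc n) * \<tau>"
      then obtain n :: nat and m :: int where "- x = of_int m - of_nat (Suc n) * \<tau>" by blast
      then have "- x = of_int m + of_int (- int (Suc n)) * \<tau>" by (simp add: algebra_simps)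
      then have "- x \<in> lattice \<tau>" by (simp only: latticeI)
      then show ?thesis using lattice_uminus[of "- x" \<tau>] by simp
    qed
  next
    assume "x \<in> lattice \<tau>"
    then obtain m n where x: "x = of_int m + of_int n * \<tau>" unfolding lattice_def by blast
    show "(\<exists>n::nat. \<exists>m::int. x = of_int m - of_nat n * \<tau>) \<or>
      (\<exists>n::nat. \<exists>m::int. - x = of_int m - of_nat (Suc n) * \<tau>)"
    proof (cases "n \<le> 0")
      case True
      then have "x = of_int m - of_nat (nat (- n)) * \<tau>" by (simp add: x)
      then show ?thesis by blast
    next
      case False
      then have "Suc (nat (n - 1)) = nat n" by simp
      then have "- x = of_int (- m) - of_nat (Suc (nat (n - 1))) * \<tau>"
        using False by (simp add: x del: of_nat_Suc)
      then show ?thesis by blast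
    qed
  qed
  finally show ?thesis .
qed

text \<open>By quasi-periodicity it suffices to look at the origin, where the factor \<open>1 - wexp x\<close> has a
  simple zero.\<close>

lemma zorder_theta:
  assumes "Im \<tau> > 0"
  shows "zorder (theta \<tau>) x = (if x \<in> lattice \<tau> then 1 else 0)"
proof -
  have hol: "theta \<tau> holomorphic_on UNIV" by (rule holomorphic_theta[OF assms])
  let ?P = "qprod (wexp \<tau>)"
  define k where "k = (\<lambda>x. ?P (wexp \<tau> * wexp x) * ?P (wexp \<tau> * wexp (- x)))"
  have th: "theta \<tau> x = (1 - wexp x) * k x" for x
    unfolding theta_def k_def by (subst qprod_rec[OF norm_wexp_less_1[OF assms]]) simp
  have k: "k holomorphic_on UNIV"
    unfolding k_def
    by (intro holomorphic_intros holomorphic_qprod_compose norm_wexp_less_1[OF assms])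
  have "wexp \<tau> ^ n * wexp \<tau> \<noteq> 1" for n
  proof -
    have "norm (wexp \<tau> ^ Suc n) < 1"
      using norm_wexp_less_1[OF assms] unfolding norm_power by (intro power_Suc_less_one) auto
    then show ?thesis by (auto simp: mult.commute)
  qed
  then have k0: "k 0 \<noteq> 0"
    using qprod_eq_0_iff[OF norm_wexp_less_1[OF assms]] wexp_eq_1_iff[of 0]
    by (auto simp: k_def intro: exI[of _ 0])
  have d: "deriv (theta \<tau>) 0 \<noteq> 0"
  proof -
    have "((\<lambda>x. (1 - wexp x) * k x) has_field_derivative
      - (2 * of_real pi * \<i>) * k 0) (at 0)"
      unfolding wexp_def using holomorphic_derivI[OF k open_UNIV, of 0]
      by (auto intro!: derivative_eq_intros)
    then have "deriv (theta \<tau>) 0 = - (2 * of_real pi * \<i>) * k 0"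
      using DERIV_imp_deriv by (simp add: th[abs_def])
    then show ?thesis using k0 by simp
  qed
  \<comment> \<open>The conjunction says that a point is a multiple zero. At a zero the product rule
    leaves only \<open>c y\<close> times the derivative, and \<open>c\<close> has no zeros, so
    quasi-periodicity preserves multiple zeros in both directions.\<close>
  have per: "deriv (theta \<tau>) y = 0 \<and> y \<in> lattice \<tau> \<longleftrightarrow> deriv (theta \<tau>) y' = 0 \<and> y' \<in> lattice \<tau>"
    if e: "\<And>x. theta \<tau> (x + (y' - y)) = c x * theta \<tau> x"
      and c: "c holomorphic_on UNIV" "\<And>x. c x \<noteq> 0" and l: "y' - y \<in> lattice \<tau>" for y y' c
  proof -
    have "y' \<in> lattice \<tau> \<longleftrightarrow> y \<in> lattice \<tau>"
      using lattice_add[OF l, of y] lattice_diff[of y' \<tau>, OF _ l] by auto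
    moreover have "deriv (theta \<tau>) y' = c y * deriv (theta \<tau>) y" if "y \<in> lattice \<tau>"
    proof -
      have "((\<lambda>x. theta \<tau> (x + (y' - y))) has_field_derivative deriv (theta \<tau>) y') (at y)"
        using DERIV_shift[of "theta \<tau>" "deriv (theta \<tau>) y'" y "y' - y"]
          holomorphic_derivI[OF hol open_UNIV, of y'] by simp
      moreover have "((\<lambda>x. c x * theta \<tau> x) has_field_derivative c y * deriv (theta \<tau>) y) (at y)"
        using holomorphic_derivI[OF hol open_UNIV, of y] holomorphic_derivI[OF c(1) open_UNIV, of y]
          theta_eq_0_iff[OF assms, of y] that by (auto intro!: derivative_eq_intros)
      ultimately show ?thesis using DERIV_unique by (simp add: e)
    qed
    ultimately show ?thesis using c(2)[of y] by auto
  qed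
  show ?thesis
  proof (cases "x \<in> lattice \<tau>")
    case False
    then show ?thesis
      using zorder_zero_eqI[OF hol open_UNIV, of x 0] theta_eq_0_iff[OF assms, of x] by auto
  next
    case True
    have cinv: "(\<lambda>x. - 1 / wexp x) holomorphic_on UNIV" "(\<lambda>x. - wexp x) holomorphic_on UNIV"
      by (intro holomorphic_intros; simp)+
    have tau: "deriv (theta \<tau>) y = 0 \<and> y \<in> lattice \<tau> \<longleftrightarrow> deriv (theta \<tau>) (y + \<tau>) = 0 \<and> y + \<tau> \<in> lattice \<tau>" for y
      by (rule per[of "y + \<tau>" y "\<lambda>x. - 1 / wexp x"]) (use cinv theta_plus_tau[OF assms] in auto)
    have one: "deriv (theta \<tau>) y = 0 \<and> y \<in> lattice \<tau> \<longleftrightarrow> deriv (theta \<tau>) (y + 1) = 0 \<and> y + 1 \<in> lattice \<tau>" for y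
      by (rule per[of "y + 1" y "\<lambda>x. 1"]) (use theta_plus_1 in auto)
    have "\<not> (deriv (theta \<tau>) (0 + x) = 0 \<and> 0 + x \<in> lattice \<tau>)"
      by (rule periodic_induct[OF True, where P = "\<lambda>y. \<not> (deriv (theta \<tau>) y = 0 \<and> y \<in> lattice \<tau>)"])
        (use one tau d one[of "_ - 1"] tau[of "_ - \<tau>"] in auto)
    then show ?thesis
      using zorder_zero_eqI[OF hol open_UNIV, of x 1] theta_eq_0_iff[OF assms, of x] True by auto
  qed
qed

section \<open>Orders of quasi-periodic meromorphic functions\<close>

lemma eventually_at_shift:
  fixes x l :: "'a :: real_normed_vector"
  assumes "\<forall>\<^sub>F y in at (x + l). P y"
  shows "\<forall>\<^sub>F y in at x. P (y + l)"
proof -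
  obtain d where d: "d > 0" "\<And>y. y \<noteq> x + l \<Longrightarrow> dist y (x + l) < d \<Longrightarrow> P y"
    using assms unfolding eventually_at by auto
  have "P (y + l)" if "y \<noteq> x" "dist y x < d" for y
    using d(2)[of "y + l"] that by (simp add: dist_norm)
  then show ?thesis using d(1) unfolding eventually_at by auto
qed

lemma zorder_translate: "zorder (\<lambda>y. f (y + l)) x = zorder f (x + l)"
  using zorder_shift[of f "x + l"] zorder_shift[of "\<lambda>y. f (y + l)" x] by (simp add: add.assoc)

lemma zorder_quasiperiodic:
  assumes "c \<noteq> 0" "\<forall>\<^sub>F y in at x. R (y + l) = c * R y"
  shows "zorder R (x + l) = zorder R x"
proof -
  have "zorder R (x + l) = zorder (\<lambda>y. c * R y) x"
    unfolding zorder_translate[symmetric] by (rule zorder_cong[OF assms(2) refl])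
  then show ?thesis using zorder_cmult[OF assms(1)] by simp
qed

lemma zorder_lattice_periodic:
  assumes "c1 \<noteq> 0" "c2 \<noteq> 0" "\<And>x. \<forall>\<^sub>F y in at x. R (y + 1) = c1 * R y"
    "\<And>x. \<forall>\<^sub>F y in at x. R (y + \<tau>) = c2 * R y" "ecls \<tau> x = ecls \<tau> y"
  shows "zorder R x = zorder R y"
proof -
  have "x - y \<in> lattice \<tau>" using assms(5) by (simp add: ecls_eq_iff)
  from periodic_lattice[OF this, of "zorder R" y] show ?thesis
    using zorder_quasiperiodic[OF assms(1,3)] zorder_quasiperiodic[OF assms(2,4)] by simp
qed

lemma zorder_nonzero_value:
  assumes "f analytic_on {x}" "f x \<noteq> 0"
  shows "zorder f x = 0"
  using zorder_zero_eqI'[OF assms(1), of 0] assms(2) by simp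

lemma eventually_zorder_eq_0:
  assumes "R meromorphic_on UNIV" "\<forall>\<^sub>F y in at x. R y \<noteq> 0"
  shows "\<forall>\<^sub>F y in at x. zorder R y = 0"
proof -
  have "isolated_singularity_at R x" using assms(1) by (simp add: meromorphic_on_altdef)
  then have "\<forall>\<^sub>F y in at x. R analytic_on {y}" using isolated_singularity_at_altdef by blast
  then show ?thesis using assms(2) by eventually_elim (rule zorder_nonzero_value)
qed

lemma zorder_0_limit:
  assumes "R meromorphic_on {x}" "\<forall>\<^sub>F y in at x. R y \<noteq> 0" "zorder R x = 0"
  obtains c where "R \<midarrow>x\<rightarrow> c" "c \<noteq> 0"
proof -
  have "isolated_singularity_at R x" "not_essential R x"
    using assms(1) by (auto simp: meromorphic_at_iff)
  from zorder_exist[OF this eventually_frequently[OF at_neq_bot assms(2)]] assms(3)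
  obtain r where r: "r > 0" "zor_poly R x x \<noteq> 0" "zor_poly R x holomorphic_on cball x r"
    "\<And>w. w \<in> cball x r - {x} \<Longrightarrow> R w = zor_poly R x w" by auto
  have "continuous_on (ball x r) (zor_poly R x)"
    using holomorphic_on_imp_continuous_on[OF r(3)] continuous_on_subset ball_subset_cball by blast
  then have "zor_poly R x \<midarrow>x\<rightarrow> zor_poly R x x"
    using r(1) by (simp add: continuous_on_eq_continuous_at isCont_def)
  moreover have "\<forall>\<^sub>F w in at x. R w = zor_poly R x w"
    using r(1,4) unfolding eventually_at by (auto intro!: exI[of _ r] simp: dist_commute)
  ultimately have "R \<midarrow>x\<rightarrow> zor_poly R x x" using tendsto_cong by blast
  then show ?thesis using that r(2) by blast
qed

text \<open>Order 0 means a finite nonzero limit, so all singularities are removable and filling in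
  the limits creates no zero.\<close>

lemma entire_zorder_0:
  assumes "R meromorphic_on UNIV" "\<And>x. \<forall>\<^sub>F y in at x. R y \<noteq> 0" "\<And>x. zorder R x = 0"
  shows "remove_sings R holomorphic_on UNIV" "remove_sings R x \<noteq> 0"
proof -
  have lim: "\<exists>c. R \<midarrow>x\<rightarrow> c \<and> c \<noteq> 0" for x
    using zorder_0_limit[of R x] assms meromorphic_on_subset by (metis subset_UNIV)
  then show "remove_sings R x \<noteq> 0" using remove_sings_eqI by blast
  have "remove_sings R analytic_on {x}" for x
    using lim[of x] remove_sings_analytic_at assms(1) by (auto simp: meromorphic_on_altdef)
  then show "remove_sings R holomorphic_on UNIV"
    using analytic_on_analytic_at analytic_imp_holomorphic by blast
qed

lemma remove_sings_translate: "remove_sings (\<lambda>y. f (y + l)) x = remove_sings f (x + l)"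
  using remove_sings_shift_0[of f "x + l"] remove_sings_shift_0[of "\<lambda>y. f (y + l)" x]
  by (simp add: add_ac)

section \<open>Divisors of quasi-periodic meromorphic functions have degree zero\<close>

lemma eventually_theta_nonzero:
  assumes "Im \<tau> > 0"
  shows "\<forall>\<^sub>F y in at x. theta \<tau> (y - a) \<noteq> 0"
proof (cases "x - a \<in> lattice \<tau>")
  case True
  obtain e where e: "e > 0" "\<And>l. l \<in> lattice \<tau> \<Longrightarrow> l \<noteq> 0 \<Longrightarrow> e \<le> norm l"
    using lattice_discrete[of \<tau>] assms by auto
  have "theta \<tau> (y - a) \<noteq> 0" if "y \<noteq> x" "dist y x < e" for y
  proof
    assume "theta \<tau> (y - a) = 0"
    then have "y - x \<in> lattice \<tau>"
      using True lattice_diff[of "y - a" \<tau> "x - a"] theta_eq_0_iff[OF assms] by simp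
    then show False using e(2)[of "y - x"] that by (simp add: dist_norm)
  qed
  then show ?thesis using e(1) unfolding eventually_at by auto
next
  case False
  have "continuous_on UNIV (\<lambda>y. theta \<tau> (y - a))"
    by (intro continuous_on_compose2[OF holomorphic_on_imp_continuous_on[OF holomorphic_theta[OF assms]]]
        continuous_intros) auto
  then have "(\<lambda>y. theta \<tau> (y - a)) \<midarrow>x\<rightarrow> theta \<tau> (x - a)"
    by (simp add: continuous_on_eq_continuous_at isCont_def)
  then show ?thesis
    by (rule tendsto_imp_eventually_ne) (use False theta_eq_0_iff[OF assms] in auto)
qed

text \<open>The logarithmic derivative of such a function would be additively quasi-periodic, and its
  derivative elliptic.\<close>

lemma entire_quasiperiodic_factor:
  assumes "Im \<tau> \<noteq> 0" "Q holomorphic_on UNIV" "\<And>x. Q x \<noteq> 0"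
    "c \<noteq> 0" "\<And>x. Q (x + 1) = c * Q x"
    "K \<noteq> 0" "\<And>x. Q (x + \<tau>) = K * exp (k * x) * Q x"
  shows "k = 0"
proof -
  define H where "H = (\<lambda>x. deriv Q x / Q x)"
  have H: "H holomorphic_on UNIV"
    unfolding H_def by (intro holomorphic_intros assms) auto
  have Hshift: "H (x + l) = H x + b"
    if e: "\<And>x. Q (x + l) = B * exp (b * x) * Q x" and "B \<noteq> 0" for l B b x
  proof -
    have "((\<lambda>x. Q (x + l)) has_field_derivative deriv Q (x + l)) (at x)"
      using DERIV_shift[of Q "deriv Q (x + l)" x l] holomorphic_derivI[OF assms(2) open_UNIV, of "x + l"]
      by simp
    moreover have "((\<lambda>x. B * exp (b * x) * Q x) has_field_derivative
        B * (exp (b * x) * b) * Q x + B * exp (b * x) * deriv Q x) (at x)"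
      using holomorphic_derivI[OF assms(2) open_UNIV, of x]
      by (auto intro!: derivative_eq_intros)
    ultimately have "deriv Q (x + l) = B * (exp (b * x) * b) * Q x + B * exp (b * x) * deriv Q x"
      using DERIV_unique by (simp add: e)
    then show ?thesis unfolding H_def e using assms(3)[of x] \<open>B \<noteq> 0\<close> by (simp add: field_simps)
  qed
  have H1: "H (x + 1) = H x" for x using Hshift[of 1 c 0] assms by simp
  have Htau: "H (x + \<tau>) = H x + k" for x using Hshift[of \<tau> K k] assms by simp
  have "deriv H (x + l) = deriv H x" if "\<And>x. H (x + l) = H x + b" for x l b
  proof -
    have "((\<lambda>x. H (x + l)) has_field_derivative deriv H (x + l)) (at x)"
      using DERIV_shift[of H "deriv H (x + l)" x l] holomorphic_derivI[OF H open_UNIV, of "x + l"]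
      by simp
    moreover have "((\<lambda>x. H x + b) has_field_derivative deriv H x) (at x)"
      using holomorphic_derivI[OF H open_UNIV, of x] by (auto intro!: derivative_eq_intros)
    ultimately show ?thesis using DERIV_unique by (simp add: that)
  qed
  from this[of 1 0] this[of \<tau> k] H1 Htau obtain \<alpha> where \<alpha>: "\<And>x. deriv H x = \<alpha>"
    using entire_elliptic_constant[OF assms(1), of "deriv H"] holomorphic_deriv[OF H open_UNIV]
    by (metis add.right_neutral)
  have "\<exists>\<beta>. \<forall>x\<in>UNIV. H x - \<alpha> * x = \<beta>"
  proof (rule has_field_derivative_zero_constant)
    show "((\<lambda>x. H x - \<alpha> * x) has_field_derivative 0) (at x within UNIV)" for x
      using holomorphic_derivI[OF H open_UNIV, of x] \<alpha> by (auto intro!: derivative_eq_intros)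
  qed auto
  then obtain \<beta> where \<beta>: "\<And>x. H x = \<alpha> * x + \<beta>" by (metis UNIV_I diff_add_cancel add.commute)
  have "\<alpha> = 0" using H1[of 0] by (simp add: \<beta>)
  then show "k = 0" using Htau[of 0] by (simp add: \<beta>)
qed

text \<open>Dividing \<open>R\<close> by the theta product with the same divisor leaves a function
  without zeros and poles. Its factor under translation by \<open>\<tau>\<close> is a constant times
  exp (2 pi i E x) with E the degree, and \<open>entire_quasiperiodic_factor\<close> makes the
  exponent vanish.\<close>

theorem sum_zorder_eq_0:
  assumes tau: "Im \<tau> > 0"
    and R: "R meromorphic_on UNIV" "\<And>x. \<forall>\<^sub>F y in at x. R y \<noteq> 0"
    and c: "c1 \<noteq> 0" "c2 \<noteq> 0" "\<And>x. \<forall>\<^sub>F y in at x. R (y + 1) = c1 * R y"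
      "\<And>x. \<forall>\<^sub>F y in at x. R (y + \<tau>) = c2 * R y"
    and D: "\<And>x. D (ecls \<tau> x) = zorder R x"
  shows "finite {c \<in> ell_curve \<tau>. D c \<noteq> 0}" "(\<Sum>c | c \<in> ell_curve \<tau> \<and> D c \<noteq> 0. D c) = 0"
proof -
  define A where "A = {c \<in> ell_curve \<tau>. D c \<noteq> 0}"
  show fin: "finite {c \<in> ell_curve \<tau>. D c \<noteq> 0}"
  proof (rule finite_classes[of \<tau>])
    show "\<forall>\<^sub>F y in at x. ecls \<tau> y \<notin> {c \<in> ell_curve \<tau>. D c \<noteq> 0}" for x
      using eventually_zorder_eq_0[OF R(1) R(2)[of x]] by eventually_elim (simp add: D)
  qed (use tau in auto)
  then have finA: "finite A" by (simp add: A_def)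
  have "\<forall>c\<in>A. \<exists>a. ecls \<tau> a = c" by (auto simp: A_def ell_curve_def)
  then obtain a where a: "\<And>c. c \<in> A \<Longrightarrow> ecls \<tau> (a c) = c" by metis
  \<comment> \<open>One representative per class suffices, since
    \<open>theta \<tau> (x - a c)\<close> vanishes, simply, on the whole class
    \<open>c\<close>.\<close>
  define T where "T = (\<lambda>x. \<Prod>c\<in>A. theta \<tau> (x - a c) powi D c)"
  define Q where "Q = (\<lambda>x. R x / T x)"
  have th: "(\<lambda>x. theta \<tau> (x - b)) meromorphic_on B" for b B
    by (rule meromorphic_on_compose[where g = "theta \<tau>" and A = UNIV])
      (use holomorphic_theta[OF tau] in \<open>auto intro!: analytic_on_imp_meromorphic_on analytic_intros
        simp: analytic_on_open\<close>)
  have evth: "\<forall>\<^sub>F y in at x. \<forall>c\<in>A. theta \<tau> (y - a c) \<noteq> 0" for x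
    using finA eventually_theta_nonzero[OF tau] by (simp add: eventually_ball_finite)
  have evT: "\<forall>\<^sub>F y in at x. T y \<noteq> 0" for x
    using evth[of x] by eventually_elim (simp add: T_def finA)
  have T: "T meromorphic_on B" for B unfolding T_def by (intro meromorphic_intros th)
  have Q: "Q meromorphic_on UNIV" unfolding Q_def by (intro meromorphic_intros T R)
  have evQ: "\<forall>\<^sub>F y in at x. Q y \<noteq> 0" for x
    using evT[of x] R(2)[of x] by eventually_elim (simp add: Q_def)
  have "zorder Q x = 0" for x
  proof -
    have "zorder T x = (\<Sum>c\<in>A. zorder (\<lambda>x. theta \<tau> (x - a c) powi D c) x)"
      unfolding T_def by (rule zorder_prod) (use evT in \<open>auto simp: T_def intro!: meromorphic_intros th\<close>)
    also have "\<dots> = (\<Sum>c\<in>A. if ecls \<tau> x = c then D c else 0)"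
    proof (rule sum.cong[OF refl])
      fix c assume c: "c \<in> A"
      have "zorder (\<lambda>x. theta \<tau> (x - a c) powi D c) x = D c * zorder (\<lambda>x. theta \<tau> (x - a c)) x"
        by (intro zorder_power_int th eventually_frequently eventually_theta_nonzero tau) auto
      also have "zorder (\<lambda>x. theta \<tau> (x - a c)) x = zorder (theta \<tau>) (x - a c)"
        using zorder_translate[of "theta \<tau>" "- a c" x] by simp
      also have "\<dots> = (if ecls \<tau> x = c then 1 else 0)"
        using zorder_theta[OF tau] a[OF c] ecls_eq_iff[of \<tau> x "a c"] by simp
      finally show "zorder (\<lambda>x. theta \<tau> (x - a c) powi D c) x = (if ecls \<tau> x = c then D c else 0)" by simp
    qed
    also have "\<dots> = D (ecls \<tau> x)"
      using finA by (auto simp: A_def ell_curve_def)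
    finally have "zorder T x = zorder R x" by (simp add: D)
    moreover have "zorder Q x = zorder R x - zorder T x"
      unfolding Q_def using R evT
      by (intro zorder_divide eventually_frequently T) (auto intro: meromorphic_on_subset)
    ultimately show ?thesis by simp
  qed
  note ent = entire_zorder_0[OF Q evQ this]
  define E where "E = (\<Sum>c\<in>A. D c)"
  \<comment> \<open>Translation by \<open>\<tau>\<close> divides \<open>theta \<tau> (x - b)\<close>
    by \<open>- wexp (- b) * wexp x\<close>. The constants are collected in \<open>K\<close>, the
    powers of \<open>wexp x\<close> in the exponent \<open>E\<close>.\<close>
  define K where "K = (\<Prod>c\<in>A. (- wexp (- a c)) powi D c)"
  have K: "K \<noteq> 0" using finA by (simp add: K_def)
  \<comment> \<open>The functional equations are known only off isolated points; passing to limits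
    makes them hold everywhere for the entire extension.\<close>
  have Qshift: "remove_sings Q (x + l) = g x * remove_sings Q x"
    if ev: "\<forall>\<^sub>F y in at x. Q (y + l) = g y * Q y" and g: "g holomorphic_on UNIV" for x l g
  proof -
    have "remove_sings Q (x + l) = remove_sings (\<lambda>y. g y * Q y) x"
      unfolding remove_sings_translate[symmetric] by (rule remove_sings_cong[OF ev refl])
    also have "\<dots> = g x * remove_sings Q x"
    proof (rule remove_sings_eqI, rule tendsto_mult)
      show "g \<midarrow>x\<rightarrow> g x" using holomorphic_on_imp_continuous_on[OF g]
        by (simp add: continuous_on_eq_continuous_at isCont_def)
      obtain b where "Q \<midarrow>x\<rightarrow> b"
        using zorder_0_limit[of Q x] Q evQ \<open>\<And>x. zorder Q x = 0\<close> meromorphic_on_subset by (metis subset_UNIV)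
      then show "Q \<midarrow>x\<rightarrow> remove_sings Q x" using remove_sings_eqI by blast
    qed
    finally show ?thesis .
  qed
  have T1: "T (y + 1) = T y" for y
    using theta_plus_1[of \<tau> "y - a _"] by (simp add: T_def algebra_simps)
  have T2: "T (y + \<tau>) * K * wexp y powi E = T y" for y
  proof -
    have "T (y + \<tau>) = (\<Prod>c\<in>A. (theta \<tau> (y - a c) / (- wexp (- a c) * wexp y)) powi D c)"
      unfolding T_def
    proof (intro prod.cong refl)
      fix c
      have "wexp (y - a c) = wexp (- a c) * wexp y" using wexp_add[of "- a c" y] by simp
      then show "theta \<tau> (y + \<tau> - a c) powi D c = (theta \<tau> (y - a c) / (- wexp (- a c) * wexp y)) powi D c"
        using theta_plus_tau[OF tau, of "y - a c"] by (simp add: algebra_simps)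
    qed
    also have "\<dots> = T y / (K * (\<Prod>c\<in>A. wexp y powi D c))"
      by (simp only: T_def K_def prod_dividef power_int_divide_distrib power_int_mult_distrib prod.distrib)
    also have "(\<Prod>c\<in>A. wexp y powi D c) = wexp y powi E"
      unfolding E_def using finA by (induction A rule: finite_induct) (simp_all add: power_int_add)
    finally show ?thesis using K by simp
  qed
  have "remove_sings Q (x + 1) = c1 * remove_sings Q x" for x
  proof (rule Qshift[where g = "\<lambda>_. c1"])
    show "\<forall>\<^sub>F y in at x. Q (y + 1) = c1 * Q y"
      using c(3)[of x] by eventually_elim (simp add: Q_def T1)
  qed auto
  moreover have "remove_sings Q (x + \<tau>) = (c2 * K) * exp ((2 * of_real pi * \<i> * of_int E) * x) * remove_sings Q x" for x
  proof (rule Qshift[where g = "\<lambda>x. (c2 * K) * exp ((2 * of_real pi * \<i> * of_int E) * x)"])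
    have w: "wexp y powi E = exp ((2 * of_real pi * \<i> * of_int E) * y)" for y
      by (simp add: wexp_def exp_power_int algebra_simps)
    show "\<forall>\<^sub>F y in at x. Q (y + \<tau>) = (c2 * K) * exp ((2 * of_real pi * \<i> * of_int E) * y) * Q y"
      using c(4)[of x] evT[of x]
    proof eventually_elim
      case (elim y)
      have "T (y + \<tau>) \<noteq> 0" using T2[of y] elim(2) by auto
      then show ?case using elim T2[of y] K unfolding w[symmetric] Q_def by (simp add: field_simps)
    qed
  qed (intro holomorphic_intros)
  moreover have "Im \<tau> \<noteq> 0" "c2 * K \<noteq> 0" using tau c K by auto
  ultimately have "2 * of_real pi * \<i> * of_int E = (0 :: complex)"
    using entire_quasiperiodic_factor[OF _ ent c(1)] by metis
  then have "E = 0" by simp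
  then show "(\<Sum>c | c \<in> ell_curve \<tau> \<and> D c \<noteq> 0. D c) = 0" by (simp add: E_def A_def)
qed

section \<open>Twisted meromorphic functions\<close>

lemma P1_neg_simps [simp]: "P1_neg (Aff z) = Aff (- z)" "P1_neg Infty = Infty"
  by (simp_all add: P1_neg_def mobius_def proj_def matrix_vector_mult_def sum_2 vector_2)

lemma P1_inv_simps: "P1_inv (Aff z) = (if z = 0 then Infty else Aff (inverse z))" "P1_inv Infty = Aff 0"
  by (simp_all add: P1_inv_def mobius_def proj_def matrix_vector_mult_def sum_2 vector_2 inverse_eq_divide)

text \<open>With the convention \<open>inverse 0 = 0\<close>, sending infinity to \<open>0\<close> makes \<open>val\<close> commute with both
  involutions everywhere.\<close>

fun val :: "P1 \<Rightarrow> complex" where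
  "val (Aff z) = z"
| "val Infty = 0"

lemma val_neg: "val (P1_neg z) = - val z"
  by (cases z) simp_all

lemma val_inv: "val (P1_inv z) = inverse (val z)"
  by (cases z) (simp_all add: P1_inv_simps)

definition twisted :: "complex \<Rightarrow> (complex \<Rightarrow> P1) \<Rightarrow> bool" where
  "twisted \<tau> f \<longleftrightarrow> P1_holomorphic_on f UNIV \<and>
     (\<forall>x. f (x + 1) = P1_neg (f x)) \<and> (\<forall>x. f (x + \<tau>) = P1_inv (f x))"

text \<open>Whichever of \<^term>\<open>f\<close> and its inverse is finite at \<^term>\<open>x\<close>, hence holomorphic near \<^term>\<open>x\<close>.\<close>

definition loc :: "(complex \<Rightarrow> P1) \<Rightarrow> complex \<Rightarrow> complex \<Rightarrow> complex" where
  "loc f x y = (if f x = Infty then inverse (val (f y)) else val (f y))"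

text \<open>\<open>P1_holomorphic_on\<close> permits either chart near a point; here the chart is
  dictated by whether \<open>f x\<close> is infinite.\<close>

lemma P1_holomorphic_loc:
  assumes "P1_holomorphic_on f A" "x \<in> A"
  obtains N where "open N" "x \<in> N" "loc f x holomorphic_on N"
    "\<And>y. y \<in> N \<Longrightarrow> f y = (if f x = Infty then P1_inv (Aff (loc f x y)) else Aff (loc f x y))"
proof -
  obtain N g where N: "open N" "x \<in> N" "g holomorphic_on N"
    and or: "(\<forall>y\<in>N. f y = Aff (g y)) \<or> (\<forall>y\<in>N. f y = P1_inv (Aff (g y)))"
    using assms unfolding P1_holomorphic_on_def by blast
  from or show ?thesis
  proof
    assume f: "\<forall>y\<in>N. f y = Aff (g y)"
    then have l: "loc f x y = g y" if "y \<in> N" for y using that N(2) by (simp add: loc_def)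
    have "loc f x holomorphic_on N" using N(3) l holomorphic_cong by blast
    then show ?thesis using that[OF N(1,2)] f l N(2) by auto
  next
    assume f: "\<forall>y\<in>N. f y = P1_inv (Aff (g y))"
    show ?thesis
    proof (cases "f x = Infty")
      case True
      then have l: "loc f x y = g y" if "y \<in> N" for y
        using that f by (simp add: loc_def val_inv)
      have "loc f x holomorphic_on N" using N(3) l holomorphic_cong by blast
      then show ?thesis using that[OF N(1,2)] f l True by auto
    next
      \<comment> \<open>The given chart is the one at infinity although \<open>f x\<close> is
        finite, so \<open>g\<close> is nonzero at \<open>x\<close> and may be inverted on a smaller
        neighbourhood.\<close>
      case False
      have gx: "g x \<noteq> 0" using f N(2) False by (auto simp: P1_inv_simps)
      define M where "M = {y \<in> N. g y \<noteq> 0}"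
      have M: "open M" unfolding M_def
        using continuous_open_preimage[OF holomorphic_on_imp_continuous_on[OF N(3)] N(1), of "- {0}"]
        by (simp add: vimage_def Int_def open_delete Compl_eq_Diff_UNIV)
      have l: "f y = Aff (inverse (g y))" if "y \<in> M" for y
        using that f by (auto simp: P1_inv_simps M_def)
      then have l': "loc f x y = inverse (g y)" if "y \<in> M" for y
        using that False by (simp add: loc_def)
      have "g holomorphic_on M" by (rule holomorphic_on_subset[OF N(3)]) (auto simp: M_def)
      then have "(\<lambda>y. inverse (g y)) holomorphic_on M"
        by (intro holomorphic_intros) (auto simp: M_def)
      then have "loc f x holomorphic_on M" using l' holomorphic_cong by metis
      then show ?thesis using that[of M] M gx N(2) l l' False by (auto simp: M_def)
    qed
  qed
qed

lemma loc_analytic: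
  assumes "P1_holomorphic_on f A" "x \<in> A"
  shows "loc f x analytic_on {x}"
  using P1_holomorphic_loc[OF assms] analytic_at by metis

lemma val_eq_loc: "val (f y) = (if f x = Infty then inverse (loc f x y) else loc f x y)"
  by (simp add: loc_def)

lemma val_meromorphic:
  assumes "P1_holomorphic_on f A"
  shows "(\<lambda>y. val (f y)) meromorphic_on A"
proof -
  have "(\<lambda>y. val (f y)) meromorphic_on {x}" if "x \<in> A" for x
  proof (cases "f x = Infty")
    case True
    have "(\<lambda>y. inverse (loc f x y)) meromorphic_on {x}"
      by (intro meromorphic_on_inverse analytic_on_imp_meromorphic_on loc_analytic[OF assms that])
    then show ?thesis using True by (simp add: val_eq_loc[of f _ x])
  next
    case False
    then show ?thesis using analytic_on_imp_meromorphic_on[OF loc_analytic[OF assms that]]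
      by (simp add: val_eq_loc[of f _ x])
  qed
  then show ?thesis using meromorphic_on_meromorphic_at by blast
qed

context
  fixes \<tau> :: complex and f :: "complex \<Rightarrow> P1"
  assumes tw: "twisted \<tau> f"
begin

lemma twisted_holomorphic: "P1_holomorphic_on f UNIV"
  and twisted_1: "f (x + 1) = P1_neg (f x)"
  and twisted_tau: "f (x + \<tau>) = P1_inv (f x)"
  using tw by (auto simp: twisted_def)

abbreviation (input) fv :: "complex \<Rightarrow> complex" where "fv \<equiv> \<lambda>y. val (f y)"

lemma twisted_val_meromorphic: "fv meromorphic_on A"
  using val_meromorphic[OF twisted_holomorphic] meromorphic_on_subset by blast

lemma twisted_val_1: "fv (x + 1) = - fv x"
  by (simp add: twisted_1 val_neg)

lemma twisted_val_tau: "fv (x + \<tau>) = inverse (fv x)"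
  by (simp add: twisted_tau val_inv)

text \<open>Otherwise \<^term>\<open>f\<close> would be locally constant with value \<open>0\<close> or infinity.\<close>

lemma twisted_val_nonzero: "\<forall>\<^sub>F y in at x. fv y \<noteq> 0"
proof -
  have "\<not> eventually (\<lambda>y. fv y = 0) (cosparse UNIV)"
  proof
    assume "eventually (\<lambda>y. fv y = 0) (cosparse UNIV)"
    then have ev: "eventually (\<lambda>y. fv y = 0) (at x)" for x
      by (simp add: eventually_cosparse_open_eq)
    have const: "\<exists>N. open N \<and> x \<in> N \<and> (\<forall>y\<in>N. f y = f x) \<and> f x \<in> {Aff 0, Infty}" for x
    proof -
      obtain N where N: "open N" "x \<in> N" "loc f x holomorphic_on N"
        "\<And>y. y \<in> N \<Longrightarrow> f y = (if f x = Infty then P1_inv (Aff (loc f x y)) else Aff (loc f x y))"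
        using P1_holomorphic_loc[OF twisted_holomorphic, of x] by auto
      have ev0: "\<forall>\<^sub>F y in at x. loc f x y = 0"
        using ev[of x] by eventually_elim (simp add: loc_def)
      moreover have "loc f x \<midarrow>x\<rightarrow> loc f x x"
        using N holomorphic_on_imp_continuous_on[OF N(3)]
        by (simp add: continuous_on_eq_continuous_at isCont_def)
      ultimately have "loc f x x = 0"
        using tendsto_cong[OF ev0] LIM_unique[of "loc f x" _ x 0] tendsto_const by metis
      with ev0 have "\<forall>\<^sub>F y in nhds x. loc f x y = 0" by (auto simp: eventually_nhds_conv_at)
      then obtain M where M: "open M" "x \<in> M" "\<forall>y\<in>M. loc f x y = 0"
        by (auto simp: eventually_nhds)
      define k where "k = (if f x = Infty then Infty else Aff 0)"
      have k: "f y = k" if "y \<in> N \<inter> M" for y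
        using N(4)[of y] M(3) that by (simp add: P1_inv_simps k_def)
      have "open (N \<inter> M)" "x \<in> N \<inter> M" using M N by auto
      moreover have "k \<in> {Aff 0, Infty}" by (simp add: k_def)
      ultimately show ?thesis using k k[of x] by (intro exI[of _ "N \<inter> M"]) simp
    qed
    have "open {x. f x = c}" for c
      using const by (subst open_subopen) (metis (mono_tags) mem_Collect_eq subsetI)
    moreover have "{x. f x = Infty} = - {x. f x = Aff 0}"
      using const by fastforce
    \<comment> \<open>By connectedness \<open>f\<close> is constantly 0 or constantly infinite, but
      the twist by \<open>\<tau>\<close> exchanges these two values.\<close>
    ultimately have "{x. f x = Infty} = {} \<or> {x. f x = Infty} = UNIV"
      using clopen[of "{x. f x = Infty}"] by (metis closed_Compl closed_def double_complement)
    then show False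
    proof
      assume "{x. f x = Infty} = {}"
      then have "f x = Aff 0" for x using const[of x] by auto
      then show False using twisted_tau[of 0] by (simp add: P1_inv_simps)
    next
      assume "{x. f x = Infty} = UNIV"
      then have "f x = Infty" for x by auto
      then show False using twisted_tau[of 0] by (simp add: P1_inv_simps)
    qed
  qed
  then have "eventually (\<lambda>y. fv y \<noteq> 0) (cosparse UNIV)"
    using meromorphic_imp_constant_or_avoid[OF twisted_val_meromorphic open_UNIV connected_UNIV] by blast
  then show ?thesis by (simp add: eventually_cosparse_open_eq)
qed

lemma twisted_val_analytic: "\<forall>\<^sub>F y in at x. fv analytic_on {y}"
  using twisted_val_meromorphic[of UNIV] isolated_singularity_at_altdef
  by (auto simp: meromorphic_on_altdef)

text \<open>Otherwise \<open>f\<close> would have a constant value off isolated points, and the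
  twist by 1 would make this constant equal to its negative, although \<open>f\<close> is
  generically nonzero.\<close>

lemma twisted_deriv_nonzero: "\<forall>\<^sub>F y in at x. deriv fv y \<noteq> 0"
proof -
  have "\<not> eventually (\<lambda>y. deriv fv y = 0) (cosparse UNIV)"
  proof
    assume "eventually (\<lambda>y. deriv fv y = 0) (cosparse UNIV)"
    then have "eventually (\<lambda>y. deriv fv y = 0) (at 0)"
      by (simp add: eventually_cosparse_open_eq)
    with twisted_val_analytic[of 0] have "\<forall>\<^sub>F y in at 0. fv analytic_on {y} \<and> deriv fv y = 0"
      by eventually_elim simp
    then obtain d where d: "d > 0" "\<And>y. y \<noteq> 0 \<Longrightarrow> norm y < d \<Longrightarrow> fv analytic_on {y} \<and> deriv fv y = 0"
      by (auto simp: eventually_at)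
    \<comment> \<open>The ball of radius d/2 about d/2 avoids 0, where analyticity is not known, and
      stays in the disc of radius d. Unlike the punctured disc it is convex.\<close>
    define y0 :: complex where "y0 = of_real (d / 2)"
    have y0: "y \<noteq> 0 \<and> norm y < d" if "y \<in> ball y0 (d / 2)" for y
    proof -
      have "norm y0 = d / 2" using d(1) by (simp add: y0_def del: of_real_divide)
      then show ?thesis
        using that norm_triangle_sub[of y y0] by (auto simp: dist_norm norm_minus_commute)
    qed
    have "\<exists>c. \<forall>y\<in>ball y0 (d / 2). fv y = c"
    proof (rule has_field_derivative_zero_constant)
      fix y assume "y \<in> ball y0 (d / 2)"
      then have "fv analytic_on {y}" "deriv fv y = 0" using d(2) y0 by auto
      then show "(fv has_field_derivative 0) (at y within ball y0 (d / 2))"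
        using analytic_on_imp_differentiable_at DERIV_deriv_iff_field_differentiable
          has_field_derivative_at_within by (metis singletonI)
    qed simp
    then obtain c where c: "\<forall>y\<in>ball y0 (d / 2). fv y = c" by blast
    have "\<forall>\<^sub>F y in at y0. fv y = c"
      using c d(1) unfolding eventually_at by (auto simp: dist_commute intro!: exI[of _ "d / 2"])
    then have "\<not> (\<forall>\<^sub>F y in at y0. fv y \<noteq> c)"
      using eventually_frequently[OF at_neq_bot] by (auto simp: frequently_def)
    then have "eventually (\<lambda>y. fv y = c) (cosparse UNIV)"
      using meromorphic_imp_constant_or_avoid[OF twisted_val_meromorphic open_UNIV connected_UNIV, of c]
      by (auto simp: eventually_cosparse_open_eq)
    then have ev: "\<forall>\<^sub>F y in at x. fv y = c" for x by (simp add: eventually_cosparse_open_eq)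
    have "\<forall>\<^sub>F y in at 0. fv (y + 1) = c" by (rule eventually_at_shift) (rule ev)
    with ev[of 0] twisted_val_nonzero[of 0] have "\<forall>\<^sub>F y in at (0::complex). False"
      by eventually_elim (simp add: twisted_val_1)
    then show False by simp
  qed
  then have "eventually (\<lambda>y. deriv fv y \<noteq> 0) (cosparse UNIV)"
    using meromorphic_imp_constant_or_avoid[OF meromorphic_on_deriv[OF twisted_val_meromorphic] open_UNIV connected_UNIV]
    by blast
  then show ?thesis by (simp add: eventually_cosparse_open_eq)
qed

abbreviation (input) logd :: "complex \<Rightarrow> complex" where "logd \<equiv> \<lambda>y. deriv fv y / fv y"

lemma logd_meromorphic: "logd meromorphic_on A"
  by (intro meromorphic_intros twisted_val_meromorphic)

lemma logd_nonzero: "\<forall>\<^sub>F y in at x. logd y \<noteq> 0"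
  using twisted_val_nonzero twisted_deriv_nonzero by eventually_elim simp

lemma logd_1: "\<forall>\<^sub>F y in at x. logd (y + 1) = 1 * logd y"
  using twisted_val_analytic[of x]
proof eventually_elim
  case (elim y)
  then have "(fv has_field_derivative deriv fv y) (at y)"
    by (meson analytic_on_imp_differentiable_at DERIV_deriv_iff_field_differentiable singletonI)
  then have "((\<lambda>y. fv (y + 1)) has_field_derivative - deriv fv y) (at y)"
    unfolding twisted_val_1 by (rule DERIV_minus)
  then have "deriv fv (y + 1) = - deriv fv y"
    using DERIV_imp_deriv DERIV_shift by blast
  then show ?case by (simp add: twisted_val_1)
qed

lemma logd_tau: "\<forall>\<^sub>F y in at x. logd (y + \<tau>) = (- 1) * logd y"
  using twisted_val_analytic[of x] twisted_val_nonzero[of x]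
proof eventually_elim
  case (elim y)
  then have "(fv has_field_derivative deriv fv y) (at y)"
    by (meson analytic_on_imp_differentiable_at DERIV_deriv_iff_field_differentiable singletonI)
  then have "((\<lambda>y. fv (y + \<tau>)) has_field_derivative - (deriv fv y * inverse (fv y ^ Suc (Suc 0)))) (at y)"
    unfolding twisted_val_tau using elim(2) DERIV_inverse_fun by blast
  then have "deriv fv (y + \<tau>) = - (deriv fv y * inverse (fv y ^ Suc (Suc 0)))"
    using DERIV_imp_deriv DERIV_shift by blast
  then show ?case unfolding twisted_val_tau using elim(2) by (simp add: field_simps)
qed

section \<open>The ramification of a twisted function, counted on the curve\<close>

lemma zorder_val_1: "zorder fv (x + 1) = zorder fv x"
  by (rule zorder_quasiperiodic[of "- 1"]) (simp_all add: twisted_val_1)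

lemma zorder_val_tau: "zorder fv (x + \<tau>) = - zorder fv x"
proof -
  have "zorder fv (x + \<tau>) = zorder (\<lambda>y. inverse (fv y)) x"
    unfolding zorder_translate[symmetric] twisted_val_tau ..
  also have "\<dots> = - zorder fv x"
    using twisted_val_meromorphic[of "{x}"] eventually_frequently[OF at_neq_bot twisted_val_nonzero[of x]]
    by (intro zorder_inverse) (auto simp: meromorphic_at_iff)
  finally show ?thesis .
qed

text \<open>The absolute value makes the order independent of the representative: translation by
  \<open>\<tau>\<close> turns a zero into a pole of the same order.\<close>

definition absord :: "complex set \<Rightarrow> int" where
  "absord c = \<bar>zorder fv (SOME x. ecls \<tau> x = c)\<bar>"

lemma abs_zorder_ecls:
  assumes "ecls \<tau> x = ecls \<tau> y"
  shows "\<bar>zorder fv x\<bar> = \<bar>zorder fv y\<bar>"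
proof -
  have "x - y \<in> lattice \<tau>" using assms by (simp add: ecls_eq_iff)
  from periodic_lattice[OF this, of "\<lambda>x. \<bar>zorder fv x\<bar>" y] show ?thesis
    using zorder_val_1 zorder_val_tau by simp
qed

lemma absord_ecls: "absord (ecls \<tau> x) = \<bar>zorder fv x\<bar>"
  unfolding absord_def by (rule abs_zorder_ecls) (rule someI[of _ x], simp)

lemma finite_absord:
  assumes "Im \<tau> \<noteq> 0"
  shows "finite {c \<in> ell_curve \<tau>. absord c \<noteq> 0}"
proof (rule finite_classes[OF assms])
  show "\<forall>\<^sub>F y in at x. ecls \<tau> y \<notin> {c \<in> ell_curve \<tau>. absord c \<noteq> 0}" for x
    using eventually_zorder_eq_0[OF twisted_val_meromorphic twisted_val_nonzero[of x]]
    by eventually_elim (simp add: absord_ecls)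
qed auto

text \<open>By \<open>zorder_deriv_loc\<close>, \<open>D\<close> is the ramification divisor. Its
  difference from \<open>absord\<close> is the divisor of the logarithmic derivative, which has
  degree 0.\<close>

lemma sum_ramification:
  assumes tau: "Im \<tau> > 0" and D: "\<And>x. D (ecls \<tau> x) = zorder logd x + \<bar>zorder fv x\<bar>"
  shows "finite {c \<in> ell_curve \<tau>. D c \<noteq> 0}"
    "(\<Sum>c | c \<in> ell_curve \<tau> \<and> D c \<noteq> 0. D c) = (\<Sum>c | c \<in> ell_curve \<tau> \<and> absord c \<noteq> 0. absord c)"
proof -
  define E where "E = (\<lambda>c. D c - absord c)"
  have "E (ecls \<tau> x) = zorder logd x" for x by (simp add: E_def D absord_ecls)
  note E = sum_zorder_eq_0[OF tau logd_meromorphic logd_nonzero _ _ logd_1 logd_tau this]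
  define C where "C = {c \<in> ell_curve \<tau>. E c \<noteq> 0} \<union> {c \<in> ell_curve \<tau>. absord c \<noteq> 0}"
  have C: "finite C" using E(1) finite_absord tau by (simp add: C_def)
  have sub: "{c \<in> ell_curve \<tau>. D c \<noteq> 0} \<subseteq> C" by (auto simp: C_def E_def)
  then show "finite {c \<in> ell_curve \<tau>. D c \<noteq> 0}" using C finite_subset by blast
  have "(\<Sum>c | c \<in> ell_curve \<tau> \<and> D c \<noteq> 0. D c) = sum D C"
    by (rule sum.mono_neutral_left[OF C sub]) (auto simp: C_def)
  also have "\<dots> = sum E C + sum absord C" by (simp add: E_def sum.distrib[symmetric])
  also have "sum E C = (\<Sum>c | c \<in> ell_curve \<tau> \<and> E c \<noteq> 0. E c)"
    by (rule sum.mono_neutral_right[OF C]) (auto simp: C_def)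
  also have "sum absord C = (\<Sum>c | c \<in> ell_curve \<tau> \<and> absord c \<noteq> 0. absord c)"
    by (rule sum.mono_neutral_right[OF C]) (auto simp: C_def)
  finally show "(\<Sum>c | c \<in> ell_curve \<tau> \<and> D c \<noteq> 0. D c) = (\<Sum>c | c \<in> ell_curve \<tau> \<and> absord c \<noteq> 0. absord c)"
    using E(2) by simp
qed

lemma loc_nonzero: "\<forall>\<^sub>F y in at x. loc f x y \<noteq> 0"
  using twisted_val_nonzero[of x] by eventually_elim (simp add: loc_def)

text \<open>\<open>loc f x\<close> is the value of \<open>f\<close> or its inverse, so its order is
  that of \<open>f\<close> up to sign; being analytic at \<open>x\<close>, it has the nonnegative
  one.\<close>

lemma zorder_loc: "zorder (loc f x) x = \<bar>zorder fv x\<bar>"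
proof -
  have "zorder (loc f x) x = (if f x = Infty then - zorder fv x else zorder fv x)"
  proof (cases "f x = Infty")
    case True
    then have "zorder (loc f x) x = zorder (\<lambda>y. inverse (fv y)) x" by (simp add: loc_def[abs_def])
    also have "\<dots> = - zorder fv x"
      using twisted_val_meromorphic[of "{x}"] eventually_frequently[OF at_neq_bot twisted_val_nonzero[of x]]
      by (intro zorder_inverse) (auto simp: meromorphic_at_iff)
    finally show ?thesis using True by simp
  qed (simp add: loc_def[abs_def])
  moreover have "zorder (loc f x) x \<ge> 0"
  proof (rule ccontr)
    assume "\<not> zorder (loc f x) x \<ge> 0"
    then have "is_pole (loc f x) x"
      using loc_analytic[OF twisted_holomorphic, of x] loc_nonzero[of x]
      by (intro neg_zorder_imp_is_pole eventually_frequently not_essential_analytic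
          isolated_singularity_at_analytic) auto
    then show False using analytic_at_imp_no_pole loc_analytic[OF twisted_holomorphic, of x] by blast
  qed
  ultimately show ?thesis by auto
qed

lemma deriv_loc:
  assumes "fv analytic_on {y}" "fv y \<noteq> 0"
  shows "deriv (loc f x) y / loc f x y = (if f x = Infty then - 1 else 1) * logd y"
proof (cases "f x = Infty")
  case True
  have "(fv has_field_derivative deriv fv y) (at y)"
    using assms(1) by (meson analytic_on_imp_differentiable_at DERIV_deriv_iff_field_differentiable singletonI)
  then have "((\<lambda>y. inverse (fv y)) has_field_derivative - (deriv fv y * inverse (fv y ^ Suc (Suc 0)))) (at y)"
    using assms(2) DERIV_inverse_fun by blast
  then have "deriv (loc f x) y = - (deriv fv y * inverse (fv y ^ Suc (Suc 0)))"
    using DERIV_imp_deriv True by (simp add: loc_def[abs_def])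
  then show ?thesis using assms(2) True by (simp add: loc_def field_simps)
qed (simp add: loc_def[abs_def])

lemma deriv_loc_nonzero: "\<forall>\<^sub>F y in at x. deriv (loc f x) y \<noteq> 0"
  using twisted_val_analytic[of x] twisted_val_nonzero[of x] twisted_deriv_nonzero[of x]
proof eventually_elim
  case (elim y)
  then have "(if f x = Infty then - 1 else 1) * logd y \<noteq> 0" by simp
  then show ?case using deriv_loc[OF elim(1,2), of x] by (metis div_0)
qed

text \<open>The derivative is the logarithmic derivative times the function, and the logarithmic
  derivatives of \<open>f\<close> and of its inverse differ only by a sign.\<close>

lemma zorder_deriv_loc: "zorder (deriv (loc f x)) x = zorder logd x + \<bar>zorder fv x\<bar>"
proof -
  let ?c = "if f x = Infty then - 1 else 1 :: complex"
  have "\<forall>\<^sub>F y in at x. deriv (loc f x) y = (?c * logd y) * loc f x y"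
    using twisted_val_analytic[of x] twisted_val_nonzero[of x] loc_nonzero[of x]
  proof eventually_elim
    case (elim y)
    show ?case using deriv_loc[OF elim(1,2), of x] elim(3) by (metis nonzero_divide_eq_eq)
  qed
  then have "zorder (deriv (loc f x)) x = zorder (\<lambda>y. (?c * logd y) * loc f x y) x"
    by (rule zorder_cong) simp
  also have "\<dots> = zorder (\<lambda>y. ?c * logd y) x + zorder (loc f x) x"
    using logd_nonzero[of x] loc_nonzero[of x] loc_analytic[OF twisted_holomorphic, of x]
    by (intro zorder_mult eventually_frequently meromorphic_on_mult meromorphic_on_const
        logd_meromorphic analytic_on_imp_meromorphic_on) (auto elim: eventually_mono)
  also have "zorder (\<lambda>y. ?c * logd y) x = zorder logd x" by (rule zorder_cmult) simp
  finally show ?thesis by (simp add: zorder_loc)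
qed

end

section \<open>The minimal twisted function\<close>

text \<open>A theta quotient with simple zeros at the points \<open>m + 2n\<tau>\<close> and simple poles at their translates
  by \<open>\<tau>\<close>.  The exponential makes it change sign under \<open>x \<mapsto> x + 1\<close>, and the constant is a square root of
  the one that turns \<open>sn (x + \<tau>) \<cdot> sn x\<close> into \<open>1\<close>.\<close>

definition sn_num :: "complex \<Rightarrow> complex \<Rightarrow> complex" where
  "sn_num \<tau> x = \<i> * exp (\<i> * of_real pi * \<tau> / 2) * exp (- (\<i> * of_real pi * x)) * theta (2 * \<tau>) x"

definition sn_den :: "complex \<Rightarrow> complex \<Rightarrow> complex" where
  "sn_den \<tau> x = theta (2 * \<tau>) (x + \<tau>)"

text \<open>Up to sign this is sqrt k times Jacobi's elliptic sine at 2 K x, where i K' / K = 2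
  \<open>\<tau>\<close>. The point 1/2 is then the quarter period K.\<close>

definition sn :: "complex \<Rightarrow> complex \<Rightarrow> P1" where
  "sn \<tau> x = (if sn_den \<tau> x = 0 then Infty else Aff (sn_num \<tau> x / sn_den \<tau> x))"

lemma val_sn: "val (sn \<tau> x) = sn_num \<tau> x / sn_den \<tau> x"
  by (simp add: sn_def)

text \<open>The parity of the coefficient of \<open>\<tau>\<close> separates the zeros of
  \<open>sn \<tau>\<close> from its poles; together they form a single class on the curve.\<close>

lemma lattice_double:
  "x \<in> lattice \<tau> \<longleftrightarrow> x \<in> lattice (2 * \<tau>) \<or> x + \<tau> \<in> lattice (2 * \<tau>)"
proof
  assume "x \<in> lattice \<tau>"
  then obtain m n where x: "x = of_int m + of_int n * \<tau>" unfolding lattice_def by blast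
  show "x \<in> lattice (2 * \<tau>) \<or> x + \<tau> \<in> lattice (2 * \<tau>)"
  proof (cases "even n")
    case True
    then obtain k where "n = 2 * k" by blast
    then have "x = of_int m + of_int k * (2 * \<tau>)" by (simp add: x)
    then show ?thesis using latticeI by blast
  next
    case False
    then obtain k where "n = 2 * k + 1" by (rule oddE)
    then have "x + \<tau> = of_int m + of_int (k + 1) * (2 * \<tau>)" by (simp add: x algebra_simps)
    then show ?thesis using latticeI by metis
  qed
next
  have sub: "l \<in> lattice \<tau>" if l: "l \<in> lattice (2 * \<tau>)" for l
  proof -
    from l obtain m n where "l = of_int m + of_int n * (2 * \<tau>)" unfolding lattice_def by blast
    then have "l = of_int m + of_int (2 * n) * \<tau>" by (simp add: algebra_simps)
    then show ?thesis using latticeI by metis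
  qed
  assume "x \<in> lattice (2 * \<tau>) \<or> x + \<tau> \<in> lattice (2 * \<tau>)"
  then show "x \<in> lattice \<tau>"
    using sub lattice_diff[of "x + \<tau>" \<tau> \<tau>] by auto
qed

lemma lattice_double_disjoint:
  assumes "Im \<tau> \<noteq> 0" "x \<in> lattice (2 * \<tau>)"
  shows "x + \<tau> \<notin> lattice (2 * \<tau>)"
proof
  assume "x + \<tau> \<in> lattice (2 * \<tau>)"
  then have "\<tau> \<in> lattice (2 * \<tau>)" using lattice_diff[OF _ assms(2), of "x + \<tau>"] by simp
  then obtain m n where "\<tau> = of_int m + of_int n * (2 * \<tau>)" unfolding lattice_def by blast
  then have "of_int 0 + of_int 1 * \<tau> = of_int m + of_int (2 * n) * \<tau>" by (simp add: algebra_simps)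
  then have "1 = 2 * n" using lattice_coords_unique[OF assms(1)] by blast
  then show False by presburger
qed

lemma entire_eventually_nonzero:
  assumes "h holomorphic_on UNIV" "h b \<noteq> 0"
  shows "\<forall>\<^sub>F y in at x. h y \<noteq> 0"
proof -
  have "isCont h b" using holomorphic_on_imp_continuous_on[OF assms(1)]
    by (simp add: continuous_on_eq_continuous_at)
  then have "\<forall>\<^sub>F y in at b. h y \<noteq> 0"
    unfolding isCont_def by (rule tendsto_imp_eventually_ne) (rule assms(2))
  then have "\<not> (\<forall>\<^sub>F y in at b. h y = 0)"
    using eventually_frequently[OF at_neq_bot] by (auto simp: frequently_def)
  moreover have "h meromorphic_on UNIV"
    using assms(1) by (intro analytic_on_imp_meromorphic_on) (simp add: analytic_on_open)
  ultimately show ?thesis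
    using meromorphic_imp_constant_or_avoid[OF _ open_UNIV connected_UNIV, of h 0]
    by (auto simp: eventually_cosparse_open_eq)
qed

lemma twisted_translate:
  assumes "twisted \<tau> f"
  shows "twisted \<tau> (\<lambda>x. f (x - a))"
  unfolding twisted_def
proof (intro conjI allI)
  show "P1_holomorphic_on (\<lambda>x. f (x - a)) UNIV"
    unfolding P1_holomorphic_on_def
  proof
    fix x :: complex
    obtain N g where N: "open N" "x - a \<in> N" "g holomorphic_on N"
      "(\<forall>y\<in>N. f y = Aff (g y)) \<or> (\<forall>y\<in>N. f y = P1_inv (Aff (g y)))"
      using assms unfolding twisted_def P1_holomorphic_on_def by (metis UNIV_I)
    show "\<exists>N g. open N \<and> x \<in> N \<and> g holomorphic_on N \<and>
      ((\<forall>y\<in>N. f (y - a) = Aff (g y)) \<or> (\<forall>y\<in>N. f (y - a) = P1_inv (Aff (g y))))"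
    proof (intro exI conjI)
      show "open ((\<lambda>y. y - a) -` N)" using N(1) by (intro open_vimage continuous_intros) auto
      show "x \<in> (\<lambda>y. y - a) -` N" using N(2) by simp
      show "(\<lambda>y. g (y - a)) holomorphic_on ((\<lambda>y. y - a) -` N)"
        by (rule holomorphic_on_compose_gen[of "\<lambda>y. y - a" _ g N, unfolded o_def])
          (use N(3) in \<open>auto intro!: holomorphic_intros\<close>)
      show "(\<forall>y\<in>(\<lambda>y. y - a) -` N. f (y - a) = Aff (g (y - a))) \<or>
        (\<forall>y\<in>(\<lambda>y. y - a) -` N. f (y - a) = P1_inv (Aff (g (y - a))))" using N(4) by auto
    qed
  qed
  show "f (x + 1 - a) = P1_neg (f (x - a))" for x
    using assms unfolding twisted_def by (metis add_diff_eq diff_add_eq)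
  show "f (x + \<tau> - a) = P1_inv (f (x - a))" for x
    using assms unfolding twisted_def by (metis add_diff_eq diff_add_eq)
qed

text \<open>\<open>val\<close> confuses 0 with infinity, so the two functions might still differ at
  \<open>x\<close> itself. If only one of them were infinite there, the inverse of that one times
  the other would be 1 nearby and yet tend to 0.\<close>

lemma P1_eq_of_eventually_val_eq:
  assumes "P1_holomorphic_on f UNIV" "P1_holomorphic_on g UNIV"
    "\<forall>\<^sub>F y in at x. val (f y) = val (g y)" "\<forall>\<^sub>F y in at x. val (f y) \<noteq> 0"
  shows "f x = g x"
proof -
  have lim: "loc f x \<midarrow>x\<rightarrow> loc f x x" if "P1_holomorphic_on f UNIV" for f
    using loc_analytic[OF that, of x] analytic_at_imp_isCont isContD by blast
  have no: False
    if f: "P1_holomorphic_on f UNIV" and g: "P1_holomorphic_on g UNIV" and "f x = Infty" "g x \<noteq> Infty"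
      and ev: "\<forall>\<^sub>F y in at x. val (f y) = val (g y)" "\<forall>\<^sub>F y in at x. val (f y) \<noteq> 0" for f g
  proof -
    have l: "((\<lambda>y. loc f x y * loc g x y) \<longlongrightarrow> loc f x x * loc g x x) (at x)"
      by (intro tendsto_mult lim f g)
    have e: "\<forall>\<^sub>F y in at x. loc f x y * loc g x y = 1"
      using ev by eventually_elim (simp add: loc_def \<open>f x = Infty\<close> \<open>g x \<noteq> Infty\<close>)
    have "((\<lambda>_. 1) \<longlongrightarrow> loc f x x * loc g x x) (at x)"
      using l unfolding tendsto_cong[OF e] .
    then have "loc f x x * loc g x x = 1"
      using LIM_unique[OF _ tendsto_const] by blast
    then show False by (simp add: loc_def \<open>f x = Infty\<close>)
  qed
  show ?thesis
  proof (cases "f x"; cases "g x")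
    fix a b assume *: "f x = Aff a" "g x = Aff b"
    then have "((\<lambda>y. val (f y)) \<longlongrightarrow> a) (at x)" "((\<lambda>y. val (g y)) \<longlongrightarrow> b) (at x)"
      using lim[OF assms(1)] lim[OF assms(2)] by (simp_all add: loc_def[abs_def])
    then have "((\<lambda>y. val (g y)) \<longlongrightarrow> a) (at x)" "((\<lambda>y. val (g y)) \<longlongrightarrow> b) (at x)"
      unfolding tendsto_cong[OF assms(3)] by auto
    from LIM_unique[OF this] show ?thesis using * by simp
  next
    fix a assume "f x = Aff a" "g x = Infty"
    moreover have "\<forall>\<^sub>F y in at x. val (g y) = val (f y)" "\<forall>\<^sub>F y in at x. val (g y) \<noteq> 0"
      using assms(3) by (auto elim: eventually_mono) (use assms(3,4) in eventually_elim, simp)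
    ultimately show ?thesis using no[OF assms(2,1)] by simp
  next
    fix a assume "f x = Infty" "g x = Aff a"
    then show ?thesis using no[OF assms(1,2) _ _ assms(3,4)] by simp
  qed simp
qed

section \<open>The theta quotient is twisted and has one simple zero or pole on the curve\<close>

context
  fixes \<tau> :: complex
  assumes tau: "Im \<tau> > 0"
begin

lemma tau2: "Im (2 * \<tau>) > 0"
  using tau by simp

lemma sn_num_holomorphic: "sn_num \<tau> holomorphic_on UNIV"
  unfolding sn_num_def[abs_def] by (intro holomorphic_intros holomorphic_theta[OF tau2])

lemma sn_den_holomorphic: "sn_den \<tau> holomorphic_on UNIV"
proof -
  have "theta (2 * \<tau>) \<circ> (\<lambda>x. x + \<tau>) holomorphic_on UNIV"
    by (intro holomorphic_on_compose_gen[OF _ holomorphic_theta[OF tau2]] holomorphic_intros) auto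
  then show ?thesis by (simp add: o_def sn_den_def[abs_def])
qed

lemma sn_num_eq_0_iff: "sn_num \<tau> x = 0 \<longleftrightarrow> x \<in> lattice (2 * \<tau>)"
  by (simp add: sn_num_def theta_eq_0_iff[OF tau2])

lemma sn_den_eq_0_iff: "sn_den \<tau> x = 0 \<longleftrightarrow> x + \<tau> \<in> lattice (2 * \<tau>)"
  by (simp add: sn_den_def theta_eq_0_iff[OF tau2])

lemma sn_num_den_nonzero: "sn_num \<tau> x \<noteq> 0 \<or> sn_den \<tau> x \<noteq> 0"
  using lattice_double_disjoint[of \<tau> x] tau by (auto simp: sn_num_eq_0_iff sn_den_eq_0_iff)

lemma sn_num_1: "sn_num \<tau> (x + 1) = - sn_num \<tau> x"
proof -
  have "exp (- (\<i> * of_real pi * (x + 1))) = exp (- (\<i> * of_real pi * x)) * exp (- (\<i> * of_real pi))"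
    unfolding exp_add[symmetric] by (simp add: algebra_simps)
  also have "exp (- (\<i> * of_real pi)) = (- 1 :: complex)" by (simp add: exp_minus)
  finally show ?thesis unfolding sn_num_def theta_plus_1 by simp
qed

lemma sn_den_1: "sn_den \<tau> (x + 1) = sn_den \<tau> x"
  using theta_plus_1[of "2 * \<tau>" "x + \<tau>"] by (simp add: sn_den_def add_ac)

text \<open>Translation by \<open>\<tau>\<close> swaps \<open>sn_num\<close> and
  \<open>sn_den\<close> up to this common factor. The constant in \<open>sn_num\<close> makes the
  factor the same for both, so that it cancels in the quotient.\<close>

definition sn_factor :: "complex \<Rightarrow> complex" where
  "sn_factor x = \<i> * exp (\<i> * of_real pi * \<tau> / 2) * exp (- (\<i> * of_real pi * (x + \<tau>)))"

lemma sn_factor_nonzero: "sn_factor x \<noteq> 0"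
  by (simp add: sn_factor_def)

lemma sn_num_tau: "sn_num \<tau> (x + \<tau>) = sn_factor x * sn_den \<tau> x"
  by (simp add: sn_num_def sn_den_def sn_factor_def)

lemma sn_den_tau: "sn_den \<tau> (x + \<tau>) = sn_factor x * sn_num \<tau> x"
proof -
  let ?k = "\<i> * exp (\<i> * of_real pi * \<tau> / 2)"
  have "exp (- (\<i> * of_real pi * (x + \<tau>))) * exp (- (\<i> * of_real pi * x)) *
      (exp (\<i> * of_real pi * \<tau> / 2) * exp (\<i> * of_real pi * \<tau> / 2)) * wexp x = 1"
    unfolding wexp_def exp_add[symmetric] by (simp add: algebra_simps)
  \<comment> \<open>All exponentials cancel; the two factors \<open>\<i>\<close> supply the sign
    that \<open>theta_plus_tau\<close> demands.\<close>
  then have *: "sn_factor x * (?k * exp (- (\<i> * of_real pi * x))) * wexp x = - 1"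
    unfolding sn_factor_def by (simp add: algebra_simps)
  have "sn_den \<tau> (x + \<tau>) = - theta (2 * \<tau>) x / wexp x"
    using theta_plus_tau[OF tau2, of x] unfolding sn_den_def by (simp add: algebra_simps)
  also have "\<dots> = sn_factor x * (?k * exp (- (\<i> * of_real pi * x))) * wexp x * theta (2 * \<tau>) x / wexp x"
    unfolding * by simp
  finally show ?thesis by (simp add: sn_num_def)
qed

lemma sn_num_uminus: "sn_num \<tau> (- x) = - sn_num \<tau> x"
proof -
  have "exp (\<i> * of_real pi * x) = exp (- (\<i> * of_real pi * x)) * wexp x"
    unfolding wexp_def exp_add[symmetric] by (simp add: algebra_simps)
  then show ?thesis unfolding sn_num_def theta_uminus[OF tau2] by simp
qed

lemma sn_den_uminus: "sn_den \<tau> (- x) = sn_den \<tau> x"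
  using theta_tau_minus[of "2 * \<tau>" "x + \<tau>"] by (simp add: sn_den_def algebra_simps)

lemma sn_uminus: "sn \<tau> (- x) = P1_neg (sn \<tau> x)"
  by (simp add: sn_def sn_num_uminus sn_den_uminus)

lemma sn_holomorphic: "P1_holomorphic_on (sn \<tau>) UNIV"
  unfolding P1_holomorphic_on_def
proof
  fix x
  have op: "open {y. g y \<noteq> 0}" if "g holomorphic_on UNIV" for g :: "complex \<Rightarrow> complex"
    by (intro open_Collect_neq holomorphic_on_imp_continuous_on[OF that] continuous_on_const)
  show "\<exists>N g. open N \<and> x \<in> N \<and> g holomorphic_on N \<and>
    ((\<forall>y\<in>N. sn \<tau> y = Aff (g y)) \<or> (\<forall>y\<in>N. sn \<tau> y = P1_inv (Aff (g y))))"
  proof (cases "sn_den \<tau> x = 0")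
    case False
    show ?thesis
    proof (intro exI conjI)
      show "(\<lambda>y. sn_num \<tau> y / sn_den \<tau> y) holomorphic_on {y. sn_den \<tau> y \<noteq> 0}"
        using sn_num_holomorphic sn_den_holomorphic
        by (intro holomorphic_intros) (auto intro: holomorphic_on_subset)
      show "(\<forall>y\<in>{y. sn_den \<tau> y \<noteq> 0}. sn \<tau> y = Aff (sn_num \<tau> y / sn_den \<tau> y)) \<or>
          (\<forall>y\<in>{y. sn_den \<tau> y \<noteq> 0}. sn \<tau> y = P1_inv (Aff (sn_num \<tau> y / sn_den \<tau> y)))"
        by (simp add: sn_def)
    qed (use False op[OF sn_den_holomorphic] in auto)
  next
    case True
    show ?thesis
    proof (intro exI conjI)
      show "(\<lambda>y. sn_den \<tau> y / sn_num \<tau> y) holomorphic_on {y. sn_num \<tau> y \<noteq> 0}"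
        using sn_num_holomorphic sn_den_holomorphic
        by (intro holomorphic_intros) (auto intro: holomorphic_on_subset)
      show "(\<forall>y\<in>{y. sn_num \<tau> y \<noteq> 0}. sn \<tau> y = Aff (sn_den \<tau> y / sn_num \<tau> y)) \<or>
          (\<forall>y\<in>{y. sn_num \<tau> y \<noteq> 0}. sn \<tau> y = P1_inv (Aff (sn_den \<tau> y / sn_num \<tau> y)))"
        by (simp add: sn_def P1_inv_simps)
    qed (use True sn_num_den_nonzero[of x] op[OF sn_num_holomorphic] in auto)
  qed
qed

lemma sn_twisted: "twisted \<tau> (sn \<tau>)"
  unfolding twisted_def
proof (intro conjI allI sn_holomorphic)
  show "sn \<tau> (x + 1) = P1_neg (sn \<tau> x)" for x
    by (simp add: sn_def sn_num_1 sn_den_1)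
  show "sn \<tau> (x + \<tau>) = P1_inv (sn \<tau> x)" for x
    using sn_num_den_nonzero[of x]
    by (auto simp: sn_def sn_num_tau sn_den_tau sn_factor_nonzero P1_inv_simps)
qed

lemma zorder_sn_num: "zorder (sn_num \<tau>) x = (if x \<in> lattice (2 * \<tau>) then 1 else 0)"
proof -
  define e where "e = (\<lambda>x. \<i> * exp (\<i> * of_real pi * \<tau> / 2) * exp (- (\<i> * of_real pi * x)))"
  have e: "e holomorphic_on UNIV" unfolding e_def by (intro holomorphic_intros)
  then have "e analytic_on {x}" by (metis analytic_on_open analytic_on_subset open_UNIV subset_UNIV)
  moreover have "theta (2 * \<tau>) analytic_on {x}"
    using holomorphic_theta[OF tau2] by (metis analytic_on_open analytic_on_subset open_UNIV subset_UNIV)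
  ultimately have "zorder (\<lambda>y. e y * theta (2 * \<tau>) y) x = zorder e x + zorder (theta (2 * \<tau>)) x"
    using eventually_theta_nonzero[OF tau2, where a = 0]
    by (intro zorder_mult analytic_on_imp_meromorphic_on eventually_frequently) (auto simp: e_def)
  moreover have "zorder e x = 0"
    by (rule zorder_nonzero_value) (use \<open>e analytic_on {x}\<close> in \<open>auto simp: e_def\<close>)
  ultimately show ?thesis by (simp add: e_def sn_num_def[abs_def] zorder_theta[OF tau2])
qed

lemma zorder_sn_den: "zorder (sn_den \<tau>) x = (if x + \<tau> \<in> lattice (2 * \<tau>) then 1 else 0)"
  unfolding sn_den_def[abs_def] zorder_translate zorder_theta[OF tau2] ..

lemma sn_num_eventually_nonzero: "\<forall>\<^sub>F y in at x. sn_num \<tau> y \<noteq> 0"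
  using eventually_theta_nonzero[OF tau2, where a = 0] by (simp add: sn_num_def)

lemma sn_den_eventually_nonzero: "\<forall>\<^sub>F y in at x. sn_den \<tau> y \<noteq> 0"
  using eventually_theta_nonzero[OF tau2, where a = "- \<tau>"] by (simp add: sn_den_def)

lemma zorder_val_sn:
  "zorder (\<lambda>y. val (sn \<tau> y)) x =
    (if x \<in> lattice (2 * \<tau>) then 1 else if x + \<tau> \<in> lattice (2 * \<tau>) then - 1 else 0)"
proof -
  have "zorder (\<lambda>y. val (sn \<tau> y)) x = zorder (sn_num \<tau>) x - zorder (sn_den \<tau>) x"
    unfolding val_sn
    using sn_num_holomorphic sn_den_holomorphic sn_num_eventually_nonzero sn_den_eventually_nonzero
    by (intro zorder_divide analytic_on_imp_meromorphic_on eventually_frequently)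
      (auto simp: analytic_on_open intro: analytic_on_subset[of _ UNIV])
  then show ?thesis
    using lattice_double_disjoint[of \<tau> x] tau by (auto simp: zorder_sn_num zorder_sn_den)
qed

lemma absord_sn_translate:
  "absord \<tau> (\<lambda>x. sn \<tau> (x - a)) (ecls \<tau> x) = (if ecls \<tau> x = ecls \<tau> a then 1 else 0)"
proof -
  have "absord \<tau> (\<lambda>x. sn \<tau> (x - a)) (ecls \<tau> x) = \<bar>zorder (\<lambda>y. val (sn \<tau> (y - a))) x\<bar>"
    by (rule absord_ecls[OF twisted_translate[OF sn_twisted]])
  also have "zorder (\<lambda>y. val (sn \<tau> (y - a))) x = zorder (\<lambda>y. val (sn \<tau> y)) (x - a)"
    using zorder_translate[of "\<lambda>y. val (sn \<tau> y)" "- a" x] by simp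
  finally show ?thesis
    using lattice_double[of "x - a" \<tau>] by (simp add: zorder_val_sn ecls_eq_iff)
qed

lemma sum_absord_sn_translate:
  fixes a :: complex
  defines "f \<equiv> \<lambda>x. sn \<tau> (x - a)"
  shows "(\<Sum>c | c \<in> ell_curve \<tau> \<and> absord \<tau> f c \<noteq> 0. absord \<tau> f c) = 1"
proof -
  have "{c \<in> ell_curve \<tau>. absord \<tau> f c \<noteq> 0} = {ecls \<tau> a}"
    using absord_sn_translate[of a] by (auto simp: ell_curve_def f_def split: if_splits)
  then show ?thesis using absord_sn_translate[of a a] by (simp add: f_def)
qed

section \<open>A twisted function is determined by its divisor up to translation by 1\<close>

lemma twisted_zorder_eq:
  assumes f: "twisted \<tau> f" and g: "twisted \<tau> g"
    and eq: "zorder (\<lambda>y. val (f y)) a = zorder (\<lambda>y. val (g y)) a" and l: "x - a \<in> lattice \<tau>"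
  shows "zorder (\<lambda>y. val (f y)) x = zorder (\<lambda>y. val (g y)) x"
proof -
  have "zorder (\<lambda>y. val (f y)) (a + (x - a)) = zorder (\<lambda>y. val (g y)) (a + (x - a))"
  proof (rule periodic_induct[OF l, where P = "\<lambda>x. zorder (\<lambda>y. val (f y)) x = zorder (\<lambda>y. val (g y)) x"])
    fix x assume *: "zorder (\<lambda>y. val (f y)) x = zorder (\<lambda>y. val (g y)) x"
    show "zorder (\<lambda>y. val (f y)) (x + 1) = zorder (\<lambda>y. val (g y)) (x + 1)"
      using * zorder_val_1[OF f, of x] zorder_val_1[OF g, of x] by simp
    show "zorder (\<lambda>y. val (f y)) (x - 1) = zorder (\<lambda>y. val (g y)) (x - 1)"
      using * zorder_val_1[OF f, of "x - 1"] zorder_val_1[OF g, of "x - 1"] by simp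
    show "zorder (\<lambda>y. val (f y)) (x + \<tau>) = zorder (\<lambda>y. val (g y)) (x + \<tau>)"
      using * zorder_val_tau[OF f, of x] zorder_val_tau[OF g, of x] by simp
    show "zorder (\<lambda>y. val (f y)) (x - \<tau>) = zorder (\<lambda>y. val (g y)) (x - \<tau>)"
      using * zorder_val_tau[OF f, of "x - \<tau>"] zorder_val_tau[OF g, of "x - \<tau>"] by simp
  qed (rule eq)
  then show ?thesis by simp
qed

text \<open>The quotient of two twisted functions with the same divisor is entire and elliptic for the
  lattice generated by \<open>1\<close> and \<open>2\<tau>\<close>, hence a constant, which the shift by \<^term>\<open>\<tau>\<close> inverts.\<close>

lemma twisted_same_divisor:
  assumes f: "twisted \<tau> f" and g: "twisted \<tau> g"
    and eq: "\<And>x. zorder (\<lambda>y. val (f y)) x = zorder (\<lambda>y. val (g y)) x"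
  shows "(\<forall>x. f x = g x) \<or> (\<forall>x. f x = g (x - 1))"
proof -
  define Q where "Q = (\<lambda>x. val (f x) / val (g x))"
  have Q: "Q meromorphic_on UNIV"
    unfolding Q_def by (intro meromorphic_intros twisted_val_meromorphic[OF f] twisted_val_meromorphic[OF g])
  have evQ: "\<forall>\<^sub>F y in at x. Q y \<noteq> 0" for x
    unfolding Q_def using twisted_val_nonzero[OF f] twisted_val_nonzero[OF g] by eventually_elim simp
  have "zorder Q x = 0" for x
    unfolding Q_def using eq[of x] twisted_val_nonzero[OF f] twisted_val_nonzero[OF g]
    by (subst zorder_divide) (auto intro!: twisted_val_meromorphic[OF f] twisted_val_meromorphic[OF g]
      eventually_frequently)
  note ent = entire_zorder_0[OF Q evQ this]
  have Q1: "Q (x + 1) = Q x" for x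
    by (simp add: Q_def twisted_val_1[OF f] twisted_val_1[OF g])
  have Q2: "Q (x + \<tau>) = inverse (Q x)" for x
    unfolding Q_def twisted_val_tau[OF f] twisted_val_tau[OF g] by (simp add: field_simps)
  have Q3: "Q (x + 2 * \<tau>) = Q x" for x
    using Q2[of "x + \<tau>"] Q2[of x] by (simp add: algebra_simps)
  obtain c where c: "\<And>x. remove_sings Q x = c"
  proof (rule entire_elliptic_constant[of "2 * \<tau>" "remove_sings Q"])
    show "remove_sings Q (x + 1) = remove_sings Q x" for x
      unfolding remove_sings_translate[symmetric] Q1 ..
    show "remove_sings Q (x + 2 * \<tau>) = remove_sings Q x" for x
      unfolding remove_sings_translate[symmetric] Q3 ..
  qed (use tau ent in auto)
  have evc: "\<forall>\<^sub>F y in at x. Q y = c" for x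
  proof -
    have "isolated_singularity_at Q x" using Q by (simp add: meromorphic_on_altdef)
    from eventually_remove_sings_eq_at[OF this] show ?thesis by eventually_elim (simp add: c)
  qed
  have "\<forall>\<^sub>F y in at 0. Q (y + \<tau>) = c" by (rule eventually_at_shift) (rule evc)
  with evc[of 0] have "\<forall>\<^sub>F y in at (0::complex). c = inverse c"
    by eventually_elim (metis Q2)
  then have "c = inverse c" by simp
  moreover have "c \<noteq> 0" using ent(2) c by auto
  ultimately have "c * c = 1" by (metis right_inverse)
  then have "c = 1 \<or> c = - 1" by (simp add: square_eq_1_iff)
  then show ?thesis
  proof
    assume c: "c = 1"
    have "\<forall>\<^sub>F y in at x. val (f y) = val (g y)" for x
      using evc[of x] twisted_val_nonzero[OF g, of x] by eventually_elim (simp add: Q_def c)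
    then have "f x = g x" for x
      using P1_eq_of_eventually_val_eq twisted_holomorphic[OF f] twisted_holomorphic[OF g]
        twisted_val_nonzero[OF f] by blast
    then show ?thesis by blast
  next
    \<comment> \<open>The twist by 1 absorbs the sign: the negative of \<open>g\<close> is its
      translate by 1.\<close>
    assume c: "c = - 1"
    have g': "twisted \<tau> (\<lambda>x. g (x - 1))" by (rule twisted_translate[OF g])
    have "\<forall>\<^sub>F y in at x. val (f y) = val (g (y - 1))" for x
      using evc[of x] twisted_val_nonzero[OF g, of x]
    proof eventually_elim
      case (elim y)
      then show ?case using twisted_val_1[OF g, of "y - 1"] c by (simp add: Q_def field_simps)
    qed
    then have "f x = g (x - 1)" for x
      using P1_eq_of_eventually_val_eq[of f "\<lambda>x. g (x - 1)"] twisted_holomorphic[OF f]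
        twisted_holomorphic[OF g'] twisted_val_nonzero[OF f] by blast
    then show ?thesis by blast
  qed
qed

text \<open>Degree 1 leaves a single class of order 1 or -1. Moving by \<open>\<tau>\<close> if
  necessary, it contains a simple zero \<open>a\<close>; the twists then determine the orders of
  \<open>f\<close> on the whole class, so its divisor is that of the translate of
  \<open>sn \<tau>\<close> by \<open>a\<close>. The remaining sign is absorbed in
  \<open>a\<close>.\<close>

theorem minimal_twisted:
  assumes f: "twisted \<tau> f"
    and one: "(\<Sum>c | c \<in> ell_curve \<tau> \<and> absord \<tau> f c \<noteq> 0. absord \<tau> f c) = 1"
  obtains a where "\<And>x. f x = sn \<tau> (x - a)"
proof -
  let ?A = "{c \<in> ell_curve \<tau>. absord \<tau> f c \<noteq> 0}"
  have fin: "finite ?A" using finite_absord[OF f] tau by simp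
  have ge: "absord \<tau> f c \<ge> 1" if "c \<in> ?A" for c
    using that by (auto simp: absord_def[OF f])
  obtain c where c: "c \<in> ?A" using one by (metis (no_types, lifting) sum.empty zero_neq_one all_not_in_conv)
  have "?A - {c} = {}"
  proof (rule ccontr)
    assume "?A - {c} \<noteq> {}"
    then obtain d where d: "d \<in> ?A - {c}" by blast
    then have "1 \<le> sum (absord \<tau> f) (?A - {c})"
      using ge member_le_sum[of d "?A - {c}" "absord \<tau> f"] fin by force
    then show False using one ge[OF c] sum.remove[OF fin c, of "absord \<tau> f"] by simp
  qed
  then have A: "?A = {c}" using c by blast
  then have c1: "absord \<tau> f c = 1" using one by simp
  obtain b where b: "c = ecls \<tau> b" using c by (auto simp: ell_curve_def)
  have "\<bar>zorder (\<lambda>y. val (f y)) b\<bar> = 1" using c1 absord_ecls[OF f, of b] by (simp add: b)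
  then have "zorder (\<lambda>y. val (f y)) b = 1 \<or> zorder (\<lambda>y. val (f y)) (b + \<tau>) = 1"
    using zorder_val_tau[OF f, of b] by linarith
  then have "\<exists>a. ecls \<tau> a = c \<and> zorder (\<lambda>y. val (f y)) a = 1"
    using ecls_add_lattice[of \<tau> \<tau> b] b lattice_tau by metis
  then obtain a where a: "ecls \<tau> a = c" "zorder (\<lambda>y. val (f y)) a = 1" by blast
  define g where "g = (\<lambda>x. sn \<tau> (x - a))"
  have g: "twisted \<tau> g" unfolding g_def by (rule twisted_translate[OF sn_twisted])
  have "zorder (\<lambda>y. val (g y)) a = 1"
    using zorder_translate[of "\<lambda>y. val (sn \<tau> y)" "- a" a] by (simp add: g_def zorder_val_sn)
  have "zorder (\<lambda>y. val (f y)) x = zorder (\<lambda>y. val (g y)) x" for x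
  proof (cases "x - a \<in> lattice \<tau>")
    case True
    then show ?thesis
      using twisted_zorder_eq[OF f g _ True] a(2) \<open>zorder (\<lambda>y. val (g y)) a = 1\<close> by simp
  next
    case False
    then have ne: "ecls \<tau> x \<noteq> c" using a(1) ecls_eq_iff by metis
    then have "ecls \<tau> x \<notin> ?A" using A by blast
    then have "absord \<tau> f (ecls \<tau> x) = 0" by (auto simp: ell_curve_def)
    moreover have "absord \<tau> g (ecls \<tau> x) = 0"
      unfolding g_def absord_sn_translate using ne a(1) by simp
    ultimately show ?thesis using absord_ecls[OF f, of x] absord_ecls[OF g, of x] by simp
  qed
  from twisted_same_divisor[OF f g this] show ?thesis
  proof
    assume "\<forall>x. f x = g x"
    then show ?thesis using that[of a] by (simp add: g_def)
  next
    assume "\<forall>x. f x = g (x - 1)"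
    then show ?thesis using that[of "a + 1"] by (simp add: g_def algebra_simps)
  qed
qed

end

section \<open>The fibres of the minimal twisted function\<close>

text \<open>Doubling carries functions periodic under twice the lattice to functions on the curve;
  this lemma transfers their orders.\<close>

lemma zorder_scale_2:
  assumes "f meromorphic_on UNIV" "\<forall>\<^sub>F y in at (2 * x). f y \<noteq> 0"
  shows "zorder (\<lambda>y. f (2 * y)) x = zorder f (2 * x)"
proof -
  define n where "n = zorder f (2 * x)"
  define g where "g = zor_poly f (2 * x)"
  have "isolated_singularity_at f (2 * x)" "not_essential f (2 * x)"
    using assms(1) by (auto simp: meromorphic_on_altdef)
  from zorder_exist[OF this eventually_frequently[OF at_neq_bot assms(2)]]
  obtain r where r: "r > 0" "g (2 * x) \<noteq> 0" "g holomorphic_on cball (2 * x) r"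
    "\<And>w. w \<in> cball (2 * x) r - {2 * x} \<Longrightarrow> f w = g w * (w - 2 * x) powi n"
    unfolding n_def g_def by auto
  have b: "2 * y \<in> cball (2 * x) r" if "y \<in> ball x (r / 2)" for y
  proof -
    have "dist (2 * x) (2 * y) = 2 * dist x y"
      unfolding dist_norm right_diff_distrib[symmetric] norm_mult by simp
    then show ?thesis using that by simp
  qed
  have "zorder (\<lambda>y. f (2 * y)) x = n"
  proof (rule zorder_eqI[of "ball x (r / 2)" _ "\<lambda>y. g (2 * y) * 2 powi n"])
    have "g \<circ> (\<lambda>y. 2 * y) holomorphic_on ball x (r / 2)"
      by (rule holomorphic_on_compose_gen[OF _ r(3)]) (use b in \<open>auto intro!: holomorphic_intros\<close>)
    then show "(\<lambda>y. g (2 * y) * 2 powi n) holomorphic_on ball x (r / 2)"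
      by (intro holomorphic_intros) (simp add: o_def)
    show "f (2 * y) = g (2 * y) * 2 powi n * (y - x) powi n" if "y \<in> ball x (r / 2)" "y \<noteq> x" for y
    proof -
      have "f (2 * y) = g (2 * y) * (2 * y - 2 * x) powi n" using r(4) b[OF that(1)] that(2) by simp
      also have "2 * y - 2 * x = 2 * (y - x)" by simp
      finally show ?thesis by (simp only: power_int_mult_distrib mult.assoc)
    qed
  qed (use r in auto)
  then show ?thesis by (simp add: n_def)
qed

lemma entire_zorder:
  assumes "h holomorphic_on UNIV" "h b \<noteq> 0"
  shows "if h z = 0 then zorder h z > 0 else zorder h z = 0"
proof -
  have "\<exists>w\<in>UNIV. h w \<noteq> 0" using assms(2) by blast
  from zorder_exist_zero[OF assms(1) open_UNIV connected_UNIV UNIV_I this, of z] show ?thesis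
    by (rule conjunct1)
qed

text \<open>At a simple zero h = g (w - z) with g nonzero at z, and the derivative there is
  g(z).\<close>

lemma entire_critical_zorder:
  assumes "h holomorphic_on UNIV" "h b \<noteq> 0" "h z = 0" "deriv h z = 0"
  shows "zorder h z \<ge> 2"
proof -
  have an: "h analytic_on {z}" by (metis assms(1) analytic_on_open analytic_on_subset open_UNIV subset_UNIV)
  have pos: "zorder h z > 0" using entire_zorder[OF assms(1,2), of z] assms(3) by simp
  have "zorder h z \<noteq> 1"
  proof
    assume one: "zorder h z = 1"
    have "\<exists>w\<in>UNIV. h w \<noteq> 0" using assms(2) by blast
    from zorder_exist_zero[OF assms(1) open_UNIV connected_UNIV UNIV_I this, of z] one
    obtain r where r: "r > 0" "zor_poly h z holomorphic_on cball z r"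
      "\<And>w. w \<in> cball z r \<Longrightarrow> h w = zor_poly h z w * (w - z) \<and> zor_poly h z w \<noteq> 0" by auto
    define g where "g = zor_poly h z"
    have "(g has_field_derivative deriv g z) (at z)"
      unfolding g_def using r(1,2)
      by (intro holomorphic_derivI[of _ "ball z r"]) (auto intro: holomorphic_on_subset)
    then have "((\<lambda>w. g w * (w - z)) has_field_derivative g z) (at z)"
      by (auto intro!: derivative_eq_intros)
    then have "(h has_field_derivative g z) (at z)"
      by (rule has_field_derivative_transform_within_open[of _ _ _ "ball z r"]) (use r in \<open>auto simp: g_def\<close>)
    then have "g z = 0" using assms(4) DERIV_imp_deriv by metis
    then show False using r(1) r(3)[of z] by (simp add: g_def)
  qed
  then show ?thesis using pos by simp
qed

lemma half_not_in_lattice: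
  assumes "Im \<tau> \<noteq> 0"
  shows "1 / 2 \<notin> lattice \<tau>"
proof
  assume "1 / 2 \<in> lattice \<tau>"
  then obtain m n where h: "1 / 2 = of_int m + of_int n * \<tau>" unfolding lattice_def by blast
  have "Im (1 / 2) = of_int n * Im \<tau>" unfolding h by simp
  then have "n = 0" using assms by simp
  then have "Re (1 / 2) = of_int m" using h by (metis Re_complex_of_real add.right_neutral mult_zero_left of_int_0 of_real_of_int_eq)
  then have "of_int (2 * m) = (1 :: real)" by simp
  then have "2 * m = 1" by (metis of_int_eq_1_iff)
  then show False by presburger
qed

lemma P1_inv_inv: "P1_inv (P1_inv z) = z"
  by (cases z) (simp_all add: P1_inv_simps)

lemma P1_neg_neg: "P1_neg (P1_neg z) = z"
  by (cases z) simp_all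

context
  fixes \<tau> :: complex
  assumes tau: "Im \<tau> > 0"
begin

lemma sn_flip: "sn \<tau> (1 - x) = sn \<tau> x"
proof -
  have "sn \<tau> (1 - x) = P1_neg (P1_neg (sn \<tau> x))"
    using sn_uminus[OF tau, of x] twisted_1[OF sn_twisted[OF tau], of "- x"] by simp
  then show ?thesis by (cases "sn \<tau> x") simp_all
qed

text \<open>Both twists are involutions, so doubled periods act trivially. Substituting y = x/2
  brings the claim into the form of \<open>periodic_lattice\<close>.\<close>

lemma sn_double_periodic:
  assumes "l \<in> lattice \<tau>"
  shows "sn \<tau> (x + 2 * l) = sn \<tau> x"
proof -
  note tw = sn_twisted[OF tau]
  have "sn \<tau> (2 * (x / 2 + l)) = sn \<tau> (2 * (x / 2))"
  proof (rule periodic_lattice[OF assms, of "\<lambda>y. sn \<tau> (2 * y)"])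
    show "sn \<tau> (2 * (y + 1)) = sn \<tau> (2 * y)" for y
    proof -
      have "2 * (y + 1) = 2 * y + 1 + 1" by simp
      then show ?thesis by (simp only: twisted_1[OF tw] P1_neg_neg)
    qed
    show "sn \<tau> (2 * (y + \<tau>)) = sn \<tau> (2 * y)" for y
    proof -
      have "2 * (y + \<tau>) = 2 * y + \<tau> + \<tau>" by simp
      then show ?thesis by (simp only: twisted_tau[OF tw] P1_inv_inv)
    qed
  qed
  then show ?thesis by (simp add: distrib_left)
qed

text \<open>The points of the fibre over \<^term>\<open>w\<close> are the zeros of an entire function, which the two
  simple poles of \<^term>\<open>sn \<tau>\<close> modulo twice the lattice count.\<close>

definition sn_fibre :: "complex \<Rightarrow> complex \<Rightarrow> complex" where
  "sn_fibre w x = sn_num \<tau> x - w * sn_den \<tau> x"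

lemma sn_fibre_holomorphic: "sn_fibre w holomorphic_on UNIV"
  unfolding sn_fibre_def[abs_def]
  by (intro holomorphic_intros sn_num_holomorphic sn_den_holomorphic tau)

lemma sn_fibre_eq_0_iff: "sn_fibre w x = 0 \<longleftrightarrow> sn \<tau> x = Aff w"
  using sn_num_den_nonzero[OF tau, of x] by (auto simp: sn_fibre_def sn_def field_simps)

lemma sn_at_pole: "sn \<tau> (- \<tau>) = Infty"
  by (simp add: sn_def sn_den_eq_0_iff[OF tau])

lemma sn_fibre_nonzero: "sn_fibre w (- \<tau>) \<noteq> 0"
  by (simp add: sn_fibre_eq_0_iff sn_at_pole)

text \<open>The divisor on the curve of \<open>sn \<tau>\<close> minus \<open>w\<close>, evaluated
  at 2x: doubling identifies the curve with the plane modulo twice the lattice.\<close>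

definition fibre_div :: "complex \<Rightarrow> complex set \<Rightarrow> int" where
  "fibre_div w c = zorder (\<lambda>x. sn_fibre w (2 * x) / sn_den \<tau> (2 * x)) (SOME x. ecls \<tau> x = c)"

lemma eventually_scale_2:
  assumes "\<And>x. \<forall>\<^sub>F y in at x. P y"
  shows "\<forall>\<^sub>F y in at (x :: complex). P (2 * y)"
proof -
  obtain d where d: "d > 0" "\<And>y. y \<noteq> 2 * x \<Longrightarrow> dist y (2 * x) < d \<Longrightarrow> P y"
    using assms[of "2 * x"] unfolding eventually_at by auto
  have "P (2 * y)" if "y \<noteq> x" "dist y x < d / 2" for y
  proof (rule d(2))
    have "dist (2 * y) (2 * x) = 2 * dist y x"
      unfolding dist_norm right_diff_distrib[symmetric] norm_mult by simp
    then show "dist (2 * y) (2 * x) < d" using that by simp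
  qed (use that in simp)
  then show ?thesis using d(1) unfolding eventually_at by (intro exI[of _ "d / 2"]) auto
qed

lemma fibre_div:
  defines "R \<equiv> \<lambda>w x. sn_fibre w (2 * x) / sn_den \<tau> (2 * x)"
  shows "fibre_div w (ecls \<tau> x) = zorder (sn_fibre w) (2 * x) - zorder (sn_den \<tau>) (2 * x)"
    "finite {c \<in> ell_curve \<tau>. fibre_div w c \<noteq> 0}"
    "(\<Sum>c | c \<in> ell_curve \<tau> \<and> fibre_div w c \<noteq> 0. fibre_div w c) = 0"
proof -
  have per1: "R w (y + 1) = 1 * R w y" for y
  proof -
    have *: "2 * (y + 1) = 2 * y + 1 + 1" by simp
    show ?thesis unfolding R_def sn_fibre_def *
      by (simp only: sn_num_1[OF tau] sn_den_1[OF tau] minus_minus mult_1)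
  qed
  have per2: "R w (y + \<tau>) = 1 * R w y" for y
  proof -
    have *: "2 * (y + \<tau>) = 2 * y + \<tau> + \<tau>" by simp
    \<comment> \<open>Two translations by \<open>\<tau>\<close> swap numerator and denominator
      twice, so both acquire the same factor and the quotient is periodic.\<close>
    let ?k = "sn_factor \<tau> (2 * y + \<tau>) * sn_factor \<tau> (2 * y)"
    have "sn_fibre w (2 * (y + \<tau>)) = ?k * sn_fibre w (2 * y)"
      unfolding sn_fibre_def * sn_num_tau[OF tau] sn_den_tau[OF tau] by (simp add: algebra_simps)
    moreover have "sn_den \<tau> (2 * (y + \<tau>)) = ?k * sn_den \<tau> (2 * y)"
      unfolding * sn_num_tau[OF tau] sn_den_tau[OF tau] by simp
    ultimately show ?thesis unfolding R_def using sn_factor_nonzero[OF tau] by simp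
  qed
  have mer: "(\<lambda>x. g (2 * x)) meromorphic_on B" if "g holomorphic_on UNIV" for g B
    by (rule meromorphic_on_compose[of g UNIV])
      (use that in \<open>auto intro!: analytic_on_imp_meromorphic_on analytic_intros simp: analytic_on_open\<close>)
  have R: "R w meromorphic_on B" for B
    unfolding R_def by (intro meromorphic_on_divide mer sn_fibre_holomorphic sn_den_holomorphic tau)
  have evh: "\<forall>\<^sub>F y in at x. sn_fibre w y \<noteq> 0" for x
    by (rule entire_eventually_nonzero[OF sn_fibre_holomorphic sn_fibre_nonzero])
  have evd: "\<forall>\<^sub>F y in at x. sn_den \<tau> y \<noteq> 0" for x
    by (rule sn_den_eventually_nonzero[OF tau])
  have evR: "\<forall>\<^sub>F y in at x. R w y \<noteq> 0" for x
    using eventually_scale_2[OF evh, of x] eventually_scale_2[OF evd, of x]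
    by eventually_elim (simp add: R_def)
  have D: "fibre_div w (ecls \<tau> x) = zorder (R w) x" for x
  proof -
    have "ecls \<tau> (SOME y. ecls \<tau> y = ecls \<tau> x) = ecls \<tau> x"
      by (rule someI[of "\<lambda>y. ecls \<tau> y = ecls \<tau> x" x]) simp
    then have "zorder (R w) (SOME y. ecls \<tau> y = ecls \<tau> x) = zorder (R w) x"
      by (intro zorder_lattice_periodic[of 1 1 "R w" \<tau>] always_eventually allI per1 per2) auto
    then show ?thesis by (simp add: fibre_div_def R_def)
  qed
  from sum_zorder_eq_0[OF tau R evR _ _ _ _ D, of 1 1] per1 per2
  show "finite {c \<in> ell_curve \<tau>. fibre_div w c \<noteq> 0}"
    "(\<Sum>c | c \<in> ell_curve \<tau> \<and> fibre_div w c \<noteq> 0. fibre_div w c) = 0" by auto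
  have "zorder (R w) x = zorder (\<lambda>x. sn_fibre w (2 * x)) x - zorder (\<lambda>x. sn_den \<tau> (2 * x)) x"
    unfolding R_def using eventually_scale_2[OF evh, of x] eventually_scale_2[OF evd, of x]
    by (intro zorder_divide mer sn_fibre_holomorphic sn_den_holomorphic tau eventually_frequently) auto
  also have "zorder (\<lambda>x. sn_fibre w (2 * x)) x = zorder (sn_fibre w) (2 * x)"
    by (intro zorder_scale_2 evh analytic_on_imp_meromorphic_on)
      (use sn_fibre_holomorphic in \<open>simp add: analytic_on_open\<close>)
  also have "zorder (\<lambda>x. sn_den \<tau> (2 * x)) x = zorder (sn_den \<tau>) (2 * x)"
    by (intro zorder_scale_2 evd analytic_on_imp_meromorphic_on)
      (use sn_den_holomorphic[OF tau] in \<open>simp add: analytic_on_open\<close>)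
  finally show "fibre_div w (ecls \<tau> x) = zorder (sn_fibre w) (2 * x) - zorder (sn_den \<tau>) (2 * x)"
    by (simp add: D)
qed

text \<open>The poles of \<open>sn \<tau>\<close> are the points m + (2n - 1) \<open>\<tau>\<close>.
  Halving them gives two classes on the curve, according to the parity of m.\<close>

lemma pole_classes:
  "2 * x + \<tau> \<in> lattice (2 * \<tau>) \<longleftrightarrow> ecls \<tau> x \<in> {ecls \<tau> (\<tau> / 2), ecls \<tau> (\<tau> / 2 + 1 / 2)}"
proof
  assume "2 * x + \<tau> \<in> lattice (2 * \<tau>)"
  then obtain m n where x: "2 * x + \<tau> = of_int m + of_int n * (2 * \<tau>)" unfolding lattice_def by blast
  show "ecls \<tau> x \<in> {ecls \<tau> (\<tau> / 2), ecls \<tau> (\<tau> / 2 + 1 / 2)}"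
  proof (cases "even m")
    case True
    then obtain k where k: "m = 2 * k" by blast
    have "2 * (x - \<tau> / 2) = 2 * (of_int k + of_int (n - 1) * \<tau>)"
      using x by (simp add: k algebra_simps)
    then have "x - \<tau> / 2 = of_int k + of_int (n - 1) * \<tau>"
      by (metis mult_left_cancel zero_neq_numeral)
    then have "x - \<tau> / 2 \<in> lattice \<tau>" by (simp only: latticeI)
    then show ?thesis using ecls_eq_iff by blast
  next
    case False
    then obtain k where k: "m = 2 * k + 1" by (rule oddE)
    have "2 * (x - (\<tau> / 2 + 1 / 2)) = 2 * (of_int k + of_int (n - 1) * \<tau>)"
      using x by (simp add: k algebra_simps)
    then have "x - (\<tau> / 2 + 1 / 2) = of_int k + of_int (n - 1) * \<tau>"
      by (metis mult_left_cancel zero_neq_numeral)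
    then have "x - (\<tau> / 2 + 1 / 2) \<in> lattice \<tau>" by (simp only: latticeI)
    then show ?thesis using ecls_eq_iff by blast
  qed
next
  assume "ecls \<tau> x \<in> {ecls \<tau> (\<tau> / 2), ecls \<tau> (\<tau> / 2 + 1 / 2)}"
  then consider "x - \<tau> / 2 \<in> lattice \<tau>" | "x - (\<tau> / 2 + 1 / 2) \<in> lattice \<tau>"
    using ecls_eq_iff by blast
  then show "2 * x + \<tau> \<in> lattice (2 * \<tau>)"
  proof cases
    case 1
    then obtain m n where "x - \<tau> / 2 = of_int m + of_int n * \<tau>" unfolding lattice_def by blast
    then have "x = \<tau> / 2 + (of_int m + of_int n * \<tau>)" by (metis diff_add_cancel add.commute)
    then have "2 * x + \<tau> = of_int (2 * m) + of_int (n + 1) * (2 * \<tau>)" by (simp add: algebra_simps)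
    then show ?thesis by (simp only: latticeI)
  next
    case 2
    then obtain m n where "x - (\<tau> / 2 + 1 / 2) = of_int m + of_int n * \<tau>" unfolding lattice_def by blast
    then have "x = \<tau> / 2 + 1 / 2 + (of_int m + of_int n * \<tau>)" by (metis diff_add_cancel add.commute)
    then have "2 * x + \<tau> = of_int (2 * m + 1) + of_int (n + 1) * (2 * \<tau>)" by (simp add: algebra_simps)
    then show ?thesis by (simp only: latticeI)
  qed
qed

lemma fibre_div_pole:
  assumes "2 * x + \<tau> \<in> lattice (2 * \<tau>)"
  shows "fibre_div w (ecls \<tau> x) = - 1"
proof -
  have "sn \<tau> (2 * x) = Infty" using assms by (simp add: sn_def sn_den_eq_0_iff[OF tau])
  then have "zorder (sn_fibre w) (2 * x) = 0"
    using entire_zorder[OF sn_fibre_holomorphic sn_fibre_nonzero, of w "2 * x"]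
    by (simp add: sn_fibre_eq_0_iff)
  then show ?thesis using assms by (simp add: fibre_div(1) zorder_sn_den[OF tau])
qed

lemma fibre_div_no_pole:
  assumes "2 * x + \<tau> \<notin> lattice (2 * \<tau>)"
  shows "fibre_div w (ecls \<tau> x) = zorder (sn_fibre w) (2 * x)"
  using assms by (simp add: fibre_div(1) zorder_sn_den[OF tau])

lemma zorder_sn_fibre_nonneg: "zorder (sn_fibre w) x \<ge> 0"
  and zorder_sn_fibre_pos: "sn \<tau> x = Aff w \<Longrightarrow> zorder (sn_fibre w) x > 0"
  and zorder_sn_fibre_0: "sn \<tau> x \<noteq> Aff w \<Longrightarrow> zorder (sn_fibre w) x = 0"
  using entire_zorder[OF sn_fibre_holomorphic sn_fibre_nonzero, of w x]
  by (auto simp: sn_fibre_eq_0_iff split: if_splits)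

text \<open>The total degree is 0 and each of the two simple pole classes contributes -1. Off the
  poles the terms are multiplicities of solutions, so \<open>sn \<tau>\<close> has degree
  two.\<close>

lemma sum_fibre_div:
  defines "P \<equiv> {ecls \<tau> (\<tau> / 2), ecls \<tau> (\<tau> / 2 + 1 / 2)}"
  shows "(\<Sum>c | c \<in> ell_curve \<tau> - P \<and> fibre_div w c \<noteq> 0. fibre_div w c) = 2"
proof -
  let ?A = "{c \<in> ell_curve \<tau>. fibre_div w c \<noteq> 0}"
  let ?B = "{c \<in> ell_curve \<tau> - P. fibre_div w c \<noteq> 0}"
  have m1: "fibre_div w c = - 1" if "c \<in> P" for c
    using that fibre_div_pole pole_classes unfolding P_def by fastforce
  have "ecls \<tau> (\<tau> / 2 + 1 / 2) \<noteq> ecls \<tau> (\<tau> / 2)"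
    using half_not_in_lattice[of \<tau>] tau by (simp add: ecls_eq_iff)
  then have P2: "card P = 2" by (simp add: P_def)
  have "P \<subseteq> ell_curve \<tau>" by (auto simp: P_def ell_curve_def)
  then have A: "?A = P \<union> ?B" using m1 by auto
  have "sum (fibre_div w) ?A = sum (fibre_div w) P + sum (fibre_div w) ?B"
    unfolding A
  proof (rule sum.union_disjoint)
    show "finite ?B" by (rule finite_subset[OF _ fibre_div(2)[of w]]) auto
  qed (auto simp: P_def)
  moreover have "sum (fibre_div w) P = - 2" using m1 P2 by simp
  ultimately show ?thesis using fibre_div(3)[of w] by simp
qed

lemma sn_surj: "\<exists>y. sn \<tau> y = z"
proof (cases z)
  case Infty
  then show ?thesis using sn_at_pole by blast
next
  case (Aff w)
  let ?B = "{c \<in> ell_curve \<tau> - {ecls \<tau> (\<tau> / 2), ecls \<tau> (\<tau> / 2 + 1 / 2)}. fibre_div w c \<noteq> 0}"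
  have "?B \<noteq> {}" using sum_fibre_div[of w] by (metis (no_types, lifting) sum.empty zero_neq_numeral)
  then obtain x where "ecls \<tau> x \<notin> {ecls \<tau> (\<tau> / 2), ecls \<tau> (\<tau> / 2 + 1 / 2)}" "fibre_div w (ecls \<tau> x) \<noteq> 0"
    by (auto simp: ell_curve_def)
  then have "zorder (sn_fibre w) (2 * x) \<noteq> 0" using fibre_div_no_pole pole_classes by simp
  then show ?thesis using zorder_sn_fibre_0 Aff by blast
qed

text \<open>By symmetry \<open>1/2\<close> is a critical point, so that the fibre through it, being of degree two, contains
  no further point.\<close>

lemma sn_critical_fibre:
  assumes "sn \<tau> b = sn \<tau> (1 / 2)"
  shows "\<exists>l\<in>lattice \<tau>. b = 1 / 2 + 2 * l"
proof (rule ccontr)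
  assume no: "\<not> ?thesis"
  have "1 / 2 + \<tau> \<notin> lattice (2 * \<tau>)"
  proof
    assume "1 / 2 + \<tau> \<in> lattice (2 * \<tau>)"
    then have "1 / 2 \<in> lattice \<tau>" using lattice_double by blast
    then show False using half_not_in_lattice tau by auto
  qed
  then obtain w where w: "sn \<tau> (1 / 2) = Aff w" by (simp add: sn_def sn_den_eq_0_iff[OF tau])
  have "sn_fibre w (1 - x) = sn_fibre w x" for x
    using sn_num_1[OF tau, of "- x"] sn_den_1[OF tau, of "- x"]
    by (simp add: sn_fibre_def sn_num_uminus[OF tau] sn_den_uminus[OF tau])
  then have e: "(\<lambda>x. sn_fibre w (1 - x)) = sn_fibre w" by blast
  have d: "(sn_fibre w has_field_derivative deriv (sn_fibre w) (1 / 2)) (at (1 / 2))"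
    using holomorphic_derivI[OF sn_fibre_holomorphic open_UNIV] by simp
  then have "((\<lambda>x. sn_fibre w (1 - x)) has_field_derivative deriv (sn_fibre w) (1 / 2) * (- 1)) (at (1 / 2))"
    by (intro DERIV_chain'[where f = "\<lambda>x. 1 - x" and g = "sn_fibre w"]) (auto intro!: derivative_eq_intros)
  then have "(sn_fibre w has_field_derivative deriv (sn_fibre w) (1 / 2) * (- 1)) (at (1 / 2))"
    by (subst (asm) e)
  from DERIV_unique[OF d this] have "deriv (sn_fibre w) (1 / 2) = - deriv (sn_fibre w) (1 / 2)" by simp
  then have "deriv (sn_fibre w) (1 / 2) = 0" by simp
  then have two: "zorder (sn_fibre w) (1 / 2) \<ge> 2"
    using w by (intro entire_critical_zorder[OF sn_fibre_holomorphic sn_fibre_nonzero])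
      (simp_all add: sn_fibre_eq_0_iff)
  define P where "P = {ecls \<tau> (\<tau> / 2), ecls \<tau> (\<tau> / 2 + 1 / 2)}"
  define B where "B = {c \<in> ell_curve \<tau> - P. fibre_div w c \<noteq> 0}"
  have fB: "finite B" by (rule finite_subset[OF _ fibre_div(2)[of w]]) (auto simp: B_def)
  have notpole: "2 * x + \<tau> \<notin> lattice (2 * \<tau>)" if "sn \<tau> (2 * x) = Aff w" for x
    using that by (auto simp: sn_def sn_den_eq_0_iff[OF tau] split: if_splits)
  have v: "fibre_div w (ecls \<tau> x) = zorder (sn_fibre w) (2 * x) \<and> ecls \<tau> x \<in> B"
    if "sn \<tau> (2 * x) = Aff w" for x
    using notpole[OF that] that zorder_sn_fibre_pos[OF that] pole_classes[of x]
      fibre_div_no_pole[of x w] by (auto simp: B_def P_def ell_curve_def)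
  \<comment> \<open>Points of the fibre appear halved in \<open>fibre_div\<close>: 1/2 becomes 1/4
    and \<open>b\<close> becomes b/2. Multiplicities 2 and 1 at distinct classes would exceed the
    degree two.\<close>
  have v1: "fibre_div w (ecls \<tau> (1 / 4)) \<ge> 2" "ecls \<tau> (1 / 4) \<in> B"
    using v[of "1 / 4"] w two by auto
  have v2: "fibre_div w (ecls \<tau> (b / 2)) \<ge> 1" "ecls \<tau> (b / 2) \<in> B"
    using v[of "b / 2"] zorder_sn_fibre_pos[of b w] w assms by auto
  have ne: "ecls \<tau> (b / 2) \<noteq> ecls \<tau> (1 / 4)"
  proof
    assume "ecls \<tau> (b / 2) = ecls \<tau> (1 / 4)"
    then have "b / 2 - 1 / 4 \<in> lattice \<tau>" by (simp add: ecls_eq_iff)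
    moreover have "b = 1 / 2 + 2 * (b / 2 - 1 / 4)" by (simp add: field_simps)
    ultimately show False using no by blast
  qed
  have nonneg: "fibre_div w c \<ge> 0" if "c \<in> B" for c
  proof -
    from that obtain x where "c = ecls \<tau> x" "ecls \<tau> x \<notin> P" by (auto simp: B_def ell_curve_def)
    then show ?thesis
      using pole_classes[of x] fibre_div_no_pole[of x w] zorder_sn_fibre_nonneg by (simp add: P_def)
  qed
  have "sum (fibre_div w) {ecls \<tau> (1 / 4), ecls \<tau> (b / 2)} \<le> sum (fibre_div w) B"
    using fB v1(2) v2(2) nonneg by (intro sum_mono2) auto
  moreover have "sum (fibre_div w) B = 2" using sum_fibre_div[of w] by (simp add: B_def P_def)
  ultimately show False using v1(1) v2(1) ne by simp
qed

text \<open>A period of \<open>sn \<tau>\<close> moves 1/2 within its fibre, which by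
  \<open>sn_critical_fibre\<close> is one class modulo twice the lattice.\<close>

lemma sn_translate_eq_iff:
  "(\<forall>x. sn \<tau> (x - a) = sn \<tau> (x - b)) \<longleftrightarrow> (\<exists>l\<in>lattice \<tau>. a = b + 2 * l)"
proof
  assume eq: "\<forall>x. sn \<tau> (x - a) = sn \<tau> (x - b)"
  have shift: "sn \<tau> (y + (a - b)) = sn \<tau> y" for y
    using eq[rule_format, of "y + a"] by (simp add: algebra_simps)
  then have "sn \<tau> (1 / 2 + (a - b)) = sn \<tau> (1 / 2)" by blast
  from sn_critical_fibre[OF this] show "\<exists>l\<in>lattice \<tau>. a = b + 2 * l"
    by (auto simp: algebra_simps)
next
  assume "\<exists>l\<in>lattice \<tau>. a = b + 2 * l"
  then obtain l where l: "l \<in> lattice \<tau>" "a = b + 2 * l" by blast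
  show "\<forall>x. sn \<tau> (x - a) = sn \<tau> (x - b)"
    using sn_double_periodic[OF l(1), of "_ - a"] by (simp add: l(2) algebra_simps)
qed

end

section \<open>Moebius transformations\<close>

lemma proj_scale:
  assumes "c \<noteq> 0"
  shows "proj (c *s v) = proj v"
  using assms by (simp add: proj_def)

lemma proj_homog [simp]: "proj (homog z) = z"
  by (cases z) (simp_all add: proj_def)

lemma homog_nonzero [simp]: "homog z \<noteq> 0"
  by (cases z) (simp_all add: vec_eq_iff forall_2)

lemma homog_proj:
  assumes "v \<noteq> 0"
  obtains c where "c \<noteq> 0" "homog (proj v) = c *s v"
proof (cases "v $ 2 = 0")
  case True
  then have "v $ 1 \<noteq> 0" using assms by (auto simp: vec_eq_iff forall_2)
  then show ?thesis using True that[of "1 / v $ 1"] by (simp add: proj_def vec_eq_iff forall_2)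
next
  case False
  then show ?thesis using that[of "1 / v $ 2"] by (simp add: proj_def vec_eq_iff forall_2)
qed

lemma mobius_proj:
  assumes "v \<noteq> 0"
  shows "mobius M (proj v) = proj (M *v v)"
proof -
  obtain c where "c \<noteq> 0" "homog (proj v) = c *s v" using homog_proj[OF assms] .
  then show ?thesis
    using proj_scale[of c "M *v v"] by (simp add: mobius_def vector_scalar_commute)
qed

lemma matrix_vector_nonzero:
  fixes M :: "complex ^ 2 ^ 2"
  assumes "det M \<noteq> 0" "v \<noteq> 0"
  shows "M *v v \<noteq> 0"
  using assms invertible_det_nz[of M] matrix_left_invertible_ker[of M] invertible_left_inverse[of M]
  by blast

lemma mobius_mult:
  assumes "det B \<noteq> 0"
  shows "mobius (A ** B) z = mobius A (mobius B z)"
proof -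
  have "mobius A (mobius B z) = proj (A *v (B *v homog z))"
    unfolding mobius_def[of B] by (rule mobius_proj) (simp add: matrix_vector_nonzero[OF assms])
  then show ?thesis by (simp add: mobius_def matrix_vector_mul_assoc)
qed

text \<open>The adjugate induces the same Moebius map as the inverse, and its entries are visibly
  holomorphic in those of \<open>M\<close>, without a division by the determinant.\<close>

definition adj2 :: "complex ^ 2 ^ 2 \<Rightarrow> complex ^ 2 ^ 2" where
  "adj2 M = vector [vector [M $ 2 $ 2, - M $ 1 $ 2], vector [- M $ 2 $ 1, M $ 1 $ 1]]"

lemma det_adj2: "det (adj2 M) = det M"
  by (simp add: adj2_def det_2)

lemma adj2_mult: "adj2 M *v (M *v v) = det M *s v" "M *v (adj2 M *v v) = det M *s v"
  by (simp_all add: adj2_def det_2 vec_eq_iff forall_2 matrix_vector_mult_def sum_2 algebra_simps)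

lemma mobius_adj2:
  assumes "det M \<noteq> 0"
  shows "mobius (adj2 M) (mobius M z) = z" "mobius M (mobius (adj2 M) z) = z"
proof -
  have "mobius (adj2 M) (mobius M z) = proj (adj2 M *v (M *v homog z))"
    unfolding mobius_def[of M] by (rule mobius_proj) (simp add: matrix_vector_nonzero[OF assms])
  then show "mobius (adj2 M) (mobius M z) = z" using assms by (simp add: adj2_mult proj_scale)
  have "mobius M (mobius (adj2 M) z) = proj (M *v (adj2 M *v homog z))"
    unfolding mobius_def[of "adj2 M"]
    by (rule mobius_proj) (simp add: matrix_vector_nonzero assms det_adj2)
  then show "mobius M (mobius (adj2 M) z) = z" using assms by (simp add: adj2_mult proj_scale)
qed

lemma mobius_Aff:
  "mobius M (Aff w) = (if M $ 2 $ 1 * w + M $ 2 $ 2 = 0 then Infty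
    else Aff ((M $ 1 $ 1 * w + M $ 1 $ 2) / (M $ 2 $ 1 * w + M $ 2 $ 2)))"
  by (simp add: mobius_def proj_def matrix_vector_mult_def sum_2)

lemma mobius_Aff_deriv:
  assumes "mobius M (Aff w) \<noteq> Infty"
  shows "((\<lambda>w. coord (mobius M (Aff w))) has_field_derivative
      det M / (M $ 2 $ 1 * w + M $ 2 $ 2)\<^sup>2) (at w)"
    "\<forall>\<^sub>F u in nhds w. mobius M (Aff u) \<noteq> Infty"
proof -
  let ?d = "\<lambda>u. M $ 2 $ 1 * u + M $ 2 $ 2"
  have d: "?d w \<noteq> 0" using assms by (auto simp: mobius_Aff split: if_splits)
  have "open {u. ?d u \<noteq> 0}" by (intro open_Collect_neq continuous_intros)
  then have ev: "\<forall>\<^sub>F u in nhds w. ?d u \<noteq> 0"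
    using d unfolding eventually_nhds by (intro exI[of _ "{u. ?d u \<noteq> 0}"]) auto
  then show "\<forall>\<^sub>F u in nhds w. mobius M (Aff u) \<noteq> Infty"
    by eventually_elim (simp add: mobius_Aff)
  have lin: "((\<lambda>u. a * u + b) has_field_derivative a) (at w)" for a b :: complex
    using DERIV_add[OF DERIV_cmult_Id[of a w UNIV] DERIV_const[of b "at w"]] by simp
  have "((\<lambda>u. (M $ 1 $ 1 * u + M $ 1 $ 2) / ?d u) has_field_derivative
      (M $ 1 $ 1 * ?d w - (M $ 1 $ 1 * w + M $ 1 $ 2) * M $ 2 $ 1) / (?d w * ?d w)) (at w)"
    using DERIV_divide[OF lin[of "M $ 1 $ 1" "M $ 1 $ 2"] lin[of "M $ 2 $ 1" "M $ 2 $ 2"] d] .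
  also have "M $ 1 $ 1 * ?d w - (M $ 1 $ 1 * w + M $ 1 $ 2) * M $ 2 $ 1 = det M"
    unfolding det_2 by (simp only: algebra_simps)
  also have "?d w * ?d w = (?d w)\<^sup>2" by (simp only: power2_eq_square)
  finally have D: "((\<lambda>u. (M $ 1 $ 1 * u + M $ 1 $ 2) / ?d u) has_field_derivative det M / (?d w)\<^sup>2) (at w)" .
  have "\<forall>\<^sub>F u in nhds w. (M $ 1 $ 1 * u + M $ 1 $ 2) / ?d u = coord (mobius M (Aff u))"
    using ev by eventually_elim (simp add: mobius_Aff)
  from D DERIV_cong_ev[OF refl this refl]
  show "((\<lambda>w. coord (mobius M (Aff w))) has_field_derivative det M / (?d w)\<^sup>2) (at w)" by blast
qed

definition swap2 :: "complex ^ 2 ^ 2" where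
  "swap2 = vector [vector [0, 1], vector [1, 0]]"

lemma P1_inv_eq_mobius: "P1_inv = mobius swap2"
  by (simp add: P1_inv_def swap2_def)

lemma det_swap2: "det swap2 \<noteq> 0"
  by (simp add: swap2_def det_2)

lemma mobius_1: "mobius (mat 1) z = z"
  by (simp add: mobius_def)

text \<open>In homogeneous coordinates a Moebius map is multiplication by a matrix, so the case
  distinction between the two charts of the projective line is made here once and for all.\<close>

lemma P1_holomorphic_on_iff_lift:
  "P1_holomorphic_on f A \<longleftrightarrow> (\<forall>x\<in>A. \<exists>N w. open N \<and> x \<in> N \<and>
     (\<forall>i. (\<lambda>y. w y $ i) holomorphic_on N) \<and> (\<forall>y\<in>N. w y \<noteq> 0 \<and> f y = proj (w y)))"
  (is "_ \<longleftrightarrow> (\<forall>x\<in>A. ?L x)")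
proof -
  have 1: "?L x" if N: "open N" "x \<in> N" "g holomorphic_on N"
    and or: "(\<forall>y\<in>N. f y = Aff (g y)) \<or> (\<forall>y\<in>N. f y = P1_inv (Aff (g y)))" for x N g
    using or
  proof
    assume "\<forall>y\<in>N. f y = Aff (g y)"
    then show ?thesis using N
      by (intro exI[of _ N] exI[of _ "\<lambda>y. vector [g y, 1]"])
        (auto simp: forall_2 vec_eq_iff proj_def)
  next
    assume "\<forall>y\<in>N. f y = P1_inv (Aff (g y))"
    then show ?thesis using N
      by (intro exI[of _ N] exI[of _ "\<lambda>y. vector [1, g y]"])
        (auto simp: forall_2 vec_eq_iff proj_def P1_inv_simps inverse_eq_divide)
  qed
  have 2: "\<exists>N g. open N \<and> x \<in> N \<and> g holomorphic_on N \<and>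
      ((\<forall>y\<in>N. f y = Aff (g y)) \<or> (\<forall>y\<in>N. f y = P1_inv (Aff (g y))))"
    if N: "open N" "x \<in> N" and hol: "\<And>i. (\<lambda>y. w y $ i) holomorphic_on N"
      and w: "\<And>y. y \<in> N \<Longrightarrow> w y \<noteq> 0 \<and> f y = proj (w y)" for x N and w :: "complex \<Rightarrow> complex ^ 2"
  proof -
    have op: "open {y \<in> N. w y $ i \<noteq> 0}" for i
      using continuous_open_preimage[OF holomorphic_on_imp_continuous_on[OF hol[of i]] N(1), of "- {0}"]
      by (simp add: vimage_def Int_def open_delete Compl_eq_Diff_UNIV)
    have q: "(\<lambda>y. w y $ i / w y $ j) holomorphic_on {y \<in> N. w y $ j \<noteq> 0}" for i j
      by (rule holomorphic_on_divide) (auto intro: holomorphic_on_subset[OF hol])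
    show ?thesis
    proof (cases "w x $ 2 = 0")
      case False
      have "\<forall>y\<in>{y \<in> N. w y $ 2 \<noteq> 0}. f y = Aff (w y $ 1 / w y $ 2)" using w by (simp add: proj_def)
      then show ?thesis using op[of 2] q[of 1 2] False N(2)
        by (intro exI[of _ "{y \<in> N. w y $ 2 \<noteq> 0}"] exI[of _ "\<lambda>y. w y $ 1 / w y $ 2"]) auto
    next
      case True
      then have "w x $ 1 \<noteq> 0" using w[OF N(2)] by (auto simp: vec_eq_iff forall_2)
      moreover have "\<forall>y\<in>{y \<in> N. w y $ 1 \<noteq> 0}. f y = P1_inv (Aff (w y $ 2 / w y $ 1))"
        using w by (simp add: proj_def P1_inv_simps)
      ultimately show ?thesis using op[of 1] q[of 2 1] N(2)
        by (intro exI[of _ "{y \<in> N. w y $ 1 \<noteq> 0}"] exI[of _ "\<lambda>y. w y $ 2 / w y $ 1"]) auto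
    qed
  qed
  show ?thesis
    unfolding P1_holomorphic_on_def
  proof (intro iffI ballI)
    fix x
    assume "\<forall>x\<in>A. \<exists>N g. open N \<and> x \<in> N \<and> g holomorphic_on N \<and>
      ((\<forall>y\<in>N. f y = Aff (g y)) \<or> (\<forall>y\<in>N. f y = P1_inv (Aff (g y))))" "x \<in> A"
    from bspec[OF this] show "?L x"
      by (elim exE conjE) (rule 1)
  next
    fix x
    assume "\<forall>x\<in>A. ?L x" "x \<in> A"
    from bspec[OF this] show "\<exists>N g. open N \<and> x \<in> N \<and> g holomorphic_on N \<and>
        ((\<forall>y\<in>N. f y = Aff (g y)) \<or> (\<forall>y\<in>N. f y = P1_inv (Aff (g y))))"
    proof (elim exE conjE)
      fix N and w :: "complex \<Rightarrow> complex ^ 2"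
      assume "open N" "x \<in> N" "\<forall>i. (\<lambda>y. w y $ i) holomorphic_on N"
        "\<forall>y\<in>N. w y \<noteq> 0 \<and> f y = proj (w y)"
      then show ?thesis by (intro 2[of N x w]) auto
    qed
  qed
qed

lemma P1_holomorphic_mobius:
  assumes g: "P1_holomorphic_on g A"
    and M: "\<And>x. x \<in> A \<Longrightarrow> \<exists>N (M :: complex \<Rightarrow> complex ^ 2 ^ 2). open N \<and> x \<in> N \<and>
      (\<forall>i j. (\<lambda>y. M y $ i $ j) holomorphic_on N) \<and>
      (\<forall>y\<in>N. det (M y) \<noteq> 0 \<and> f y = mobius (M y) (g y))"
  shows "P1_holomorphic_on f A"
  unfolding P1_holomorphic_on_iff_lift
proof
  fix x assume x: "x \<in> A"
  from M[OF x] bspec[OF g[unfolded P1_holomorphic_on_iff_lift] x]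
  show "\<exists>N (w :: complex \<Rightarrow> complex ^ 2). open N \<and> x \<in> N \<and> (\<forall>i. (\<lambda>y. w y $ i) holomorphic_on N) \<and>
      (\<forall>y\<in>N. w y \<noteq> 0 \<and> f y = proj (w y))"
  proof (elim exE conjE)
    fix N N' and M :: "complex \<Rightarrow> complex ^ 2 ^ 2" and w :: "complex \<Rightarrow> complex ^ 2"
    assume N: "open N" "x \<in> N" "open N'" "x \<in> N'"
      and M: "\<forall>i j. (\<lambda>y. M y $ i $ j) holomorphic_on N"
      and f: "\<forall>y\<in>N. det (M y) \<noteq> 0 \<and> f y = mobius (M y) (g y)"
      and w: "\<forall>i. (\<lambda>y. w y $ i) holomorphic_on N'"
      and g: "\<forall>y\<in>N'. w y \<noteq> 0 \<and> g y = proj (w y)"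
    have "(\<lambda>y. (M y *v w y) $ i) holomorphic_on N \<inter> N'" for i
    proof -
      have "(\<lambda>y. M y $ i $ 1 * w y $ 1 + M y $ i $ 2 * w y $ 2) holomorphic_on N \<inter> N'"
        by (rule holomorphic_on_add; rule holomorphic_on_mult)
          (auto intro: holomorphic_on_subset[OF M[rule_format]] holomorphic_on_subset[OF w[rule_format]])
      then show ?thesis by (simp add: matrix_vector_mult_def sum_2)
    qed
    moreover have "M y *v w y \<noteq> 0 \<and> f y = proj (M y *v w y)" if "y \<in> N \<inter> N'" for y
      using that f g by (simp add: matrix_vector_nonzero mobius_proj)
    ultimately show ?thesis using N by (intro exI[of _ "N \<inter> N'"] exI[of _ "\<lambda>y. M y *v w y"]) auto
  qed
qed

section \<open>The flat model\<close>

lemma funpow_involution: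
  assumes "\<And>z. f (f z) = z"
  shows "f ^^ k = (if even k then id else f)"
  using assms by (induction k) (auto simp: fun_eq_iff)

lemma rho_eq: "rho m n z = (if even m then id else P1_neg) ((if even n then id else P1_inv) z)"
  using funpow_involution[of P1_neg "nat \<bar>m\<bar>", OF P1_neg_neg]
    funpow_involution[of P1_inv "nat \<bar>n\<bar>", OF P1_inv_inv]
  by (simp add: rho_def even_nat_iff)

text \<open>The two matrices anticommute, and the sign disappears projectively. This is what makes
  \<open>rho\<close> a homomorphism on the lattice.\<close>

lemma P1_neg_inv_commute: "P1_inv (P1_neg z) = P1_neg (P1_inv z)"
  by (cases z) (simp_all add: P1_inv_simps)

lemma rho_add: "rho (m + m') (n + n') z = rho m n (rho m' n' z)"
  by (auto simp: rho_eq P1_neg_inv_commute P1_neg_neg P1_inv_inv)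

lemma rho_0 [simp]: "rho 0 0 z = z"
  by (simp add: rho_eq)

lemma rho_involution: "rho m n (rho m n z) = z"
  by (auto simp: rho_eq P1_neg_inv_commute P1_neg_neg P1_inv_inv)

lemma rho_uminus: "rho (- m) (- n) = rho m n"
  by (simp add: rho_def)

lemma mem_flat_orbit:
  "(y, w) \<in> flat_orbit \<tau> (x, z) \<longleftrightarrow> (\<exists>m n. y = x + (of_int m + of_int n * \<tau>) \<and> w = rho m n z)"
  by (auto simp: flat_orbit_def)

lemma flat_orbit_eq_iff:
  "flat_orbit \<tau> (x, z) = flat_orbit \<tau> (x', z') \<longleftrightarrow>
    (\<exists>m n. x' = x + (of_int m + of_int n * \<tau>) \<and> z' = rho m n z)"
proof
  assume "flat_orbit \<tau> (x, z) = flat_orbit \<tau> (x', z')"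
  moreover have "(x', z') \<in> flat_orbit \<tau> (x', z')"
    unfolding mem_flat_orbit by (rule exI[of _ 0], rule exI[of _ 0]) simp
  ultimately show "\<exists>m n. x' = x + (of_int m + of_int n * \<tau>) \<and> z' = rho m n z"
    using mem_flat_orbit by blast
next
  have sub: "flat_orbit \<tau> (x + (of_int m + of_int n * \<tau>), rho m n z) \<subseteq> flat_orbit \<tau> (x, z)" for x z m n
  proof (clarify)
    fix y w assume "(y, w) \<in> flat_orbit \<tau> (x + (of_int m + of_int n * \<tau>), rho m n z)"
    then obtain m' n' where "y = x + (of_int m + of_int n * \<tau>) + (of_int m' + of_int n' * \<tau>)"
      "w = rho m' n' (rho m n z)" unfolding mem_flat_orbit by blast
    then have "y = x + (of_int (m' + m) + of_int (n' + n) * \<tau>)" "w = rho (m' + m) (n' + n) z"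
      by (simp_all add: rho_add algebra_simps)
    then show "(y, w) \<in> flat_orbit \<tau> (x, z)" unfolding mem_flat_orbit by blast
  qed
  assume "\<exists>m n. x' = x + (of_int m + of_int n * \<tau>) \<and> z' = rho m n z"
  then obtain m n where *: "x' = x + (of_int m + of_int n * \<tau>)" "z' = rho m n z" by blast
  have "x = x' + (of_int (- m) + of_int (- n) * \<tau>)" "z = rho (- m) (- n) z'"
    using * by (simp_all add: rho_uminus rho_involution)
  then have "flat_orbit \<tau> (x, z) \<subseteq> flat_orbit \<tau> (x', z')" using sub by metis
  then show "flat_orbit \<tau> (x, z) = flat_orbit \<tau> (x', z')" using sub * by blast
qed

text \<open>As \<open>\<tau>\<close> is not real, only the trivial lattice element fixes a base
  point, so each fibre of the quotient is a full projective line.\<close>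

lemma flat_orbit_same_base:
  assumes "Im \<tau> \<noteq> 0" "flat_orbit \<tau> (x, z) = flat_orbit \<tau> (x, z')"
  shows "z = z'"
proof -
  obtain m n where "x = x + (of_int m + of_int n * \<tau>)" "z' = rho m n z"
    using assms(2) flat_orbit_eq_iff by blast
  then have "of_int 0 + of_int 0 * \<tau> = of_int m + of_int n * \<tau>" "z' = rho m n z" by auto
  with lattice_coords_unique[OF assms(1) this(1)] show ?thesis by auto
qed

lemma flat_orbit_base: "fst ` flat_orbit \<tau> (x, z) = ecls \<tau> x"
  by (force simp: flat_orbit_def ecls_def lattice_def)

lemma flat_triv:
  assumes "Im \<tau> \<noteq> 0" "inj_on (ecls \<tau>) N" "y \<in> N"
  shows "(THE w. \<exists>x\<in>N. (x, w) \<in> flat_orbit \<tau> (y, z)) = z"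
proof (rule the_equality)
  show "\<exists>x\<in>N. (x, z) \<in> flat_orbit \<tau> (y, z)"
    using assms(3) unfolding mem_flat_orbit by (intro bexI[of _ y] exI[of _ 0]) auto
  fix w assume "\<exists>x\<in>N. (x, w) \<in> flat_orbit \<tau> (y, z)"
  then obtain x m n where x: "x \<in> N" "x = y + (of_int m + of_int n * \<tau>)" "w = rho m n z"
    unfolding mem_flat_orbit by blast
  then have "ecls \<tau> x = ecls \<tau> y" using ecls_add_lattice[OF latticeI] by metis
  then have "x = y" using assms x(1) by (auto dest: inj_onD)
  then have "flat_orbit \<tau> (y, z) = flat_orbit \<tau> (y, w)" using x flat_orbit_eq_iff by blast
  then show "w = z" using flat_orbit_same_base[OF assms(1)] by blast
qed

lemma ecls_inj_nbhd:
  assumes "Im \<tau> \<noteq> 0"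
  obtains e where "e > 0" "\<And>x. inj_on (ecls \<tau>) (ball x e)"
proof -
  obtain d where d: "d > 0" "\<And>l. l \<in> lattice \<tau> \<Longrightarrow> l \<noteq> 0 \<Longrightarrow> d \<le> norm l"
    using lattice_discrete[OF assms] by metis
  have "inj_on (ecls \<tau>) (ball x (d / 2))" for x
  proof (rule inj_onI)
    fix y z assume yz: "y \<in> ball x (d / 2)" "z \<in> ball x (d / 2)" "ecls \<tau> y = ecls \<tau> z"
    then have "y - z \<in> lattice \<tau>" by (simp add: ecls_eq_iff)
    moreover have "norm (y - z) < d"
      using yz(1,2) dist_triangle_half_r[of x y d z] by (simp add: dist_norm dist_commute)
    ultimately show "y = z" using d(2)[of "y - z"] by auto
  qed
  then show ?thesis using that[of "d / 2"] d(1) by simp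
qed

text \<open>The saturation of \<open>N\<close> is the union of its lattice translates.\<close>

lemma curve_open_image:
  assumes "open N"
  shows "curve_open \<tau> (ecls \<tau> ` N)"
proof -
  have "ecls \<tau> -` ecls \<tau> ` N = (\<Union>l\<in>lattice \<tau>. (\<lambda>x. l + x) ` N)"
  proof (intro equalityI subsetI)
    fix x assume "x \<in> ecls \<tau> -` ecls \<tau> ` N"
    then obtain y where y: "y \<in> N" "ecls \<tau> x = ecls \<tau> y" by auto
    then have "x - y \<in> lattice \<tau>" by (simp add: ecls_eq_iff)
    moreover have "x = (x - y) + y" by simp
    ultimately show "x \<in> (\<Union>l\<in>lattice \<tau>. (\<lambda>x. l + x) ` N)" using y(1) by blast
  next
    fix x assume "x \<in> (\<Union>l\<in>lattice \<tau>. (\<lambda>x. l + x) ` N)"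
    then obtain l y where "l \<in> lattice \<tau>" "y \<in> N" "x = l + y" by blast
    then show "x \<in> ecls \<tau> -` ecls \<tau> ` N" using ecls_add_lattice[of l \<tau> y] by (auto simp: add.commute)
  qed
  moreover have "open (\<Union>l\<in>lattice \<tau>. (\<lambda>x. l + x) ` N)"
    by (intro open_UN ballI open_translation assms)
  ultimately show ?thesis by (auto simp: curve_open_def ell_curve_def)
qed

section \<open>Sections of the surface as twisted functions\<close>

lemma twisted_rho:
  assumes tw: "twisted \<tau> f"
  shows "f (x + (of_int m + of_int n * \<tau>)) = rho m n (f x)"
proof -
  have s1: "f (y - 1) = P1_neg (f y)" for y
    using twisted_1[OF tw, of "y - 1"] P1_neg_neg[of "f (y - 1)"] by simp
  have s2: "f (y - \<tau>) = P1_inv (f y)" for y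
    using twisted_tau[OF tw, of "y - \<tau>"] P1_inv_inv[of "f (y - \<tau>)"] by simp
  have 1: "f (y + of_int m) = rho m 0 (f y)" for y
  proof (induction m rule: int_induct[where k = 0])
    case (step1 i)
    have "f (y + of_int (i + 1)) = P1_neg (f (y + of_int i))"
      using twisted_1[OF tw, of "y + of_int i"] by (simp add: add.assoc)
    also have "\<dots> = rho 1 0 (rho i 0 (f y))" using step1 by (simp add: rho_eq)
    finally show ?case using rho_add[of 1 i 0 0 "f y"] by (simp add: add.commute)
  next
    case (step2 i)
    have "f (y + of_int (i - 1)) = P1_neg (f (y + of_int i))"
      using s1[of "y + of_int i"] by (simp add: algebra_simps)
    also have "\<dots> = rho (- 1) 0 (rho i 0 (f y))" using step2 by (simp add: rho_eq)
    finally show ?case using rho_add[of "- 1" i 0 0 "f y"] by simp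
  qed simp
  have 2: "f (y + of_int n * \<tau>) = rho 0 n (f y)" for y
  proof (induction n rule: int_induct[where k = 0])
    case (step1 i)
    have "f (y + of_int (i + 1) * \<tau>) = P1_inv (f (y + of_int i * \<tau>))"
      using twisted_tau[OF tw, of "y + of_int i * \<tau>"] by (simp add: algebra_simps)
    also have "\<dots> = rho 0 1 (rho 0 i (f y))" using step1 by (simp add: rho_eq)
    finally show ?case using rho_add[of 0 0 1 i "f y"] by (simp add: add.commute)
  next
    case (step2 i)
    have "f (y + of_int (i - 1) * \<tau>) = P1_inv (f (y + of_int i * \<tau>))"
      using s2[of "y + of_int i * \<tau>"] by (simp add: algebra_simps)
    also have "\<dots> = rho 0 (- 1) (rho 0 i (f y))" using step2 by (simp add: rho_eq)
    finally show ?case using rho_add[of 0 0 "- 1" i "f y"] by simp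
  qed simp
  have "f (x + (of_int m + of_int n * \<tau>)) = f (x + of_int n * \<tau> + of_int m)"
    by (simp add: algebra_simps)
  also have "\<dots> = rho (m + 0) (0 + n) (f x)" unfolding rho_add 1 2 ..
  finally show ?thesis by simp
qed

lemma holomorphic_adj2:
  fixes M :: "complex \<Rightarrow> complex ^ 2 ^ 2"
  assumes "\<And>i j. (\<lambda>y. M y $ i $ j) holomorphic_on N"
  shows "(\<lambda>y. adj2 (M y) $ i $ j) holomorphic_on N"
proof -
  have "\<forall>i j. (\<lambda>y. adj2 (M y) $ i $ j) holomorphic_on N"
    using assms by (simp add: forall_2 adj2_def holomorphic_on_minus)
  then show ?thesis by blast
qed

lemma holomorphic_matrix_mult:
  fixes A B :: "complex \<Rightarrow> complex ^ 2 ^ 2"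
  assumes "\<And>i j. (\<lambda>y. A y $ i $ j) holomorphic_on N" "\<And>i j. (\<lambda>y. B y $ i $ j) holomorphic_on N"
  shows "(\<lambda>y. (A y ** B y) $ i $ j) holomorphic_on N"
proof -
  have "(\<lambda>y. A y $ i $ 1 * B y $ 1 $ j + A y $ i $ 2 * B y $ 2 $ j) holomorphic_on N"
    by (intro holomorphic_on_add holomorphic_on_mult assms)
  then show ?thesis by (simp add: matrix_matrix_mult_def sum_2)
qed

locale model =
  fixes \<tau> :: complex and S :: "'s fibration" and \<Phi> :: "'s \<Rightarrow> (complex \<times> P1) set"
  assumes Im_tau: "Im \<tau> \<noteq> 0"
    and ruled: "ruled_surface \<tau> S"
    and iso: "ruled_iso \<tau> S (flat_surface \<tau>) \<Phi>"
begin

text \<open>The point of the surface that corresponds under \<^term>\<open>\<Phi>\<close> to the orbit of \<^term>\<open>(x, z)\<close>.\<close>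

definition pt :: "complex \<Rightarrow> P1 \<Rightarrow> 's" where
  "pt x z = inv_into (total S) \<Phi> (flat_orbit \<tau> (x, z))"

lemma bij_Phi: "bij_betw \<Phi> (total S) (range (flat_orbit \<tau>))"
  using iso by (simp add: ruled_iso_def flat_surface_def)

lemma base_Phi: "p \<in> total S \<Longrightarrow> fst ` \<Phi> p = bproj S p"
  using iso by (simp add: ruled_iso_def flat_surface_def)

lemma pt_total: "pt x z \<in> total S"
  and Phi_pt: "\<Phi> (pt x z) = flat_orbit \<tau> (x, z)"
proof -
  have "flat_orbit \<tau> (x, z) \<in> \<Phi> ` total S"
    using bij_betw_imp_surj_on[OF bij_Phi] by simp
  then show "pt x z \<in> total S" "\<Phi> (pt x z) = flat_orbit \<tau> (x, z)"
    unfolding pt_def by (rule inv_into_into, rule f_inv_into_f)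
qed

lemma bproj_pt: "bproj S (pt x z) = ecls \<tau> x"
  using base_Phi[OF pt_total, of x z] by (simp add: Phi_pt flat_orbit_base)

lemma pt_eq_iff:
  "pt x z = pt x' z' \<longleftrightarrow> (\<exists>m n. x' = x + (of_int m + of_int n * \<tau>) \<and> z' = rho m n z)"
proof -
  have "pt x z = pt x' z' \<longleftrightarrow> flat_orbit \<tau> (x, z) = flat_orbit \<tau> (x', z')"
    using bij_Phi pt_total Phi_pt unfolding bij_betw_def inj_on_def by metis
  then show ?thesis by (simp add: flat_orbit_eq_iff)
qed

lemma pt_eq_same_base [simp]: "pt x z = pt x z' \<longleftrightarrow> z = z'"
  using Phi_pt flat_orbit_same_base[OF Im_tau] by metis

lemma pt_cases:
  assumes "p \<in> total S" "bproj S p = ecls \<tau> x"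
  obtains z where "p = pt x z"
proof -
  have "\<Phi> p \<in> range (flat_orbit \<tau>)" using bij_Phi assms(1) by (auto simp: bij_betw_def)
  then obtain x0 z0 where p: "\<Phi> p = flat_orbit \<tau> (x0, z0)" by auto
  have "ecls \<tau> x0 = ecls \<tau> x" using base_Phi[OF assms(1)] assms(2) by (simp add: p flat_orbit_base)
  then have "x - x0 \<in> lattice \<tau>" using ecls_eq_iff by metis
  then obtain m n where "x - x0 = of_int m + of_int n * \<tau>" unfolding lattice_def by blast
  then have "x = x0 + (of_int m + of_int n * \<tau>)" by (metis add.commute diff_add_cancel)
  then have "flat_orbit \<tau> (x0, z0) = flat_orbit \<tau> (x, rho m n z0)"
    unfolding flat_orbit_eq_iff by blast
  then have "\<Phi> p = \<Phi> (pt x (rho m n z0))" by (simp add: p Phi_pt)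
  then have "p = pt x (rho m n z0)" using bij_Phi assms(1) pt_total by (auto simp: bij_betw_def inj_on_def)
  then show ?thesis using that by blast
qed

lemma total_cases:
  assumes "p \<in> total S"
  obtains x z where "p = pt x z"
proof -
  have "bproj S p \<in> ell_curve \<tau>" using ruled assms by (auto simp: ruled_surface_def)
  then obtain x where "bproj S p = ecls \<tau> x" by (auto simp: ell_curve_def)
  then show ?thesis using pt_cases[OF assms] that by blast
qed

lemma trivs_cover:
  obtains V \<phi> where "(V, \<phi>) \<in> trivs S" "ecls \<tau> x \<in> V"
proof -
  have "ell_curve \<tau> \<subseteq> (\<Union>(U, \<phi>)\<in>trivs S. U)" using ruled by (simp add: ruled_surface_def)
  moreover have "ecls \<tau> x \<in> ell_curve \<tau>" by (simp add: ell_curve_def)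
  ultimately have "ecls \<tau> x \<in> (\<Union>(U, \<phi>)\<in>trivs S. U)" by (rule subsetD)
  then show ?thesis using that by auto
qed

definition flat_coord :: "complex set \<Rightarrow> 's \<Rightarrow> P1" where
  "flat_coord N p = (THE z. \<exists>x\<in>N. (x, z) \<in> \<Phi> p)"

lemma flat_coord_pt:
  assumes "inj_on (ecls \<tau>) N" "y \<in> N"
  shows "flat_coord N (pt y z) = z"
  unfolding flat_coord_def Phi_pt by (rule flat_triv[OF Im_tau assms])

lemma flat_coord_compatible:
  assumes "(V, \<phi>) \<in> trivs S" "open N" "inj_on (ecls \<tau>) N"
  shows "compatible \<tau> S V \<phi> (ecls \<tau> ` N) (flat_coord N)"
proof -
  have "(ecls \<tau> ` N, \<lambda>p. THE z. \<exists>x\<in>N. (x, z) \<in> p) \<in> trivs (flat_surface \<tau>)"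
    using assms(2,3) by (auto simp: flat_surface_def)
  then have "compatible \<tau> S V \<phi> (ecls \<tau> ` N) ((\<lambda>p. THE z. \<exists>x\<in>N. (x, z) \<in> p) \<circ> \<Phi>)"
    using iso assms(1) unfolding ruled_iso_def by blast
  then show ?thesis by (simp add: o_def flat_coord_def[abs_def])
qed

text \<open>An atlas chart mediates: the change from it to \<open>\<zeta>\<close> is composed with
  the inverse of the change from it to the flat coordinate. Calculations can then be made with the
  flat \<open>z\<close> alone.\<close>

lemma local_matrix:
  assumes U: "curve_open \<tau> U" "\<forall>(V, \<phi>)\<in>trivs S. compatible \<tau> S V \<phi> U \<zeta>" and x: "ecls \<tau> x \<in> U"
  obtains N and M :: "complex \<Rightarrow> complex ^ 2 ^ 2" where "open N" "x \<in> N" "\<And>i j. (\<lambda>y. M y $ i $ j) holomorphic_on N"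
    "\<And>y. y \<in> N \<Longrightarrow> det (M y) \<noteq> 0" "\<And>y. y \<in> N \<Longrightarrow> ecls \<tau> y \<in> U"
    "\<And>y z. y \<in> N \<Longrightarrow> \<zeta> (pt y z) = mobius (M y) z"
proof -
  obtain e where e: "e > 0" "\<And>x. inj_on (ecls \<tau>) (ball x e)" using ecls_inj_nbhd[OF Im_tau] by metis
  let ?B = "ball x e"
  obtain V \<phi> where V: "(V, \<phi>) \<in> trivs S" "ecls \<tau> x \<in> V" using trivs_cover .
  have xB: "x \<in> ?B" using e(1) by simp
  have "compatible \<tau> S V \<phi> U \<zeta>" using U(2) V(1) by auto
  then have "\<exists>N (M :: complex \<Rightarrow> complex ^ 2 ^ 2). open N \<and> x \<in> N \<and> (\<forall>i j. (\<lambda>y. M y $ i $ j) holomorphic_on N) \<and>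
      (\<forall>y\<in>N. det (M y) \<noteq> 0) \<and>
      (\<forall>y\<in>N. \<forall>p\<in>total S. bproj S p = ecls \<tau> y \<longrightarrow> \<zeta> p = mobius (M y) (\<phi> p))"
    unfolding compatible_def using V(2) x by blast
  moreover have "\<exists>N (M :: complex \<Rightarrow> complex ^ 2 ^ 2). open N \<and> x \<in> N \<and> (\<forall>i j. (\<lambda>y. M y $ i $ j) holomorphic_on N) \<and>
      (\<forall>y\<in>N. det (M y) \<noteq> 0) \<and>
      (\<forall>y\<in>N. \<forall>p\<in>total S. bproj S p = ecls \<tau> y \<longrightarrow> flat_coord ?B p = mobius (M y) (\<phi> p))"
    using flat_coord_compatible[OF V(1) open_ball e(2)] V(2) xB unfolding compatible_def by blast
  ultimately show ?thesis
  proof (elim exE conjE)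
    fix N1 N2 and M1 M2 :: "complex \<Rightarrow> complex ^ 2 ^ 2"
    assume 1: "open N1" "x \<in> N1" "\<forall>i j. (\<lambda>y. M1 y $ i $ j) holomorphic_on N1"
        "\<forall>y\<in>N1. det (M1 y) \<noteq> 0"
        "\<forall>y\<in>N1. \<forall>p\<in>total S. bproj S p = ecls \<tau> y \<longrightarrow> \<zeta> p = mobius (M1 y) (\<phi> p)"
      and 2: "open N2" "x \<in> N2" "\<forall>i j. (\<lambda>y. M2 y $ i $ j) holomorphic_on N2"
        "\<forall>y\<in>N2. det (M2 y) \<noteq> 0"
        "\<forall>y\<in>N2. \<forall>p\<in>total S. bproj S p = ecls \<tau> y \<longrightarrow> flat_coord ?B p = mobius (M2 y) (\<phi> p)"
    define N where "N = N1 \<inter> N2 \<inter> ?B \<inter> ecls \<tau> -` U"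
    show ?thesis
    proof (rule that[of N "\<lambda>y. M1 y ** adj2 (M2 y)"])
      show "open N" using 1(1) 2(1) U(1) by (auto simp: N_def curve_open_def)
      show "x \<in> N" using 1(2) 2(2) xB x by (simp add: N_def)
      show "(\<lambda>y. (M1 y ** adj2 (M2 y)) $ i $ j) holomorphic_on N" for i j
      proof (rule holomorphic_matrix_mult)
        show "(\<lambda>y. M1 y $ i $ j) holomorphic_on N" for i j
          by (rule holomorphic_on_subset[OF 1(3)[rule_format]]) (auto simp: N_def)
        show "(\<lambda>y. adj2 (M2 y) $ i $ j) holomorphic_on N" for i j
          by (rule holomorphic_on_subset[OF holomorphic_adj2[OF 2(3)[rule_format]]]) (auto simp: N_def)
      qed
      fix y assume y: "y \<in> N"
      then show "det (M1 y ** adj2 (M2 y)) \<noteq> 0" "ecls \<tau> y \<in> U"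
        using 1(4) 2(4) by (auto simp: N_def det_mul det_adj2)
      fix z
      have "flat_coord ?B (pt y z) = z" using y by (intro flat_coord_pt e(2)) (auto simp: N_def)
      then have z: "z = mobius (M2 y) (\<phi> (pt y z))" using 2(5) y pt_total bproj_pt by (auto simp: N_def)
      have "\<zeta> (pt y z) = mobius (M1 y) (\<phi> (pt y z))" using 1(5) y pt_total bproj_pt by (auto simp: N_def)
      also have "\<phi> (pt y z) = mobius (adj2 (M2 y)) (mobius (M2 y) (\<phi> (pt y z)))"
        using mobius_adj2(1)[of "M2 y" "\<phi> (pt y z)"] 2(4) y by (simp add: N_def)
      also have "\<dots> = mobius (adj2 (M2 y)) z" using z by simp
      finally show "\<zeta> (pt y z) = mobius (M1 y ** adj2 (M2 y)) z"
        using mobius_mult[of "adj2 (M2 y)"] 2(4) y by (simp add: N_def det_adj2)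
    qed
  qed
qed

lemma trivs_properties:
  assumes "(U, \<phi>) \<in> trivs S"
  shows "curve_open \<tau> U" "\<forall>(V, \<psi>)\<in>trivs S. compatible \<tau> S V \<psi> U \<phi>"
proof -
  have "\<forall>(U, \<phi>)\<in>trivs S. local_triv \<tau> S U \<phi>" using ruled by (simp add: ruled_surface_def)
  from bspec[OF this assms] show "curve_open \<tau> U" by (simp add: local_triv_def)
  have "\<forall>(V, \<psi>)\<in>trivs S. \<forall>(U, \<phi>)\<in>trivs S. compatible \<tau> S V \<psi> U \<phi>"
    using ruled by (simp add: ruled_surface_def)
  then show "\<forall>(V, \<psi>)\<in>trivs S. compatible \<tau> S V \<psi> U \<phi>"
    using assms by blast
qed

text \<open>For each \<open>x\<close> the label \<open>z\<close> in \<open>pt x z\<close> is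
  determined by the point. Another representative of the same class alters it by \<open>rho\<close>,
  which yields the twists; holomorphy is transported by \<open>local_matrix\<close>.\<close>

lemma section_imp_twisted:
  assumes "is_section \<tau> S \<sigma>"
  obtains f where "twisted \<tau> f" "\<And>x. \<sigma> (ecls \<tau> x) = pt x (f x)"
proof -
  have sec: "\<sigma> (ecls \<tau> x) \<in> total S" "bproj S (\<sigma> (ecls \<tau> x)) = ecls \<tau> x" for x
    using assms by (auto simp: is_section_def ell_curve_def)
  have "\<exists>z. \<sigma> (ecls \<tau> x) = pt x z" for x using pt_cases[OF sec] by metis
  then obtain f where f: "\<And>x. \<sigma> (ecls \<tau> x) = pt x (f x)" by metis
  have shift: "f (x + (of_int m + of_int n * \<tau>)) = rho m n (f x)" for x m n
  proof -
    let ?l = "of_int m + of_int n * \<tau>"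
    have "pt (x + ?l) (f (x + ?l)) = pt x (f x)"
      unfolding f[symmetric] ecls_add_lattice[OF latticeI] ..
    also have "\<dots> = pt (x + ?l) (rho m n (f x))" unfolding pt_eq_iff by blast
    finally show ?thesis by simp
  qed
  have "P1_holomorphic_on f UNIV"
  proof -
    have "P1_holomorphic_on f {x}" for x
    proof -
      obtain U \<phi> where U: "(U, \<phi>) \<in> trivs S" "ecls \<tau> x \<in> U" using trivs_cover .
      have g: "P1_holomorphic_on (\<lambda>y. \<phi> (\<sigma> (ecls \<tau> y))) {x}"
        using assms U unfolding is_section_def P1_holomorphic_on_def by force
      obtain N and M :: "complex \<Rightarrow> complex ^ 2 ^ 2" where N: "open N" "x \<in> N" "\<And>i j. (\<lambda>y. M y $ i $ j) holomorphic_on N"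
        "\<And>y. y \<in> N \<Longrightarrow> det (M y) \<noteq> 0"
        "\<And>y z. y \<in> N \<Longrightarrow> \<phi> (pt y z) = mobius (M y) z"
        using local_matrix[OF trivs_properties[OF U(1)] U(2)] by metis
      show ?thesis
      proof (rule P1_holomorphic_mobius[OF g])
        have "\<forall>y\<in>N. det (adj2 (M y)) \<noteq> 0 \<and> f y = mobius (adj2 (M y)) (\<phi> (\<sigma> (ecls \<tau> y)))"
          using N(4,5) mobius_adj2(1) by (simp add: f det_adj2)
        with N(1,2) holomorphic_adj2[OF N(3)]
        show "\<exists>N (M :: complex \<Rightarrow> complex ^ 2 ^ 2). open N \<and> y \<in> N \<and>
            (\<forall>i j. (\<lambda>y. M y $ i $ j) holomorphic_on N) \<and>
            (\<forall>y\<in>N. det (M y) \<noteq> 0 \<and> f y = mobius (M y) (\<phi> (\<sigma> (ecls \<tau> y))))" if "y \<in> {x}" for y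
          using that by (intro exI[of _ N] exI[of _ "\<lambda>y. adj2 (M y)"]) auto
      qed
    qed
    then show ?thesis by (simp add: P1_holomorphic_on_def)
  qed
  moreover have "f (x + 1) = P1_neg (f x)" "f (x + \<tau>) = P1_inv (f x)" for x
    using shift[of x 1 0] shift[of x 0 1] by (simp_all add: rho_eq)
  ultimately have "twisted \<tau> f" by (simp add: twisted_def)
  then show ?thesis using that f by blast
qed

definition section_of :: "(complex \<Rightarrow> P1) \<Rightarrow> complex set \<Rightarrow> 's" where
  "section_of f c = (let x = SOME x. ecls \<tau> x = c in pt x (f x))"

lemma section_of_ecls:
  assumes "twisted \<tau> f"
  shows "section_of f (ecls \<tau> x) = pt x (f x)"
proof -
  define x0 where "x0 = (SOME y. ecls \<tau> y = ecls \<tau> x)"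
  have "ecls \<tau> x0 = ecls \<tau> x" unfolding x0_def by (rule someI[of _ x]) simp
  then have "x0 - x \<in> lattice \<tau>" by (simp add: ecls_eq_iff)
  then obtain m n where "x0 - x = of_int m + of_int n * \<tau>" unfolding lattice_def by blast
  then have x0: "x0 = x + (of_int m + of_int n * \<tau>)" by (metis add.commute diff_add_cancel)
  then have "f x0 = rho m n (f x)" using twisted_rho[OF assms] by simp
  then have "pt x (f x) = pt x0 (f x0)" using x0 pt_eq_iff by blast
  then show ?thesis by (simp add: section_of_def x0_def[symmetric] Let_def)
qed

lemma section_of_is_section:
  assumes tw: "twisted \<tau> f"
  shows "is_section \<tau> S (section_of f)"
  unfolding is_section_def
proof (intro conjI ballI, goal_cases)
  case (1 c)
  then show ?case using section_of_ecls[OF tw] pt_total by (auto simp: ell_curve_def)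
next
  case (2 c)
  then show ?case using section_of_ecls[OF tw] bproj_pt by (auto simp: ell_curve_def)
next
  case (3 p)
  obtain U \<phi> where p: "p = (U, \<phi>)" by (cases p)
  have U: "(U, \<phi>) \<in> trivs S" using 3 p by simp
  have "P1_holomorphic_on (\<lambda>x. \<phi> (section_of f (ecls \<tau> x))) (ecls \<tau> -` U)"
  proof (rule P1_holomorphic_mobius[where g = f])
    show "P1_holomorphic_on f (ecls \<tau> -` U)"
      using twisted_holomorphic[OF tw] by (simp add: P1_holomorphic_on_def)
    fix x assume "x \<in> ecls \<tau> -` U"
    then have "ecls \<tau> x \<in> U" by simp
    obtain N and M :: "complex \<Rightarrow> complex ^ 2 ^ 2" where N: "open N" "x \<in> N" "\<And>i j. (\<lambda>y. M y $ i $ j) holomorphic_on N"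
      "\<And>y. y \<in> N \<Longrightarrow> det (M y) \<noteq> 0"
      "\<And>y z. y \<in> N \<Longrightarrow> \<phi> (pt y z) = mobius (M y) z"
      using local_matrix[OF trivs_properties[OF U] \<open>ecls \<tau> x \<in> U\<close>] by metis
    then show "\<exists>N (M :: complex \<Rightarrow> complex ^ 2 ^ 2). open N \<and> x \<in> N \<and>
        (\<forall>i j. (\<lambda>y. M y $ i $ j) holomorphic_on N) \<and>
        (\<forall>y\<in>N. det (M y) \<noteq> 0 \<and> \<phi> (section_of f (ecls \<tau> y)) = mobius (M y) (f y))"
      by (intro exI[of _ N] exI[of _ M]) (auto simp: section_of_ecls[OF tw])
  qed
  then show ?case by (simp add: p)
qed

end

section \<open>The self-intersection of a section\<close>

lemma deriv_translate: "deriv (\<lambda>t. g (t + l)) x = deriv g (x + l)"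
  unfolding deriv_def DERIV_shift ..

lemma compatible_mobius:
  assumes "compatible \<tau> S U \<phi> V \<psi>" "det A \<noteq> 0"
  shows "compatible \<tau> S U \<phi> V (\<lambda>p. mobius A (\<psi> p))"
  unfolding compatible_def
proof (intro allI impI)
  fix x assume "ecls \<tau> x \<in> U \<inter> V"
  with assms(1)[unfolded compatible_def, rule_format, OF this]
  show "\<exists>N M. open N \<and> x \<in> N \<and> (\<forall>i j. (\<lambda>y. M y $ i $ j) holomorphic_on N) \<and>
      (\<forall>y\<in>N. det (M y) \<noteq> 0) \<and>
      (\<forall>y\<in>N. \<forall>p\<in>total S. bproj S p = ecls \<tau> y \<longrightarrow> mobius A (\<psi> p) = mobius (M y) (\<phi> p))"
  proof (elim exE conjE)
    fix N and M :: "complex \<Rightarrow> complex ^ 2 ^ 2"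
    assume N: "open N" "x \<in> N" "\<forall>i j. (\<lambda>y. M y $ i $ j) holomorphic_on N" "\<forall>y\<in>N. det (M y) \<noteq> 0"
      "\<forall>y\<in>N. \<forall>p\<in>total S. bproj S p = ecls \<tau> y \<longrightarrow> \<psi> p = mobius (M y) (\<phi> p)"
    have "(\<lambda>y. (A ** M y) $ i $ j) holomorphic_on N" for i j
      by (rule holomorphic_matrix_mult) (use N(3) in auto)
    moreover have "det (A ** M y) \<noteq> 0" if "y \<in> N" for y using N(4) assms(2) that by (simp add: det_mul)
    moreover have "mobius A (\<psi> p) = mobius (A ** M y) (\<phi> p)"
      if "y \<in> N" "p \<in> total S" "bproj S p = ecls \<tau> y" for y p
      using N(4,5) that by (simp add: mobius_mult)
    ultimately show ?thesis using N(1,2) by (intro exI[of _ N] exI[of _ "\<lambda>y. A ** M y"]) auto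
  qed
qed

context model
begin

text \<open>The flat coordinate, with 0 and infinity exchanged if \<open>f x\<close> is infinite, is
  finite along the section near \<open>x\<close>: its value there is \<open>loc f x\<close>.\<close>

lemma fibre_coord_exists:
  assumes tw: "twisted \<tau> f" and \<sigma>: "\<And>x. \<sigma> (ecls \<tau> x) = pt x (f x)"
  shows "\<exists>U \<zeta>. fibre_coord \<tau> S \<sigma> U \<zeta> \<and> ecls \<tau> x \<in> U"
proof -
  obtain N where N: "open N" "x \<in> N"
    "\<And>y. y \<in> N \<Longrightarrow> f y = (if f x = Infty then P1_inv (Aff (loc f x y)) else Aff (loc f x y))"
    using P1_holomorphic_loc[OF twisted_holomorphic[OF tw] UNIV_I] by metis
  obtain e where e: "e > 0" "\<And>x. inj_on (ecls \<tau>) (ball x e)" using ecls_inj_nbhd[OF Im_tau] by metis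
  define B where "B = N \<inter> ball x e"
  have B: "open B" "x \<in> B" "inj_on (ecls \<tau>) B"
    using N(1,2) e by (auto simp: B_def intro: inj_on_subset)
  define A :: "complex ^ 2 ^ 2" where "A = (if f x = Infty then swap2 else mat 1)"
  have A: "det A \<noteq> 0" by (simp add: A_def det_swap2)
  define \<zeta> where "\<zeta> = (\<lambda>p. mobius A (flat_coord B p))"
  have \<zeta>: "\<zeta> (pt y z) = mobius A z" if "y \<in> B" for y z
    using flat_coord_pt[OF B(3) that] by (simp add: \<zeta>_def)
  have fin: "\<zeta> (pt y (f y)) \<noteq> Infty" if "y \<in> B" for y
  proof -
    have "mobius A (f y) = Aff (loc f x y)"
      using N(3)[of y] that by (auto simp: A_def B_def mobius_1 P1_inv_eq_mobius[symmetric] P1_inv_inv)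
    then show ?thesis using \<zeta>[OF that] by simp
  qed
  have "local_triv \<tau> S (ecls \<tau> ` B) \<zeta>"
    unfolding local_triv_def
  proof (intro conjI curve_open_image B(1) bij_betwI')
    fix p q assume pq: "p \<in> {p \<in> total S. bproj S p \<in> ecls \<tau> ` B}" "q \<in> {p \<in> total S. bproj S p \<in> ecls \<tau> ` B}"
    show "(bproj S p, \<zeta> p) = (bproj S q, \<zeta> q) \<longleftrightarrow> p = q"
    proof
      assume eq: "(bproj S p, \<zeta> p) = (bproj S q, \<zeta> q)"
      obtain y where y: "y \<in> B" "bproj S p = ecls \<tau> y" using pq(1) by auto
      obtain z where z: "p = pt y z" using pt_cases[of p y] pq(1) y(2) by auto
      obtain z' where z': "q = pt y z'" using pt_cases[of q y] pq(2) y(2) eq by auto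
      have "mobius A z = mobius A z'" using eq \<zeta>[OF y(1)] z z' by simp
      then have "z = z'" using mobius_adj2(1)[OF A] by metis
      then show "p = q" using z z' by simp
    qed simp
  next
    fix p assume "p \<in> {p \<in> total S. bproj S p \<in> ecls \<tau> ` B}"
    then show "(bproj S p, \<zeta> p) \<in> ecls \<tau> ` B \<times> UNIV" by simp
  next
    fix cw assume "cw \<in> ecls \<tau> ` B \<times> (UNIV :: P1 set)"
    then obtain y w where y: "y \<in> B" "cw = (ecls \<tau> y, w)" by auto
    then show "\<exists>p\<in>{p \<in> total S. bproj S p \<in> ecls \<tau> ` B}. cw = (bproj S p, \<zeta> p)"
      using \<zeta>[OF y(1)] mobius_adj2(2)[OF A]
      by (intro bexI[of _ "pt y (mobius (adj2 A) w)"]) (auto simp: bproj_pt pt_total)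
  qed
  moreover have "\<forall>(V, \<phi>)\<in>trivs S. compatible \<tau> S V \<phi> (ecls \<tau> ` B) \<zeta>"
    using flat_coord_compatible[OF _ B(1,3)] compatible_mobius[OF _ A] unfolding \<zeta>_def by blast
  ultimately have "fibre_coord \<tau> S \<sigma> (ecls \<tau> ` B) \<zeta>"
    using fin \<sigma> by (auto simp: fibre_coord_def)
  then show ?thesis using B(2) by blast
qed

text \<open>The image under the section of the translation invariant vector field on the curve, projected
  along the flat foliation to a vertical vector field.\<close>

definition nsec :: "(complex \<Rightarrow> P1) \<Rightarrow> ('s \<Rightarrow> P1) \<Rightarrow> complex set \<Rightarrow> complex" where
  "nsec f \<zeta> c = (let x = SOME x. ecls \<tau> x = c in deriv (\<lambda>t. coord (\<zeta> (pt x (f t)))) x)"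

context
  fixes f :: "complex \<Rightarrow> P1" and \<sigma> :: "complex set \<Rightarrow> 's"
  assumes tw: "twisted \<tau> f" and \<sigma>: "\<And>x. \<sigma> (ecls \<tau> x) = pt x (f x)"
begin

text \<open>Translating base point and argument together by a lattice vector does not change the
  point of the surface, so the choice of representative is immaterial.\<close>

lemma nsec_ecls: "nsec f \<zeta> (ecls \<tau> x) = deriv (\<lambda>t. coord (\<zeta> (pt x (f t)))) x"
proof -
  define x0 where "x0 = (SOME y. ecls \<tau> y = ecls \<tau> x)"
  have "ecls \<tau> x0 = ecls \<tau> x" unfolding x0_def by (rule someI[of _ x]) simp
  then have "x0 - x \<in> lattice \<tau>" by (simp add: ecls_eq_iff)
  then obtain m n where l: "x0 - x = of_int m + of_int n * \<tau>" unfolding lattice_def by blast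
  define l where "l = of_int m + of_int n * \<tau>"
  have x0: "x0 = x + l" using l by (simp add: l_def algebra_simps)
  have "pt x0 (f (t + l)) = pt x (f t)" for t
    unfolding x0 l_def twisted_rho[OF tw] using pt_eq_iff by metis
  then show ?thesis
    using deriv_translate[of "\<lambda>t. coord (\<zeta> (pt x0 (f t)))" l x]
    by (simp add: nsec_def x0_def[symmetric] Let_def x0)
qed

text \<open>The base point \<open>y\<close> and the argument \<open>t\<close> vary independently,
  since \<open>nsec\<close> differentiates in \<open>t\<close> while \<open>y\<close> is
  frozen.\<close>

lemma fibre_coord_local:
  assumes "fibre_coord \<tau> S \<sigma> U \<zeta>" "ecls \<tau> x \<in> U"
  obtains N and M :: "complex \<Rightarrow> complex ^ 2 ^ 2" where "open N" "x \<in> N"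
    "\<And>i j. (\<lambda>y. M y $ i $ j) holomorphic_on N" "\<And>y. y \<in> N \<Longrightarrow> det (M y) \<noteq> 0"
    "loc f x holomorphic_on N"
    "\<And>y t. y \<in> N \<Longrightarrow> t \<in> N \<Longrightarrow> \<zeta> (pt y (f t)) = mobius (M y) (Aff (loc f x t))"
    "\<And>y. y \<in> N \<Longrightarrow> mobius (M y) (Aff (loc f x y)) \<noteq> Infty"
proof -
  have U: "curve_open \<tau> U" "\<forall>(V, \<phi>)\<in>trivs S. compatible \<tau> S V \<phi> U \<zeta>"
    and fin: "\<And>c. c \<in> U \<Longrightarrow> \<zeta> (\<sigma> c) \<noteq> Infty"
    using assms(1) by (auto simp: fibre_coord_def local_triv_def)
  obtain N1 and M1 :: "complex \<Rightarrow> complex ^ 2 ^ 2" where 1: "open N1" "x \<in> N1"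
    "\<And>i j. (\<lambda>y. M1 y $ i $ j) holomorphic_on N1" "\<And>y. y \<in> N1 \<Longrightarrow> det (M1 y) \<noteq> 0"
    "\<And>y. y \<in> N1 \<Longrightarrow> ecls \<tau> y \<in> U" "\<And>y z. y \<in> N1 \<Longrightarrow> \<zeta> (pt y z) = mobius (M1 y) z"
    using local_matrix[OF U assms(2)] by metis
  obtain N2 where 2: "open N2" "x \<in> N2" "loc f x holomorphic_on N2"
    "\<And>y. y \<in> N2 \<Longrightarrow> f y = (if f x = Infty then P1_inv (Aff (loc f x y)) else Aff (loc f x y))"
    using P1_holomorphic_loc[OF twisted_holomorphic[OF tw] UNIV_I] by metis
  define A :: "complex ^ 2 ^ 2" where "A = (if f x = Infty then swap2 else mat 1)"
  have A: "det A \<noteq> 0" by (simp add: A_def det_swap2)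
  have fA: "f t = mobius A (Aff (loc f x t))" if "t \<in> N2" for t
    using 2(4)[OF that] by (simp add: A_def mobius_1 P1_inv_eq_mobius)
  have eq: "\<zeta> (pt y (f t)) = mobius (M1 y ** A) (Aff (loc f x t))" if "y \<in> N1 \<inter> N2" "t \<in> N1 \<inter> N2" for y t
    using that 1(6) fA by (simp add: mobius_mult[OF A])
  show ?thesis
  proof (rule that[of "N1 \<inter> N2" "\<lambda>y. M1 y ** A"])
    show "(\<lambda>y. (M1 y ** A) $ i $ j) holomorphic_on N1 \<inter> N2" for i j
      by (rule holomorphic_on_subset[OF holomorphic_matrix_mult[OF 1(3)]]) auto
    show "det (M1 y ** A) \<noteq> 0" if "y \<in> N1 \<inter> N2" for y using that 1(4) A by (simp add: det_mul)
    show "loc f x holomorphic_on N1 \<inter> N2" by (rule holomorphic_on_subset[OF 2(3)]) auto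
    show "mobius (M1 y ** A) (Aff (loc f x y)) \<noteq> Infty" if "y \<in> N1 \<inter> N2" for y
    proof -
      have "\<zeta> (\<sigma> (ecls \<tau> y)) \<noteq> Infty" using that by (intro fin 1(5)) simp
      then show ?thesis unfolding eq[OF that that, symmetric] \<sigma> .
    qed
  qed (use 1 2 eq in auto)
qed

text \<open>With \<open>y\<close> frozen, the fibre coordinate is a Moebius function of
  \<open>loc f x\<close>. The chain rule gives the factor det / (c w + d)^2, holomorphic and nonzero
  in \<open>y\<close>, so it does not affect orders.\<close>

lemma nsec_local:
  assumes "fibre_coord \<tau> S \<sigma> U \<zeta>" "ecls \<tau> x \<in> U"
  obtains N k where "open N" "x \<in> N" "k holomorphic_on N" "\<And>y. y \<in> N \<Longrightarrow> k y \<noteq> 0"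
    "loc f x holomorphic_on N"
    "\<And>y. y \<in> N \<Longrightarrow> ((\<lambda>t. coord (\<zeta> (pt y (f t)))) has_field_derivative k y * deriv (loc f x) y) (at y)"
    "\<And>y. y \<in> N \<Longrightarrow> \<forall>\<^sub>F t in nhds y. \<zeta> (pt y (f t)) \<noteq> Infty"
proof -
  obtain N and M :: "complex \<Rightarrow> complex ^ 2 ^ 2" where N: "open N" "x \<in> N"
    "\<And>i j. (\<lambda>y. M y $ i $ j) holomorphic_on N" "\<And>y. y \<in> N \<Longrightarrow> det (M y) \<noteq> 0"
    "loc f x holomorphic_on N"
    "\<And>y t. y \<in> N \<Longrightarrow> t \<in> N \<Longrightarrow> \<zeta> (pt y (f t)) = mobius (M y) (Aff (loc f x t))"
    "\<And>y. y \<in> N \<Longrightarrow> mobius (M y) (Aff (loc f x y)) \<noteq> Infty"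
    using fibre_coord_local[OF assms] by blast
  define g where "g = loc f x"
  define d where "d = (\<lambda>y. M y $ 2 $ 1 * g y + M y $ 2 $ 2)"
  have d: "d y \<noteq> 0" if "y \<in> N" for y
    using N(7)[OF that] by (auto simp: d_def g_def mobius_Aff split: if_splits)
  have dh: "d holomorphic_on N"
    unfolding d_def g_def by (intro holomorphic_on_add holomorphic_on_mult N)
  have "(\<lambda>y. M y $ 1 $ 1 * M y $ 2 $ 2 - M y $ 1 $ 2 * M y $ 2 $ 1) holomorphic_on N"
    by (intro holomorphic_on_diff holomorphic_on_mult N)
  then have "(\<lambda>y. det (M y)) holomorphic_on N" by (simp add: det_2)
  then have kh: "(\<lambda>y. det (M y) / (d y)\<^sup>2) holomorphic_on N"
    using dh d by (intro holomorphic_on_divide holomorphic_on_power) auto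
  show ?thesis
  proof (rule that[OF N(1,2) kh _ N(5)])
    fix y assume y: "y \<in> N"
    show "det (M y) / (d y)\<^sup>2 \<noteq> 0" using N(4)[OF y] d[OF y] by simp
    have g: "(g has_field_derivative deriv g y) (at y)"
      unfolding g_def by (rule holomorphic_derivI[OF N(5,1) y])
    have ev: "\<forall>\<^sub>F t in nhds y. t \<in> N" using N(1) y by (rule eventually_nhds_in_open)
    have m: "((\<lambda>w. coord (mobius (M y) (Aff w))) has_field_derivative det (M y) / (d y)\<^sup>2) (at (g y))"
      using mobius_Aff_deriv(1)[OF N(7)[OF y]] by (simp add: d_def g_def)
    have D: "((\<lambda>t. coord (mobius (M y) (Aff (g t)))) has_field_derivative det (M y) / (d y)\<^sup>2 * deriv g y) (at y)"
      by (rule DERIV_chain2[where f = "\<lambda>w. coord (mobius (M y) (Aff w))" and g = g, OF m g])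
    have "\<forall>\<^sub>F t in nhds y. coord (mobius (M y) (Aff (g t))) = coord (\<zeta> (pt y (f t)))"
      using ev by eventually_elim (simp add: N(6)[OF y] g_def)
    from DERIV_cong_ev[OF refl this refl, THEN iffD1, OF D]
    show "((\<lambda>t. coord (\<zeta> (pt y (f t)))) has_field_derivative
        det (M y) / (d y)\<^sup>2 * deriv (loc f x) y) (at y)"
      by (simp add: g_def)
    have "(g \<longlongrightarrow> g y) (nhds y)"
      using DERIV_isCont[OF g] by (simp add: isCont_def tendsto_at_iff_tendsto_nhds)
    then have "\<forall>\<^sub>F t in nhds y. mobius (M y) (Aff (g t)) \<noteq> Infty"
      using mobius_Aff_deriv(2)[OF N(7)[OF y]] unfolding g_def
      by (rule eventually_compose_filterlim[rotated])
    with ev show "\<forall>\<^sub>F t in nhds y. \<zeta> (pt y (f t)) \<noteq> Infty"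
      by eventually_elim (simp add: N(6)[OF y] g_def)
  qed
qed

lemma nsec_eq:
  assumes "fibre_coord \<tau> S \<sigma> U \<zeta>" "ecls \<tau> x \<in> U"
  obtains N k where "open N" "x \<in> N" "k holomorphic_on N" "\<And>y. y \<in> N \<Longrightarrow> k y \<noteq> 0"
    "loc f x holomorphic_on N" "\<And>y. y \<in> N \<Longrightarrow> nsec f \<zeta> (ecls \<tau> y) = k y * deriv (loc f x) y"
  using nsec_local[OF assms] DERIV_imp_deriv nsec_ecls by metis

text \<open>With \<open>y\<close> frozen the curve t -> \<open>pt y (f t)\<close> stays in one
  fibre, and the rule is the chain rule for the coordinate change of that fibre.\<close>

lemma nsec_transform:
  assumes U: "fibre_coord \<tau> S \<sigma> U \<zeta>" "ecls \<tau> y \<in> U" and V: "fibre_coord \<tau> S \<sigma> V \<xi>" "ecls \<tau> y \<in> V"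
  shows "nsec f \<xi> (ecls \<tau> y) = coord_change_deriv S \<sigma> \<zeta> \<xi> (ecls \<tau> y) * nsec f \<zeta> (ecls \<tau> y)"
proof -
  have Uo: "curve_open \<tau> U" "\<forall>(V, \<phi>)\<in>trivs S. compatible \<tau> S V \<phi> U \<zeta>"
    and Vo: "curve_open \<tau> V" "\<forall>(W, \<phi>)\<in>trivs S. compatible \<tau> S W \<phi> V \<xi>"
    and fin: "\<zeta> (\<sigma> (ecls \<tau> y)) \<noteq> Infty" "\<xi> (\<sigma> (ecls \<tau> y)) \<noteq> Infty"
    using U V by (auto simp: fibre_coord_def local_triv_def)
  obtain A :: "complex ^ 2 ^ 2" where A: "det A \<noteq> 0" "\<And>z. \<zeta> (pt y z) = mobius A z"
    using local_matrix[OF Uo U(2)] by metis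
  obtain B :: "complex ^ 2 ^ 2" where B: "det B \<noteq> 0" "\<And>z. \<xi> (pt y z) = mobius B z"
    using local_matrix[OF Vo V(2)] by metis
  define T where "T = (\<lambda>w. coord (\<xi> (THE p. p \<in> total S \<and> bproj S p = ecls \<tau> y \<and> \<zeta> p = Aff w)))"
  \<comment> \<open>The point with a prescribed coordinate is found by inverting the Moebius map,
    which turns the coordinate change into a Moebius map as well.\<close>
  have the: "(THE p. p \<in> total S \<and> bproj S p = ecls \<tau> y \<and> \<zeta> p = Aff w) = pt y (mobius (adj2 A) (Aff w))" for w
  proof (rule the_equality)
    show "pt y (mobius (adj2 A) (Aff w)) \<in> total S \<and> bproj S (pt y (mobius (adj2 A) (Aff w))) = ecls \<tau> y \<and>
        \<zeta> (pt y (mobius (adj2 A) (Aff w))) = Aff w"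
      by (simp add: pt_total bproj_pt A mobius_adj2(2))
    fix p assume p: "p \<in> total S \<and> bproj S p = ecls \<tau> y \<and> \<zeta> p = Aff w"
    then obtain z where z: "p = pt y z" using pt_cases by blast
    then have "mobius A z = Aff w" using p A(2) by simp
    then have "z = mobius (adj2 A) (Aff w)" using mobius_adj2(1)[OF A(1), of z] by simp
    then show "p = pt y (mobius (adj2 A) (Aff w))" using z by simp
  qed
  have T: "T = (\<lambda>w. coord (mobius (B ** adj2 A) (Aff w)))"
    unfolding T_def the B(2) using mobius_mult[of "adj2 A" B] A(1) by (simp add: det_adj2)
  have Tz: "T (coord (\<zeta> (pt y z))) = coord (\<xi> (pt y z))" if "\<zeta> (pt y z) \<noteq> Infty" for z
  proof -
    have "Aff (coord (\<zeta> (pt y z))) = mobius A z" using that A(2) by (cases "\<zeta> (pt y z)") auto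
    then show ?thesis unfolding T_def the using mobius_adj2(1)[OF A(1), of z] by simp
  qed
  define w0 where "w0 = coord (\<zeta> (\<sigma> (ecls \<tau> y)))"
  have w0: "mobius A (f y) = Aff w0" using fin(1) A(2) \<sigma>[of y] by (cases "mobius A (f y)") (auto simp: w0_def)
  have "mobius (B ** adj2 A) (Aff w0) = mobius B (f y)"
    using mobius_mult[of "adj2 A" B "Aff w0"] A(1) mobius_adj2(1)[OF A(1), of "f y"] w0 by (simp add: det_adj2)
  then have "mobius (B ** adj2 A) (Aff w0) \<noteq> Infty" using fin(2) B(2) \<sigma>[of y] by simp
  from mobius_Aff_deriv(1)[OF this] have "T field_differentiable at w0"
    unfolding T field_differentiable_def by (rule exI)
  then have dT: "(T has_field_derivative deriv T w0) (at w0)"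
    by (simp add: DERIV_deriv_iff_field_differentiable)
  obtain D where D: "((\<lambda>t. coord (\<zeta> (pt y (f t)))) has_field_derivative D) (at y)"
    and ev: "\<forall>\<^sub>F t in nhds y. \<zeta> (pt y (f t)) \<noteq> Infty"
    using nsec_local[OF U] by metis
  have w0': "w0 = coord (\<zeta> (pt y (f y)))" by (simp add: w0_def \<sigma>)
  have DT: "((\<lambda>t. T (coord (\<zeta> (pt y (f t))))) has_field_derivative deriv T w0 * D) (at y)"
    by (rule DERIV_chain2[where f = T and g = "\<lambda>t. coord (\<zeta> (pt y (f t)))"])
      (use dT D in \<open>simp_all only: w0'\<close>)
  have "\<forall>\<^sub>F t in nhds y. T (coord (\<zeta> (pt y (f t)))) = coord (\<xi> (pt y (f t)))"
    using ev by eventually_elim (rule Tz)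
  from DERIV_cong_ev[OF refl this refl, THEN iffD1, OF DT] have "nsec f \<xi> (ecls \<tau> y) = deriv T w0 * D" unfolding nsec_ecls by (rule DERIV_imp_deriv)
  moreover have "nsec f \<zeta> (ecls \<tau> y) = D" unfolding nsec_ecls using D by (rule DERIV_imp_deriv)
  moreover have "coord_change_deriv S \<sigma> \<zeta> \<xi> (ecls \<tau> y) = deriv T w0"
    by (simp add: coord_change_deriv_def T_def w0_def)
  ultimately show ?thesis by simp
qed

lemma nsec_normal_mero_section: "normal_mero_section \<tau> S \<sigma> (\<lambda>U. nsec f)"
  unfolding normal_mero_section_def
proof (intro conjI allI impI)
  fix U \<zeta> assume U: "fibre_coord \<tau> S \<sigma> U \<zeta>"
  have "(\<lambda>y. nsec f \<zeta> (ecls \<tau> y)) meromorphic_on {x}" if x: "ecls \<tau> x \<in> U" for x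
  proof -
    obtain N k where N: "open N" "x \<in> N" "k holomorphic_on N" "loc f x holomorphic_on N"
      "\<And>y. y \<in> N \<Longrightarrow> nsec f \<zeta> (ecls \<tau> y) = k y * deriv (loc f x) y"
      using nsec_eq[OF U x] by metis
    have "(\<lambda>y. k y * deriv (loc f x) y) holomorphic_on N"
      by (intro holomorphic_on_mult holomorphic_deriv N)
    then have "(\<lambda>y. nsec f \<zeta> (ecls \<tau> y)) holomorphic_on N" using N(5) by (simp cong: holomorphic_cong)
    then show ?thesis using N(1,2) by (intro analytic_on_imp_meromorphic_on) (auto simp: analytic_at)
  qed
  then show "(\<lambda>x. nsec f \<zeta> (ecls \<tau> x)) meromorphic_on ecls \<tau> -` U"
    using meromorphic_on_meromorphic_at by blast
  fix x assume x: "ecls \<tau> x \<in> U"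
  obtain N k where N: "open N" "x \<in> N" "\<And>y. y \<in> N \<Longrightarrow> k y \<noteq> 0"
    "\<And>y. y \<in> N \<Longrightarrow> nsec f \<zeta> (ecls \<tau> y) = k y * deriv (loc f x) y"
    using nsec_eq[OF U x] by metis
  show "\<forall>\<^sub>F y in at x. nsec f \<zeta> (ecls \<tau> y) \<noteq> 0"
    using deriv_loc_nonzero[OF tw, of x] eventually_at_in_open'[OF N(1,2)]
    by eventually_elim (simp add: N)
next
  fix U \<zeta> V \<xi> x
  assume UV: "fibre_coord \<tau> S \<sigma> U \<zeta> \<and> fibre_coord \<tau> S \<sigma> V \<xi>" and x: "ecls \<tau> x \<in> U \<inter> V"
  have "open (ecls \<tau> -` U \<inter> ecls \<tau> -` V)"
    using UV by (auto simp: fibre_coord_def local_triv_def curve_open_def)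
  from eventually_at_in_open'[OF this, of x] x
  have "\<forall>\<^sub>F y in at x. y \<in> ecls \<tau> -` U \<inter> ecls \<tau> -` V" by simp
  then show "\<forall>\<^sub>F y in at x. nsec f \<xi> (ecls \<tau> y) =
      coord_change_deriv S \<sigma> \<zeta> \<xi> (ecls \<tau> y) * nsec f \<zeta> (ecls \<tau> y)"
  proof eventually_elim
    case (elim y)
    then show ?case using UV by (intro nsec_transform) auto
  qed
qed

lemma zorder_nsec:
  assumes "fibre_coord \<tau> S \<sigma> U \<zeta>" "ecls \<tau> x \<in> U"
  shows "zorder (\<lambda>y. nsec f \<zeta> (ecls \<tau> y)) x = zorder (deriv (loc f x)) x"
proof -
  obtain N k where N: "open N" "x \<in> N" "k holomorphic_on N" "\<And>y. y \<in> N \<Longrightarrow> k y \<noteq> 0"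
    "loc f x holomorphic_on N" "\<And>y. y \<in> N \<Longrightarrow> nsec f \<zeta> (ecls \<tau> y) = k y * deriv (loc f x) y"
    using nsec_eq[OF assms] by metis
  have k: "k analytic_on {x}" using N(1,2,3) analytic_at by blast
  have l: "deriv (loc f x) analytic_on {x}" using holomorphic_deriv[OF N(5,1)] N(1,2) analytic_at by blast
  have evk: "\<forall>\<^sub>F y in at x. k y \<noteq> 0"
    using eventually_at_in_open'[OF N(1,2)] by eventually_elim (rule N(4))
  have "\<forall>\<^sub>F y in at x. nsec f \<zeta> (ecls \<tau> y) = k y * deriv (loc f x) y"
    using eventually_at_in_open'[OF N(1,2)] by eventually_elim (rule N(6))
  then have "zorder (\<lambda>y. nsec f \<zeta> (ecls \<tau> y)) x = zorder (\<lambda>y. k y * deriv (loc f x) y) x"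
    by (rule zorder_cong) simp
  also have "\<dots> = zorder k x + zorder (deriv (loc f x)) x"
    by (intro zorder_mult analytic_on_imp_meromorphic_on k l eventually_frequently evk
        deriv_loc_nonzero[OF tw]) auto
  also have "zorder k x = 0" using zorder_nonzero_value[OF k N(4)[OF N(2)]] .
  finally show ?thesis by simp
qed

end

end

section \<open>The degree of the normal bundle does not depend on the chosen meromorphic
  section\<close>

context model
begin

text \<open>The quotient of two meromorphic normal sections does not depend on the fibre coordinate, so it is
  an elliptic function.\<close>

lemma normal_degree_unique:
  assumes pos: "Im \<tau> > 0"
    and ch: "\<And>x. \<exists>U \<zeta>. fibre_coord \<tau> S \<sigma> U \<zeta> \<and> ecls \<tau> x \<in> U"
    and s: "normal_mero_section \<tau> S \<sigma> s" "normal_section_divisor \<tau> S \<sigma> s D"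
      "finite {c \<in> ell_curve \<tau>. D c \<noteq> 0}"
    and s': "normal_mero_section \<tau> S \<sigma> s'" "normal_section_divisor \<tau> S \<sigma> s' D'"
      "finite {c \<in> ell_curve \<tau>. D' c \<noteq> 0}"
  shows "(\<Sum>c \<in> {c \<in> ell_curve \<tau>. D c \<noteq> 0}. D c) = (\<Sum>c \<in> {c \<in> ell_curve \<tau>. D' c \<noteq> 0}. D' c)"
proof -
  have "\<forall>c. \<exists>U \<zeta>. c \<in> ell_curve \<tau> \<longrightarrow> fibre_coord \<tau> S \<sigma> U \<zeta> \<and> c \<in> U"
    using ch by (auto simp: ell_curve_def)
  then obtain UU ZZ where "\<And>c. c \<in> ell_curve \<tau> \<longrightarrow> fibre_coord \<tau> S \<sigma> (UU c) (ZZ c) \<and> c \<in> UU c"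
    by metis
  then have UU: "fibre_coord \<tau> S \<sigma> (UU (ecls \<tau> x)) (ZZ (ecls \<tau> x))" "ecls \<tau> x \<in> UU (ecls \<tau> x)" for x
    by (simp_all add: ell_curve_def)
  have mer: "(\<lambda>y. t U \<zeta> (ecls \<tau> y)) meromorphic_on {x}" "\<forall>\<^sub>F y in at x. t U \<zeta> (ecls \<tau> y) \<noteq> 0"
    if t: "normal_mero_section \<tau> S \<sigma> t" and U: "fibre_coord \<tau> S \<sigma> U \<zeta>" "ecls \<tau> x \<in> U" for t U \<zeta> x
  proof -
    have "(\<lambda>y. t U \<zeta> (ecls \<tau> y)) meromorphic_on (ecls \<tau> -` U)"
      using t U(1) unfolding normal_mero_section_def by blast
    then show "(\<lambda>y. t U \<zeta> (ecls \<tau> y)) meromorphic_on {x}"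
      by (rule meromorphic_on_subset) (use U(2) in simp)
    show "\<forall>\<^sub>F y in at x. t U \<zeta> (ecls \<tau> y) \<noteq> 0"
      using t U unfolding normal_mero_section_def by blast
  qed
  have trans: "\<forall>\<^sub>F y in at x. t V \<xi> (ecls \<tau> y) = coord_change_deriv S \<sigma> \<zeta> \<xi> (ecls \<tau> y) * t U \<zeta> (ecls \<tau> y)"
    if t: "normal_mero_section \<tau> S \<sigma> t" and U: "fibre_coord \<tau> S \<sigma> U \<zeta>" "ecls \<tau> x \<in> U"
      and V: "fibre_coord \<tau> S \<sigma> V \<xi>" "ecls \<tau> x \<in> V" for t U \<zeta> V \<xi> x
    using t U V unfolding normal_mero_section_def by blast
  define q where "q = (\<lambda>c y. s (UU c) (ZZ c) (ecls \<tau> y) / s' (UU c) (ZZ c) (ecls \<tau> y))"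
  \<comment> \<open>The selected coordinate changes with the class, and quotients in two coordinates
    agree only off a discrete set. Taking limits removes this ambiguity; periodicity is exact
    because the selection depends on the class only.\<close>
  define R where "R = (\<lambda>x. remove_sings (q (ecls \<tau> x)) x)"
  have qm: "q (ecls \<tau> x) meromorphic_on {x}" for x
    unfolding q_def by (intro meromorphic_on_divide mer s s' UU)
  have qnz: "\<forall>\<^sub>F y in at x. q (ecls \<tau> x) y \<noteq> 0" for x
    using mer(2)[OF s(1) UU] mer(2)[OF s'(1) UU] by eventually_elim (simp add: q_def)
  have eq: "\<forall>\<^sub>F y in at x. R y = remove_sings (q (ecls \<tau> x)) y" for x
  proof -
    have "open (ecls \<tau> -` UU (ecls \<tau> x))"
      using UU(1)[of x] by (auto simp: fibre_coord_def local_triv_def curve_open_def)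
    from eventually_at_in_open'[OF this, of x] UU(2)[of x]
    have "\<forall>\<^sub>F y in at x. y \<in> ecls \<tau> -` UU (ecls \<tau> x)" by simp
    then show ?thesis
    proof eventually_elim
      case (elim y)
      then have y: "ecls \<tau> y \<in> UU (ecls \<tau> x)" by simp
      have "\<forall>\<^sub>F t in at y. q (ecls \<tau> y) t = q (ecls \<tau> x) t"
        using trans[OF s(1) UU(1)[of x] y UU(1,2)[of y]] trans[OF s'(1) UU(1)[of x] y UU(1,2)[of y]]
          mer(2)[OF s(1) UU(1,2)[of y]]
        by eventually_elim (simp add: q_def)
      then show ?case unfolding R_def by (rule remove_sings_cong) simp
    qed
  qed
  have iso_q: "isolated_singularity_at (q (ecls \<tau> x)) x" for x
    using qm[of x] by (simp add: meromorphic_at_iff)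
  have "R meromorphic_on {x}" for x
  proof -
    have "R meromorphic_on {x} \<longleftrightarrow> remove_sings (q (ecls \<tau> x)) meromorphic_on {x}"
      by (rule meromorphic_on_cong) (use eq[of x] in auto)
    then show ?thesis using remove_sings_meromorphic[OF qm[of x]] by simp
  qed
  then have Rm: "R meromorphic_on UNIV" using meromorphic_on_meromorphic_at by blast
  have Rnz: "\<forall>\<^sub>F y in at x. R y \<noteq> 0" for x
    using eq[of x] eventually_remove_sings_eq_at[OF iso_q] qnz[of x] by eventually_elim simp
  have per: "R (x + l) = R x" if l: "l \<in> lattice \<tau>" for x l
    unfolding R_def remove_sings_translate[symmetric] ecls_add_lattice[OF l] q_def ..
  define E where "E = (\<lambda>c. D c - D' c)"
  have E: "E (ecls \<tau> x) = zorder R x" for x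
  proof -
    have "zorder R x = zorder (remove_sings (q (ecls \<tau> x))) x" by (rule zorder_cong[OF eq refl])
    also have "\<dots> = zorder (q (ecls \<tau> x)) x" by (rule zorder_remove_sings[OF iso_q])
    also have "\<dots> = zorder (\<lambda>y. s (UU (ecls \<tau> x)) (ZZ (ecls \<tau> x)) (ecls \<tau> y)) x -
        zorder (\<lambda>y. s' (UU (ecls \<tau> x)) (ZZ (ecls \<tau> x)) (ecls \<tau> y)) x"
      unfolding q_def by (intro zorder_divide mer s s' UU eventually_frequently) auto
    also have "\<dots> = D (ecls \<tau> x) - D' (ecls \<tau> x)"
      using s(2) s'(2) UU[of x] unfolding normal_section_divisor_def by metis
    finally show ?thesis by (simp add: E_def)
  qed
  have "(\<Sum>c | c \<in> ell_curve \<tau> \<and> E c \<noteq> 0. E c) = 0"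
    by (rule sum_zorder_eq_0(2)[OF pos Rm Rnz, of 1 1]) (simp_all add: per E)
  moreover define C where "C = {c \<in> ell_curve \<tau>. D c \<noteq> 0} \<union> {c \<in> ell_curve \<tau>. D' c \<noteq> 0}"
  have C: "finite C" using s(3) s'(3) by (simp add: C_def)
  moreover have "(\<Sum>c | c \<in> ell_curve \<tau> \<and> E c \<noteq> 0. E c) = sum E C"
    by (rule sum.mono_neutral_left[OF C]) (auto simp: C_def E_def)
  moreover have "(\<Sum>c | c \<in> ell_curve \<tau> \<and> D c \<noteq> 0. D c) = sum D C"
    by (rule sum.mono_neutral_left[OF C]) (auto simp: C_def)
  moreover have "(\<Sum>c | c \<in> ell_curve \<tau> \<and> D' c \<noteq> 0. D' c) = sum D' C"
    by (rule sum.mono_neutral_left[OF C]) (auto simp: C_def)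
  moreover have "sum E C = sum D C - sum D' C" by (simp add: E_def sum_subtractf)
  ultimately show ?thesis by simp
qed

text \<open>\<open>nsec f\<close> shows that the degree exists and
  \<open>normal_degree_unique\<close> that it is unique; its divisor is the ramification divisor,
  counted by \<open>sum_ramification\<close>.\<close>

theorem self_intersection_twisted:
  assumes pos: "Im \<tau> > 0" and tw: "twisted \<tau> f" and \<sigma>: "\<And>x. \<sigma> (ecls \<tau> x) = pt x (f x)"
  shows "self_intersection \<tau> S \<sigma> = (\<Sum>c | c \<in> ell_curve \<tau> \<and> absord \<tau> f c \<noteq> 0. absord \<tau> f c)"
proof -
  let ?v = "\<lambda>y. val (f y)"
  let ?l = "\<lambda>y. deriv ?v y / ?v y"
  define D where "D = (\<lambda>c. let x = SOME x. ecls \<tau> x = c in zorder ?l x + \<bar>zorder ?v x\<bar>)"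
  have D: "D (ecls \<tau> x) = zorder ?l x + \<bar>zorder ?v x\<bar>" for x
  proof -
    have e: "ecls \<tau> (SOME y. ecls \<tau> y = ecls \<tau> x) = ecls \<tau> x"
      by (rule someI[of "\<lambda>y. ecls \<tau> y = ecls \<tau> x" x]) simp
    have "zorder ?l (SOME y. ecls \<tau> y = ecls \<tau> x) = zorder ?l x"
      by (rule zorder_lattice_periodic[OF _ _ logd_1[OF tw] logd_tau[OF tw] e]) auto
    then show ?thesis using abs_zorder_ecls[OF tw e] by (simp add: D_def Let_def)
  qed
  note sum = sum_ramification[OF tw pos, of D, OF D]
  have s: "normal_mero_section \<tau> S \<sigma> (\<lambda>U. nsec f)" by (rule nsec_normal_mero_section[OF tw \<sigma>])
  have div: "normal_section_divisor \<tau> S \<sigma> (\<lambda>U. nsec f) D"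
    unfolding normal_section_divisor_def
  proof (intro allI impI, elim conjE)
    fix U \<zeta> x assume "fibre_coord \<tau> S \<sigma> U \<zeta>" "ecls \<tau> x \<in> U"
    from zorder_nsec[OF tw \<sigma> this]
    show "D (ecls \<tau> x) = zorder (\<lambda>y. nsec f \<zeta> (ecls \<tau> y)) x"
      by (simp only: zorder_deriv_loc[OF tw] D)
  qed
  show ?thesis
    unfolding self_intersection_def sum(2)[symmetric]
  proof (rule the_equality)
    show "\<exists>s D'. normal_mero_section \<tau> S \<sigma> s \<and> normal_section_divisor \<tau> S \<sigma> s D' \<and>
        finite {c \<in> ell_curve \<tau>. D' c \<noteq> 0} \<and>
        (\<Sum>c | c \<in> ell_curve \<tau> \<and> D c \<noteq> 0. D c) = (\<Sum>c \<in> {c \<in> ell_curve \<tau>. D' c \<noteq> 0}. D' c)"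
      using s div sum(1) by (intro exI[of _ "\<lambda>U. nsec f"] exI[of _ D]) simp
    fix d
    assume "\<exists>s D'. normal_mero_section \<tau> S \<sigma> s \<and> normal_section_divisor \<tau> S \<sigma> s D' \<and>
        finite {c \<in> ell_curve \<tau>. D' c \<noteq> 0} \<and> d = (\<Sum>c \<in> {c \<in> ell_curve \<tau>. D' c \<noteq> 0}. D' c)"
    then obtain s' D' where s': "normal_mero_section \<tau> S \<sigma> s'" "normal_section_divisor \<tau> S \<sigma> s' D'"
      "finite {c \<in> ell_curve \<tau>. D' c \<noteq> 0}" "d = (\<Sum>c \<in> {c \<in> ell_curve \<tau>. D' c \<noteq> 0}. D' c)"
      by (elim exE conjE)
    show "d = (\<Sum>c | c \<in> ell_curve \<tau> \<and> D c \<noteq> 0. D c)"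
      unfolding s'(4)
      by (rule normal_degree_unique[OF pos fibre_coord_exists[OF tw \<sigma>] s'(1-3) s div sum(1)])
  qed
qed

section \<open>The discriminant\<close>

lemma pt_equivariant:
  assumes "twisted \<tau> f"
  shows "pt (x + (of_int m + of_int n * \<tau>)) (f (x + (of_int m + of_int n * \<tau>))) = pt x (f x)"
  unfolding twisted_rho[OF assms] using pt_eq_iff by metis

lemma pt_mem_graph:
  assumes "twisted \<tau> f"
  shows "pt x z \<in> range (\<lambda>x. pt x (f x)) \<longleftrightarrow> z = f x"
proof
  assume "pt x z \<in> range (\<lambda>x. pt x (f x))"
  then obtain y where y: "pt x z = pt y (f y)" by auto
  then obtain m n where "y = x + (of_int m + of_int n * \<tau>)" using pt_eq_iff by blast
  then have "pt x z = pt x (f x)" using y pt_equivariant[OF assms] by simp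
  then show "z = f x" by simp
qed auto

text \<open>The parameter matters only modulo twice the lattice, see
  \<open>leaf_eq_iff\<close>.\<close>

definition leaf :: "complex \<Rightarrow> 's set" where
  "leaf a = range (\<lambda>x. pt x (sn \<tau> (x - a)))"

lemma minimal_web_eq:
  assumes pos: "Im \<tau> > 0"
  shows "minimal_web \<tau> S = range leaf"
proof (intro equalityI subsetI)
  fix L assume "L \<in> minimal_web \<tau> S"
  then obtain \<sigma> where \<sigma>: "L = \<sigma> ` ell_curve \<tau>" "is_section \<tau> S \<sigma>" "self_intersection \<tau> S \<sigma> = 1"
    unfolding minimal_web_def by blast
  obtain f where f: "twisted \<tau> f" "\<And>x. \<sigma> (ecls \<tau> x) = pt x (f x)"
    using section_imp_twisted[OF \<sigma>(2)] by blast
  obtain a where a: "\<And>x. f x = sn \<tau> (x - a)"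
    using minimal_twisted[OF pos f(1)] self_intersection_twisted[OF pos f] \<sigma>(3) by metis
  have "L = leaf a" unfolding \<sigma>(1) leaf_def ell_curve_def image_image f(2) a ..
  then show "L \<in> range leaf" by blast
next
  fix L assume "L \<in> range leaf"
  then obtain a where a: "L = leaf a" by blast
  define f where "f = (\<lambda>x. sn \<tau> (x - a))"
  have f: "twisted \<tau> f" unfolding f_def by (rule twisted_translate[OF sn_twisted[OF pos]])
  have "self_intersection \<tau> S (section_of f) = 1"
    using self_intersection_twisted[OF pos f section_of_ecls[OF f]] sum_absord_sn_translate[OF pos, of a]
    by (simp add: f_def)
  moreover have "L = section_of f ` ell_curve \<tau>"
    unfolding a leaf_def ell_curve_def image_image section_of_ecls[OF f] by (simp add: f_def)
  ultimately show "L \<in> minimal_web \<tau> S"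
    unfolding minimal_web_def using section_of_is_section[OF f] by blast
qed

lemma pt_mem_leaf:
  assumes "Im \<tau> > 0"
  shows "pt x z \<in> leaf a \<longleftrightarrow> z = sn \<tau> (x - a)"
  unfolding leaf_def by (rule pt_mem_graph[OF twisted_translate[OF sn_twisted[OF assms]]])

lemma leaf_eq_iff:
  assumes pos: "Im \<tau> > 0"
  shows "leaf a = leaf b \<longleftrightarrow> (\<exists>l\<in>lattice \<tau>. a = b + 2 * l)"
proof -
  have "leaf a = leaf b \<longleftrightarrow> (\<forall>x. sn \<tau> (x - a) = sn \<tau> (x - b))"
  proof
    assume eq: "leaf a = leaf b"
    show "\<forall>x. sn \<tau> (x - a) = sn \<tau> (x - b)"
    proof
      fix x
      have "pt x (sn \<tau> (x - a)) \<in> leaf b" unfolding eq[symmetric] by (simp add: pt_mem_leaf[OF pos])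
      then show "sn \<tau> (x - a) = sn \<tau> (x - b)" by (simp add: pt_mem_leaf[OF pos])
    qed
  qed (simp add: leaf_def)
  then show ?thesis using sn_translate_eq_iff[OF pos] by simp
qed

lemma unique_leaf_iff:
  assumes pos: "Im \<tau> > 0"
  shows "(\<exists>!L. L \<in> range leaf \<and> pt x z \<in> L) \<longleftrightarrow> (\<exists>m n. z = rho m n (sn \<tau> (1 / 2)))"
proof
  assume uniq: "\<exists>!L. L \<in> range leaf \<and> pt x z \<in> L"
  obtain y where y: "sn \<tau> y = z" using sn_surj[OF pos] by metis
  have "pt x z \<in> leaf (x - y)" "pt x z \<in> leaf (x - (1 - y))"
    by (simp_all add: pt_mem_leaf[OF pos] sn_flip[OF pos] y)
  then have "leaf (x - y) = leaf (x - (1 - y))" using uniq by (metis rangeI)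
  then obtain l where l: "l \<in> lattice \<tau>" "x - y = x - (1 - y) + 2 * l"
    unfolding leaf_eq_iff[OF pos] by blast
  \<comment> \<open>So \<open>y\<close> is 1/2 up to a lattice vector, and lattice vectors act on
    the values of \<open>sn \<tau>\<close> through \<open>rho\<close>.\<close>
  have "2 * y = 2 * (1 / 2 + - l)" using l(2) by (simp add: algebra_simps)
  then have "y = 1 / 2 + - l" by (metis mult_left_cancel zero_neq_numeral)
  moreover obtain m n where "- l = of_int m + of_int n * \<tau>"
    using lattice_uminus[OF l(1)] unfolding lattice_def by blast
  ultimately have "z = rho m n (sn \<tau> (1 / 2))"
    using twisted_rho[OF sn_twisted[OF pos]] y by metis
  then show "\<exists>m n. z = rho m n (sn \<tau> (1 / 2))" by blast
next
  assume "\<exists>m n. z = rho m n (sn \<tau> (1 / 2))"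
  then obtain m n where z: "z = rho m n (sn \<tau> (1 / 2))" by blast
  let ?l = "of_int m + of_int n * \<tau>"
  have sn_shift: "sn \<tau> (y + ?l) = rho m n (sn \<tau> y)" for y
    by (rule twisted_rho[OF sn_twisted[OF pos]])
  \<comment> \<open>Translation by \<open>?l\<close> turns the value \<open>z\<close> into the
    critical value, because \<open>rho m n\<close> is an involution. The critical fibre then fixes
    \<open>a\<close> modulo twice the lattice.\<close>
  have ex: "\<exists>k\<in>lattice \<tau>. a = x + ?l - 1 / 2 - 2 * k" if "pt x z \<in> leaf a" for a
  proof -
    have "z = sn \<tau> (x - a)" using that by (simp add: pt_mem_leaf[OF pos])
    then have "sn \<tau> (x - a + ?l) = sn \<tau> (1 / 2)" using sn_shift[of "x - a"] z rho_involution by metis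
    then obtain k where "k \<in> lattice \<tau>" "x - a + ?l = 1 / 2 + 2 * k"
      using sn_critical_fibre[OF pos] by metis
    moreover from this(2) have "a = x + ?l - 1 / 2 - 2 * k" by (simp add: algebra_simps)
    ultimately show ?thesis by blast
  qed
  show "\<exists>!L. L \<in> range leaf \<and> pt x z \<in> L"
  proof (rule ex_ex1I)
    have "pt x z \<in> leaf (x - (1 / 2 + ?l))"
      using sn_shift[of "1 / 2"] z by (simp add: pt_mem_leaf[OF pos])
    then show "\<exists>L. L \<in> range leaf \<and> pt x z \<in> L" by blast
  next
    fix L L' assume "L \<in> range leaf \<and> pt x z \<in> L" "L' \<in> range leaf \<and> pt x z \<in> L'"
    then obtain a b where ab: "L = leaf a" "pt x z \<in> leaf a" "L' = leaf b" "pt x z \<in> leaf b" by blast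
    obtain k k' where k: "k \<in> lattice \<tau>" "a = x + ?l - 1 / 2 - 2 * k"
      "k' \<in> lattice \<tau>" "b = x + ?l - 1 / 2 - 2 * k'"
      using ex[OF ab(2)] ex[OF ab(4)] by blast
    have "a = b + 2 * (k' - k)" unfolding k(2,4) by (simp add: algebra_simps)
    then show "L = L'" using leaf_eq_iff[OF pos] lattice_diff[OF k(3,1)] ab by blast
  qed
qed

theorem discriminant_leaf:
  assumes pos: "Im \<tau> > 0"
  shows "discriminant S (minimal_web \<tau> S) \<in> Ric \<tau> S \<Phi>"
proof -
  let ?L = "UNIV \<times> {sn \<tau> (1 / 2)}"
  \<comment> \<open>The orbit of (x, z) meets the horizontal line exactly when some
    \<open>rho m n\<close> carries \<open>z\<close> to the critical value; being an involution, it
    also carries the critical value to \<open>z\<close>.\<close>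
  have leaf: "\<Phi> (pt x z) \<in> flat_orbit \<tau> ` ?L \<longleftrightarrow> (\<exists>m n. z = rho m n (sn \<tau> (1 / 2)))" for x z
  proof
    assume "\<Phi> (pt x z) \<in> flat_orbit \<tau> ` ?L"
    then obtain x' where "flat_orbit \<tau> (x, z) = flat_orbit \<tau> (x', sn \<tau> (1 / 2))" by (auto simp: Phi_pt)
    then show "\<exists>m n. z = rho m n (sn \<tau> (1 / 2))" using flat_orbit_eq_iff rho_involution by metis
  next
    assume "\<exists>m n. z = rho m n (sn \<tau> (1 / 2))"
    then obtain m n where "z = rho m n (sn \<tau> (1 / 2))" by blast
    then have "sn \<tau> (1 / 2) = rho m n z" by (simp add: rho_involution)
    then have "\<Phi> (pt x z) = flat_orbit \<tau> (x + (of_int m + of_int n * \<tau>), sn \<tau> (1 / 2))"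
      unfolding Phi_pt flat_orbit_eq_iff by blast
    then show "\<Phi> (pt x z) \<in> flat_orbit \<tau> ` ?L" by blast
  qed
  have "p \<in> discriminant S (minimal_web \<tau> S) \<longleftrightarrow> \<Phi> p \<in> flat_orbit \<tau> ` ?L" if "p \<in> total S" for p
  proof -
    from that obtain x z where p: "p = pt x z" by (rule total_cases)
    show ?thesis unfolding p leaf unique_leaf_iff[OF pos, of x z, symmetric]
      by (simp add: discriminant_def minimal_web_eq[OF pos] pt_total)
  qed
  moreover have "discriminant S (minimal_web \<tau> S) \<subseteq> total S" unfolding discriminant_def by blast
  ultimately have "discriminant S (minimal_web \<tau> S) = {p \<in> total S. \<Phi> p \<in> flat_orbit \<tau> ` ?L}"
    by blast
  moreover have "flat_orbit \<tau> ` ?L \<in> flat_foliation \<tau>"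
    by (auto simp: flat_foliation_def horizontal_foliation_def)
  ultimately show ?thesis unfolding Ric_def by blast
qed

end

section \<open>Invariance of all notions under a change of sign of \<open>\<tau>\<close>\<close>

lemma lattice_uminus_tau: "lattice (- \<tau>) = lattice \<tau>"
proof -
  have "lattice (- \<tau>) \<subseteq> lattice \<tau>" for \<tau>
  proof
    fix l assume "l \<in> lattice (- \<tau>)"
    then obtain m n where "l = of_int m + of_int n * (- \<tau>)" unfolding lattice_def by blast
    then have "l = of_int m + of_int (- n) * \<tau>" by simp
    then show "l \<in> lattice \<tau>" by (simp only: latticeI)
  qed
  from this[of \<tau>] this[of "- \<tau>"] show ?thesis by simp
qed

text \<open>The involutions \<^term>\<open>rho m n\<close> do not see the signs of \<^term>\<open>m\<close> and \<^term>\<open>n\<close>, so nothing changes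
  when \<open>\<tau>\<close> is replaced by \<open>-\<tau>\<close>, and the imaginary part may be taken positive.\<close>

lemma ecls_uminus_tau: "ecls (- \<tau>) = ecls \<tau>"
  by (simp add: ecls_def[abs_def] lattice_uminus_tau)

lemma flat_orbit_uminus_tau: "flat_orbit (- \<tau>) = flat_orbit \<tau>"
proof
  have sub: "flat_orbit (- \<tau>) p \<subseteq> flat_orbit \<tau> p" for \<tau> p
  proof (cases p, clarify)
    fix x z y w assume "(y, w) \<in> flat_orbit (- \<tau>) (x, z)"
    then obtain m n where "y = x + (of_int m + of_int n * (- \<tau>))" "w = rho m n z"
      unfolding mem_flat_orbit by blast
    then have "y = x + (of_int m + of_int (- n) * \<tau>)" "w = rho m (- n) z" by (simp_all add: rho_def)
    then show "(y, w) \<in> flat_orbit \<tau> (x, z)" unfolding mem_flat_orbit by blast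
  qed
  show "flat_orbit (- \<tau>) p = flat_orbit \<tau> p" for p using sub[of \<tau> p] sub[of "- \<tau>" p] by simp
qed

lemma ell_curve_uminus_tau: "ell_curve (- \<tau>) = ell_curve \<tau>"
  by (simp add: ell_curve_def ecls_uminus_tau)

lemma local_triv_uminus_tau: "local_triv (- \<tau>) = local_triv \<tau>"
  by (simp add: fun_eq_iff local_triv_def curve_open_def ell_curve_uminus_tau ecls_uminus_tau)

lemma compatible_uminus_tau: "compatible (- \<tau>) = compatible \<tau>"
  by (simp add: fun_eq_iff compatible_def ecls_uminus_tau)

lemma self_intersection_uminus_tau: "self_intersection (- \<tau>) = self_intersection \<tau>"
proof -
  have "fibre_coord (- \<tau>) S = fibre_coord \<tau> S" for S :: "'a fibration"
    by (simp add: fun_eq_iff fibre_coord_def local_triv_uminus_tau compatible_uminus_tau)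
  then show "self_intersection (- \<tau>) = (self_intersection \<tau> :: 'a fibration \<Rightarrow> _)"
    by (simp add: fun_eq_iff self_intersection_def normal_mero_section_def normal_section_divisor_def
        ell_curve_uminus_tau ecls_uminus_tau)
qed

lemma uminus_tau:
  "flat_surface (- \<tau>) = flat_surface \<tau>"
  "ruled_surface (- \<tau>) = ruled_surface \<tau>"
  "ruled_iso (- \<tau>) = ruled_iso \<tau>"
  "minimal_web (- \<tau>) = minimal_web \<tau>"
  "Ric (- \<tau>) = Ric \<tau>"
  by (simp_all add: fun_eq_iff flat_surface_def ruled_surface_def ruled_iso_def minimal_web_def is_section_def
      Ric_def flat_foliation_def flat_orbit_uminus_tau ecls_uminus_tau ell_curve_uminus_tau
      local_triv_uminus_tau compatible_uminus_tau self_intersection_uminus_tau)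

theorem proposition1p1:
  fixes \<tau> :: complex
    and S :: "'s fibration"
    and \<Phi> :: "'s \<Rightarrow> (complex \<times> P1) set"
  assumes "Im \<tau> \<noteq> 0"
    and "ruled_surface \<tau> S"
    and "stable_ruled \<tau> S"
    and "ruled_iso \<tau> S (flat_surface \<tau>) \<Phi>"
  shows "discriminant S (minimal_web \<tau> S) \<in> Ric \<tau> S \<Phi>"
proof -
  consider "Im \<tau> > 0" | "Im (- \<tau>) > 0" using assms(1) by fastforce
  then show ?thesis
  proof cases
    case 1
    interpret model \<tau> S \<Phi> using assms by unfold_locales
    show ?thesis using 1 by (rule discriminant_leaf)
  next
    case 2
    interpret model "- \<tau>" S \<Phi> by unfold_locales (use assms in \<open>simp_all add: uminus_tau\<close>)
    show ?thesis using discriminant_leaf[OF 2] by (simp add: uminus_tau)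
  qed
qed

end
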